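(* Let $(X,d)$ be a metric space, $W:X\to[0,+\infty)$ a continuous function, $x^-,x^+\in X$, and put $K:=\sqrt{2W}$. Assume: (i) $(X,d)$ is a proper length metric space; (ii) $K$ is continuous and $\Sigma:=\{x\in X: K(x)=0\}$ is finite; (iii) there is a function $k\in C^0([0,+\infty),[0,+\infty))$ with $\int_0^\infty k(t)\,dt=+\infty$ such that $K(x)\ge k(d(x,\Sigma))$ for all $x\in X$; (iv) $W(x^-)=W(x^+)=0$, and for every $x\in X\setminus\{x^-,x^+\}$ with $W(x)=0$ one has $d_K(x^-,x^+)<d_K(x^-,x)+d_K(x,x^+)$. Then there exists a heteroclinic connection between $x^-$ and $x^+$, i.e. a curve $\gamma\in\mathcal{L}(\mathbb{R},X)$ with $\gamma:x^-\mapsto x^+$ (that is, $\lim_{t\to\pm\infty}\gamma(t)=x^\pm$) such that $$E_W(\gamma)=\inf\{E_W(\sigma)\;:\;\sigma\in\mathcal{L}_{ploc}(\mathbb{R},X),\ \sigma:x^-\mapsto x^+\}.$$ Moreover, $E_W(\gamma)=d_K(x^-,x^+)$.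
   Context: Curves. A curve in a metric space $(X,d)$ is a continuous map $\gamma:I\to X$, with $I\subset\mathbb{R}$ a non-empty interval. $\mathcal{L}(I,X)$ and $\mathcal{L}_{loc}(I,X)$ denote the sets of Lipschitz and locally Lipschitz maps $I\to X$ (with respect to $d$). The set of piecewise locally Lipschitz maps is $$\mathcal{L}_{ploc}(I,X):=\{\gamma\in C(I,X):\exists\, t_0=\inf I<t_1<\dots<t_n=\sup I,\ \forall i,\ \gamma|_{I\cap(t_i,t_{i+1})}\in\mathcal{L}_{loc}(I\cap(t_i,t_{i+1}),X)\}$$ (where $t_0$, $t_n$ may be infinite). Metric derivative. For $\gamma\in\mathcal{L}_{ploc}(I,X)$, the metric derivative $|\dot\gamma|(t)=\lim_{s\to t}\frac{d(\gamma(t),\gamma(s))}{|t-s|}$ exists for a.e. $t\in I$ and is measurable. Paths. $\gamma:x^-\mapsto x^+$ means that $\gamma$ is a path from $x^-$ to $x^+$: there are $a^-\le a^+$ with $\gamma\in C^0([a^-,a^+],X)$ and $\gamma(a^\pm)=x^\pm$; infinite $a^\pm$ are allowed, with the convention $\gamma(\pm\infty):=\lim_{t\to\pm\infty}\gamma(t)$, the limit being required to exist. Length spaces and proper spaces. The length of a curve is $L_d(\gamma):=\sup\sum_{i=0}^{N-1}d(\gamma(t_i),\gamma(t_{i+1}))$, the supremum being over all $N\ge1$ and $t_0\le\dots\le t_N$ in $I$. $(X,d)$ is a length space if $d(x,y)=\inf\{L_d(\gamma):\gamma:x\mapsto y\}$ for all $x,y\in X$. A metric space is proper if every bounded closed subset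 is compact. $d(x,\Sigma):=\inf_{z\in\Sigma}d(x,z)$. Weighted length. For $\gamma\in\mathcal{L}_{ploc}(I,X)$, $L_K(\gamma):=\int_I K(\gamma(t))\,|\dot\gamma|(t)\,dt$, and for $x,y\in X$, $$d_K(x,y):=\inf\{L_K(\gamma)\;:\;\gamma\in\mathcal{L}_{ploc}(I,X),\ \gamma:x\mapsto y\}$$ (the infimum is over all intervals $I$ and all such curves). Energy. For $\gamma\in\mathcal{L}_{ploc}(\mathbb{R},X)$, $E_W(\gamma)=\int_{\mathbb{R}}\left(\frac12|\dot\gamma|^2(t)+W(\gamma(t))\right)dt\in[0,+\infty]$. *)

theory Defs
  imports "HOL-Analysis.Analysis"
begin

text \<open>
  A curve in a metric space is a non-empty real interval \<open>I\<close> together with a total function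
  \<open>\<gamma>\<close> on the reals, of which only the restriction to \<open>I\<close> is ever used.
\<close>

definition lipschitz_curve :: "real set \<Rightarrow> (real \<Rightarrow> 'a::metric_space) \<Rightarrow> bool" where
  "lipschitz_curve I \<gamma> \<longleftrightarrow> (\<exists>L. L-lipschitz_on I \<gamma>)"

definition loc_lipschitz_curve :: "real set \<Rightarrow> (real \<Rightarrow> 'a::metric_space) \<Rightarrow> bool" where
  "loc_lipschitz_curve I \<gamma> \<longleftrightarrow> (\<forall>t\<in>I. \<exists>u>0. \<exists>L. L-lipschitz_on (cball t u \<inter> I) \<gamma>)"

text \<open>
  The subdivision points are extended reals, since the ends of \<open>I\<close> may be infinite. The case
  \<open>n = 0\<close> occurs only for a one-point interval.
\<close>

definition ploc_lipschitz_curve :: "real set \<Rightarrow> (real \<Rightarrow> 'a::metric_space) \<Rightarrow> bool" where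
  "ploc_lipschitz_curve I \<gamma> \<longleftrightarrow>
     is_interval I \<and> I \<noteq> {} \<and> continuous_on I \<gamma> \<and>
     (\<exists>(n::nat) (\<tau>::nat \<Rightarrow> ereal).
        \<tau> 0 = (INF s\<in>I. ereal s) \<and> \<tau> n = (SUP s\<in>I. ereal s) \<and>
        (\<forall>i<n. \<tau> i < \<tau> (Suc i)) \<and>
        (\<forall>i<n. loc_lipschitz_curve {s\<in>I. \<tau> i < ereal s \<and> ereal s < \<tau> (Suc i)} \<gamma>))"

text \<open>
  Where the limit does not exist (a null set of \<open>t\<close>, for the curves considered here), the value
  is an unspecified constant, which does not affect the integrals below.
\<close>

definition metric_derivative :: "real set \<Rightarrow> (real \<Rightarrow> 'a::metric_space) \<Rightarrow> real \<Rightarrow> real" where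
  "metric_derivative I \<gamma> t = Lim (at t within I) (\<lambda>s. dist (\<gamma> t) (\<gamma> s) / \<bar>t - s\<bar>)"

text \<open>\<open>end_value \<gamma> a x\<close> says \<open>\<gamma>(a) = x\<close>, read as an existing limit when \<open>a\<close> is infinite.\<close>

definition end_value :: "(real \<Rightarrow> 'a::metric_space) \<Rightarrow> ereal \<Rightarrow> 'a \<Rightarrow> bool" where
  "end_value \<gamma> a x \<longleftrightarrow>
     (case a of ereal r \<Rightarrow> \<gamma> r = x
      | PInfty \<Rightarrow> (\<gamma> \<longlongrightarrow> x) at_top
      | MInfty \<Rightarrow> (\<gamma> \<longlongrightarrow> x) at_bot)"

text \<open>
  A path from \<open>x\<close> to \<open>y\<close> lives on the real part of an extended interval \<open>[a, b]\<close>; non-emptiness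
  rules out \<open>a = b = \<plusminus>\<infinity>\<close>.
\<close>

definition joins :: "real set \<Rightarrow> (real \<Rightarrow> 'a::metric_space) \<Rightarrow> 'a \<Rightarrow> 'a \<Rightarrow> bool" where
  "joins I \<gamma> x y \<longleftrightarrow>
     I \<noteq> {} \<and> continuous_on I \<gamma> \<and>
     (\<exists>a b::ereal. a \<le> b \<and> I = {t. a \<le> ereal t \<and> ereal t \<le> b} \<and>
        end_value \<gamma> a x \<and> end_value \<gamma> b y)"

definition curve_length :: "real set \<Rightarrow> (real \<Rightarrow> 'a::metric_space) \<Rightarrow> ennreal" where
  "curve_length I \<gamma> =
     Sup {ennreal (\<Sum>i<N. dist (\<gamma> (t i)) (\<gamma> (t (Suc i)))) | (N::nat) (t::nat \<Rightarrow> real).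
            1 \<le> N \<and> (\<forall>i\<le>N. t i \<in> I) \<and> (\<forall>i<N. t i \<le> t (Suc i))}"

definition proper_metric :: "'a::metric_space itself \<Rightarrow> bool" where
  "proper_metric _ \<longleftrightarrow> (\<forall>S::'a set. bounded S \<and> closed S \<longrightarrow> compact S)"

definition length_metric :: "'a::metric_space itself \<Rightarrow> bool" where
  "length_metric _ \<longleftrightarrow>
     (\<forall>x y::'a. ennreal (dist x y) = Inf {curve_length I \<gamma> | I \<gamma>. joins I \<gamma> x y})"

definition weighted_length ::
    "('a::metric_space \<Rightarrow> real) \<Rightarrow> real set \<Rightarrow> (real \<Rightarrow> 'a) \<Rightarrow> ennreal" where
  "weighted_length K I \<gamma> =
     (\<integral>\<^sup>+t\<in>I. ennreal (K (\<gamma> t) * metric_derivative I \<gamma> t) \<partial>lebesgue)"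

definition weighted_dist :: "('a::metric_space \<Rightarrow> real) \<Rightarrow> 'a \<Rightarrow> 'a \<Rightarrow> ennreal" where
  "weighted_dist K x y =
     Inf {weighted_length K I \<gamma> | I \<gamma>. ploc_lipschitz_curve I \<gamma> \<and> joins I \<gamma> x y}"

definition energy :: "('a::metric_space \<Rightarrow> real) \<Rightarrow> (real \<Rightarrow> 'a) \<Rightarrow> ennreal" where
  "energy W \<gamma> =
     (\<integral>\<^sup>+t. ennreal ((metric_derivative UNIV \<gamma> t)\<^sup>2 / 2 + W (\<gamma> t)) \<partial>lebesgue)"

lemma end_value_simps [simp]:
  "end_value \<gamma> (ereal r) x \<longleftrightarrow> \<gamma> r = x"
  "end_value \<gamma> \<infinity> x \<longleftrightarrow> (\<gamma> \<longlongrightarrow> x) at_top"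
  "end_value \<gamma> (-\<infinity>) x \<longleftrightarrow> (\<gamma> \<longlongrightarrow> x) at_bot"
  by (simp_all add: end_value_def flip: PInfty_eq_infinity MInfty_eq_minfinity)

lemma joins_UNIV_iff:
  "joins UNIV \<gamma> x y \<longleftrightarrow>
     continuous_on UNIV \<gamma> \<and> (\<gamma> \<longlongrightarrow> x) at_bot \<and> (\<gamma> \<longlongrightarrow> y) at_top"
proof
  assume "joins UNIV \<gamma> x y"
  then obtain a b where cont: "continuous_on UNIV \<gamma>"
    and I: "UNIV = {t. a \<le> ereal t \<and> ereal t \<le> b}"
    and ends: "end_value \<gamma> a x" "end_value \<gamma> b y"
    unfolding joins_def by blast
  have le: "a \<le> ereal t \<and> ereal t \<le> b" for t
    using I by blast
  have "a = -\<infinity>" "b = \<infinity>"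
    using le by (blast intro: ereal_bot ereal_top)+
  with cont ends show "continuous_on UNIV \<gamma> \<and> (\<gamma> \<longlongrightarrow> x) at_bot \<and> (\<gamma> \<longlongrightarrow> y) at_top"
    by simp
next
  assume R: "continuous_on UNIV \<gamma> \<and> (\<gamma> \<longlongrightarrow> x) at_bot \<and> (\<gamma> \<longlongrightarrow> y) at_top"
  show "joins UNIV \<gamma> x y"
    unfolding joins_def
  proof (intro conjI exI)
    show "(-\<infinity>::ereal) \<le> \<infinity>" by simp
    show "UNIV = {t. -\<infinity> \<le> ereal t \<and> ereal t \<le> \<infinity>}" by simp
  qed (use R in simp_all)
qed

end

theory Submission
  imports Defs
begin

text \<open>
  A minimiser of the energy is a geodesic of the weighted distance, traversed at the right
  speed. Since \<open>W = K\<^sup>2 / 2\<close>, the arithmetic-geometric mean inequality bounds the energy density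
  from below by \<open>K\<close> times the speed, with equality when the speed equals \<open>K\<close>. Hence the energy of
  any competitor is at least its weighted length, and it suffices to find one Lipschitz curve
  whose energy is at most the weighted distance of the two end points.

  Geodesics are not found among curves but as limits of finite chains. A link from \<open>p\<close> to \<open>q\<close>
  costs \<open>max (K p) (K q) * dist p q\<close>; the chain distance \<open>chain_dist\<close> is the limit, as the mesh
  tends to zero, of the cost of the cheapest chain. Upper bounds for it come from single
  chains, lower bounds from calibrations (\<open>calibration_le_mesh_dist\<close>), that is, from functions
  that no link can increase by more than its cost. The length-space property makes it finite.
  A calibration built from a primitive of \<open>k\<close> shows that chains of bounded cost starting in a
  zero of \<open>K\<close> stay in a compact set (\<open>mesh_dist_confines\<close>), and this is where the divergence of
  the integral of \<open>k\<close> enters. A calibration that varies only in an annulus around a point shows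
  that points at small chain distance are close (\<open>chain_dist_separates\<close>), because the zeros of \<open>K\<close>
  are isolated.

  Parametrise nearly optimal chains by accumulated cost. A pointwise cluster point \<open>f\<close> on
  \<open>[0, 1]\<close>, which exists by Tychonoff's theorem, satisfies \<open>cost (f s) (f t) \<le> C * \<bar>t - s\<bar>\<close>, where
  \<open>C\<close> is the cost between its end points (\<open>geodesic_exists\<close>). Such an \<open>f\<close> is continuous and, if its
  end points differ, injective, so it meets each zero of \<open>K\<close> at most once; away from these
  finitely many times it is locally Lipschitz with \<open>K\<close> times speed at most \<open>C\<close>. It is therefore an
  admissible curve of weighted length at most \<open>C\<close>. As the chain distance never exceeds the
  weighted length of a curve (\<open>chain_dist_le_weighted_dist\<close>), chain distance and weighted
  distance agree from any zero of \<open>K\<close> to any point (\<open>weighted_dist_eq_cost\<close>); no curves have to be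
  concatenated or reparametrised for this.

  The strict triangle inequality keeps the geodesic between the two wells away from all zeros
  in the open interval. There the time change \<open>\<phi>\<close> with derivative \<open>C / K\<^sup>2\<close> is continuously
  differentiable and increasing, and running through \<open>f\<close> along its inverse \<open>\<psi>\<close> gives a curve with
  speed at most \<open>K\<close>. Its energy is at most the integral of \<open>K\<^sup>2 = C * \<psi>'\<close>, which is at most \<open>C\<close>. If
  \<open>\<phi>\<close> is bounded on one side, the curve reaches a well in finite time and stays there.

  All of this depends on the existence almost everywhere of the metric derivative of a
  Lipschitz curve and on the bound of distances by its integral. Both are reduced to
  Lebesgue's theorem that a monotone Lipschitz function on the line is differentiable almost
  everywhere, proved with Vitali coverings.
\<close>

section \<open>Differentiation of monotone Lipschitz functions\<close>

text \<open>
  Vitali's covering theorem for balls in the line, rewritten for a family of intervals that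
  need not be centred at the points they cover: a difference quotient at \<open>x\<close> belongs to an
  interval with end point \<open>x\<close>.
\<close>

lemma Vitali_intervals:
  fixes E :: "real set" and K :: "(real \<times> real) set"
  assumes lt: "\<And>s t. (s, t) \<in> K \<Longrightarrow> s < t"
    and fine: "\<And>x d. x \<in> E \<Longrightarrow> 0 < d \<Longrightarrow> \<exists>s t. (s, t) \<in> K \<and> s \<le> x \<and> x \<le> t \<and> t - s < d"
  obtains C where "countable C" "C \<subseteq> K" "disjoint_family_on (\<lambda>(s, t). {s..t}) C"
    "negligible (E - (\<Union>(s, t)\<in>C. {s..t}))"
proof -
  define c r where "c = (\<lambda>(s, t). (s + t) / 2 :: real)" and "r = (\<lambda>(s, t). (t - s) / 2 :: real)"
  have cb: "cball (c i) (r i) = (\<lambda>(s, t). {s..t}) i" for i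
    by (cases i) (auto simp: c_def r_def cball_eq_atLeastAtMost field_simps)
  have fine': "\<exists>i. i \<in> K \<and> x \<in> cball (c i) (r i) \<and> r i < d" if x: "x \<in> E" and d: "0 < d" for x d
  proof -
    obtain s t where st: "(s, t) \<in> K" "s \<le> x" "x \<le> t" "t - s < d"
      using fine[OF x d] by blast
    then have "r (s, t) < d" "x \<in> cball (c (s, t)) (r (s, t))"
      using lt[OF st(1)] unfolding cb by (auto simp: r_def)
    with st show ?thesis by blast
  qed
  have pos: "0 < r i" if "i \<in> K" for i
    using that lt by (cases i) (auto simp: r_def)
  obtain C where C: "countable C" "C \<subseteq> K"
     "pairwise (\<lambda>i j. disjnt (cball (c i) (r i)) (cball (c j) (r j))) C"
     "negligible(E - (\<Union>i \<in> C. cball (c i) (r i)))"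
    by (rule Vitali_covering_theorem_cballs[of K r E c, OF pos fine'])
  show thesis
  proof (rule that[OF C(1,2)])
    show "disjoint_family_on (\<lambda>(s, t). {s..t}) C"
      using C(3) unfolding disjoint_family_on_def pairwise_def disjnt_def cb by blast
    show "negligible (E - (\<Union>(s, t)\<in>C. {s..t}))"
      using C(4) unfolding cb .
  qed
qed

lemma emeasure_countable_intervals:
  fixes f :: "real \<Rightarrow> real"
  assumes C: "countable C" "disjoint_family_on (\<lambda>(s, t). {s..t}) C"
    and lt: "\<And>s t. (s, t) \<in> C \<Longrightarrow> s \<le> t"
    and f: "mono f" "continuous_on UNIV f"
  shows "emeasure (interval_measure f) (\<Union>(s, t)\<in>C. {s..t}) =
    (\<integral>\<^sup>+(s, t). ennreal (f t - f s) \<partial>count_space C)"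
proof -
  have "emeasure (interval_measure f) (\<Union>i\<in>C. (\<lambda>(s, t). {s..t}) i) =
    (\<integral>\<^sup>+i. emeasure (interval_measure f) ((\<lambda>(s, t). {s..t}) i) \<partial>count_space C)"
    by (rule emeasure_UN_countable) (use C in auto)
  also have "\<dots> = (\<integral>\<^sup>+(s, t). ennreal (f t - f s) \<partial>count_space C)"
  proof (intro nn_integral_cong, clarsimp)
    fix s t assume "(s, t) \<in> C"
    then show "emeasure (interval_measure f) {s..t} = ennreal (f t - f s)"
      using lt f by (intro emeasure_interval_measure_Icc) (auto dest: monoD)
  qed
  finally show ?thesis .
qed

lemma emeasure_lborel_countable_intervals:
  fixes C :: "(real \<times> real) set"
  assumes C: "countable C" "disjoint_family_on (\<lambda>(s, t). {s..t}) C"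
    and lt: "\<And>s t. (s, t) \<in> C \<Longrightarrow> s \<le> t"
  shows "emeasure lborel (\<Union>(s, t)\<in>C. {s..t}) = (\<integral>\<^sup>+(s, t). ennreal (t - s) \<partial>count_space C)"
  using emeasure_countable_intervals[OF assms, of "\<lambda>x. x"]
  by (simp add: lborel_eq_real mono_def)

lemma emeasure_lborel_le_covered:
  fixes E :: "real set"
  assumes "E \<in> sets borel" "W \<in> sets borel" "negligible (E - W)"
  shows "emeasure lborel E \<le> emeasure lborel W"
proof -
  have "emeasure lborel (E - W) = 0"
    using assms by (simp add: negligible_iff_null_sets null_sets_completion_iff null_sets_def)
  moreover have "emeasure lborel E \<le> emeasure lborel (W \<union> (E - W))"
    using assms by (intro emeasure_mono) auto
  moreover have "\<dots> \<le> emeasure lborel W + emeasure lborel (E - W)"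
    using assms by (intro emeasure_subadditive) auto
  ultimately show ?thesis by simp
qed

definition slope :: "(real \<Rightarrow> real) \<Rightarrow> real \<Rightarrow> real \<Rightarrow> real" where
  "slope f x s = (f s - f x) / (s - x)"

lemma slope_commute: "slope f x s = slope f s x"
  by (simp add: slope_def divide_simps) (auto simp: algebra_simps)

lemma frequently_slope_interval:
  assumes fr: "\<exists>\<^sub>F s in at x. P (slope f x s)" and d: "0 < d" and U: "open U" "x \<in> U"
  obtains s t where "s < t" "s \<le> x" "x \<le> t" "t - s < d" "{s..t} \<subseteq> U" "P (slope f s t)"
proof -
  obtain e where e: "e > 0" "\<And>y. dist y x < e \<Longrightarrow> y \<in> U"
    using U unfolding open_dist by blast
  have "\<forall>\<^sub>F s in at x. s \<noteq> x \<and> dist s x < min e d"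
    using e d by (auto simp: eventually_at intro!: exI[of _ "min e d"])
  from frequently_ex[OF frequently_eventually_frequently[OF fr this]]
  obtain s where s: "P (slope f x s)" "s \<noteq> x" "dist s x < min e d" by blast
  show thesis
  proof (cases "s < x")
    case True
    show thesis
      by (rule that[of s x]) (use True s e in \<open>auto simp: dist_real_def slope_commute\<close>)
  next
    case False
    show thesis
      by (rule that[of x s]) (use False s e in \<open>auto simp: dist_real_def\<close>)
  qed
qed

text \<open>
  The Stieltjes measure of \<open>f\<close> turns growth on disjoint intervals into a countably additive
  quantity. Where small slopes occur at arbitrarily small scales, disjoint intervals of small
  slope inside \<open>U\<close> exhaust almost all of \<open>E\<close>; passing to their interiors costs only countably many
  points and makes the set open, so that the next lemma can be applied inside it.
\<close>

lemma cover_small_slopes: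
  fixes f :: "real \<Rightarrow> real"
  assumes f: "mono f" "continuous_on UNIV f"
    and p: "0 \<le> p" and U: "open U" "E \<subseteq> U"
    and fr: "\<And>x. x \<in> E \<Longrightarrow> \<exists>\<^sub>F s in at x. slope f x s < p"
  obtains V where "open V" "V \<subseteq> U" "negligible (E - V)"
    "emeasure (interval_measure f) V \<le> ennreal p * emeasure lborel U"
proof -
  define K where "K = {(s, t). s < t \<and> {s..t} \<subseteq> U \<and> slope f s t < p}"
  have fine: "\<exists>s t. (s, t) \<in> K \<and> s \<le> x \<and> x \<le> t \<and> t - s < d" if x: "x \<in> E" and d: "0 < d" for x d
  proof -
    obtain s t where "s < t" "s \<le> x" "x \<le> t" "t - s < d" "{s..t} \<subseteq> U" "slope f s t < p"
      using frequently_slope_interval[where P="\<lambda>y. y < p", OF fr[OF x] d U(1)] U(2) x by blast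
    then show ?thesis unfolding K_def by blast
  qed
  have lt0: "s < t" if "(s, t) \<in> K" for s t
    using that by (simp add: K_def)
  obtain C where C: "countable C" "C \<subseteq> K" "disjoint_family_on (\<lambda>(s, t). {s..t}) C"
    "negligible (E - (\<Union>(s, t)\<in>C. {s..t}))"
    by (rule Vitali_intervals[of K E, OF lt0 fine])
  have lt: "s \<le> t" if "(s, t) \<in> C" for s t
    using C(2) that unfolding K_def by auto
  define V where "V = (\<Union>(s, t)\<in>C. {s<..<t})"
  let ?W = "\<Union>(s, t)\<in>C. {s..t}"
  have V: "V \<subseteq> ?W" unfolding V_def by (intro UN_mono) auto
  have W: "?W \<subseteq> U" using C(2) unfolding K_def by auto
  show thesis
  proof (rule that)
    show "open V" unfolding V_def by auto
    show "V \<subseteq> U" using V W by blast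
    have "countable (fst ` C \<union> snd ` C)" using C(1) by auto
    then have "negligible (fst ` C \<union> snd ` C)"
      by (simp add: negligible_iff_null_sets null_sets_completionI countable_imp_null_set_lborel)
    then have "negligible ((E - ?W) \<union> (fst ` C \<union> snd ` C))"
      using C(4) negligible_Un by blast
    then show "negligible (E - V)"
    proof (rule negligible_subset, intro subsetI)
      fix x assume x: "x \<in> E - V"
      show "x \<in> (E - ?W) \<union> (fst ` C \<union> snd ` C)"
      proof (cases "x \<in> ?W")
        case True
        then obtain s t where st: "(s, t) \<in> C" "s \<le> x" "x \<le> t" by auto
        with x have "x = s \<or> x = t" unfolding V_def by force
        with st show ?thesis by force
      qed (use x in auto)
    qed
    have "emeasure (interval_measure f) V \<le> emeasure (interval_measure f) ?W"
      using C(1) by (intro emeasure_mono V) auto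
    also have "\<dots> = (\<integral>\<^sup>+(s, t). ennreal (f t - f s) \<partial>count_space C)"
      by (rule emeasure_countable_intervals[OF C(1,3) lt f])
    also have "\<dots> \<le> (\<integral>\<^sup>+i. ennreal p * (\<lambda>(s, t). ennreal (t - s)) i \<partial>count_space C)"
    proof (intro nn_integral_mono, clarsimp)
      fix s t assume "(s, t) \<in> C"
      then have "s < t" "slope f s t < p" using C(2) unfolding K_def by auto
      then have "f t - f s \<le> p * (t - s)" by (simp add: slope_def field_simps)
      then show "ennreal (f t - f s) \<le> ennreal p * ennreal (t - s)"
        using p \<open>s < t\<close> by (simp add: ennreal_leI flip: ennreal_mult)
    qed
    also have "\<dots> = ennreal p * (\<integral>\<^sup>+(s, t). ennreal (t - s) \<partial>count_space C)"
      by (rule nn_integral_cmult) auto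
    also have "\<dots> = ennreal p * emeasure lborel ?W"
      by (simp add: emeasure_lborel_countable_intervals[OF C(1,3) lt])
    also have "\<dots> \<le> ennreal p * emeasure lborel U"
      using U by (intro mult_left_mono emeasure_mono W) auto
    finally show "emeasure (interval_measure f) V \<le> ennreal p * emeasure lborel U" .
  qed
qed

text \<open>
  The same covering, now with intervals of large slope, which bounds the growth of \<open>f\<close> from
  below.
\<close>

lemma emeasure_le_large_slopes:
  fixes f :: "real \<Rightarrow> real"
  assumes f: "mono f" "continuous_on UNIV f"
    and q: "0 \<le> q" and V: "open V" "E \<subseteq> V" and E: "E \<in> sets borel"
    and fr: "\<And>x. x \<in> E \<Longrightarrow> \<exists>\<^sub>F s in at x. q < slope f x s"
  shows "ennreal q * emeasure lborel E \<le> emeasure (interval_measure f) V"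
proof -
  define K where "K = {(s, t). s < t \<and> {s..t} \<subseteq> V \<and> q < slope f s t}"
  have fine: "\<exists>s t. (s, t) \<in> K \<and> s \<le> x \<and> x \<le> t \<and> t - s < d" if x: "x \<in> E" and d: "0 < d" for x d
  proof -
    obtain s t where "s < t" "s \<le> x" "x \<le> t" "t - s < d" "{s..t} \<subseteq> V" "q < slope f s t"
      using frequently_slope_interval[where P="\<lambda>y. q < y", OF fr[OF x] d V(1)] V(2) x by blast
    then show ?thesis unfolding K_def by blast
  qed
  have lt0: "s < t" if "(s, t) \<in> K" for s t
    using that by (simp add: K_def)
  obtain C where C: "countable C" "C \<subseteq> K" "disjoint_family_on (\<lambda>(s, t). {s..t}) C"
    "negligible (E - (\<Union>(s, t)\<in>C. {s..t}))"
    by (rule Vitali_intervals[of K E, OF lt0 fine])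
  have lt: "s \<le> t" if "(s, t) \<in> C" for s t
    using C(2) that unfolding K_def by auto
  let ?W = "\<Union>(s, t)\<in>C. {s..t}"
  have Wb: "?W \<in> sets borel" using C(1) by auto
  have W: "?W \<subseteq> V" using C(2) unfolding K_def by auto
  have "ennreal q * emeasure lborel E \<le> ennreal q * emeasure lborel ?W"
    by (intro mult_left_mono emeasure_lborel_le_covered E Wb C(4)) simp
  also have "\<dots> = ennreal q * (\<integral>\<^sup>+(s, t). ennreal (t - s) \<partial>count_space C)"
    by (simp add: emeasure_lborel_countable_intervals[OF C(1,3) lt])
  also have "\<dots> = (\<integral>\<^sup>+i. ennreal q * (\<lambda>(s, t). ennreal (t - s)) i \<partial>count_space C)"
    by (rule nn_integral_cmult[symmetric]) auto
  also have "\<dots> \<le> (\<integral>\<^sup>+(s, t). ennreal (f t - f s) \<partial>count_space C)"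
  proof (intro nn_integral_mono, clarsimp)
    fix s t assume "(s, t) \<in> C"
    then have "s < t" "q < slope f s t" using C(2) unfolding K_def by auto
    then have "q * (t - s) \<le> f t - f s" by (simp add: slope_def field_simps)
    then show "ennreal q * ennreal (t - s) \<le> ennreal (f t - f s)"
      using q \<open>s < t\<close> by (simp add: ennreal_leI flip: ennreal_mult)
  qed
  also have "\<dots> = emeasure (interval_measure f) ?W"
    by (rule emeasure_countable_intervals[OF C(1,3) lt f, symmetric])
  also have "\<dots> \<le> emeasure (interval_measure f) V"
    using V by (intro emeasure_mono W) auto
  finally show ?thesis .
qed

text \<open>
  For a fixed second point \<open>s\<close> the slope is continuous in \<open>x\<close>, so the set in question is a
  countable intersection of open sets.
\<close>

lemma borel_frequently_slope:
  fixes f :: "real \<Rightarrow> real"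
  assumes f: "continuous_on UNIV f" and P: "open {y. P y}"
  shows "{x. \<exists>\<^sub>F s in at x. P (slope f x s)} \<in> sets borel"
proof -
  have eq: "{x. \<exists>\<^sub>F s in at x. P (slope f x s)} =
    (\<Inter>n. \<Union>s. {x \<in> ball s (inverse (Suc n)) - {s}. P (slope f x s)})" (is "?L = ?R")
  proof (intro set_eqI iffI)
    fix x assume "x \<in> ?L"
    then have fr: "\<exists>\<^sub>F s in at x. P (slope f x s)" by simp
    show "x \<in> ?R"
    proof safe
      fix n
      have "\<forall>\<^sub>F s in at x. s \<noteq> x \<and> dist s x < inverse (real (Suc n))"
        unfolding eventually_at by (rule exI[of _ "inverse (real (Suc n))"]) auto
      from frequently_ex[OF frequently_eventually_frequently[OF fr this]]
      obtain s where "P (slope f x s)" "s \<noteq> x" "dist s x < inverse (real (Suc n))" by blast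
      then show "x \<in> (\<Union>s. {x \<in> ball s (inverse (Suc n)) - {s}. P (slope f x s)})" by auto
    qed
  next
    fix x assume R: "x \<in> ?R"
    have "\<exists>s. s \<noteq> x \<and> dist s x < d \<and> P (slope f x s)" if "d > 0" for d
    proof -
      obtain n where "inverse (real (Suc n)) < d" using \<open>d > 0\<close> reals_Archimedean by blast
      moreover obtain s where "x \<in> ball s (inverse (Suc n)) - {s}" "P (slope f x s)"
        using R by blast
      ultimately show ?thesis by (intro exI[of _ s]) auto
    qed
    then show "x \<in> ?L" unfolding frequently_def eventually_at by auto
  qed
  have "open {x \<in> ball s (inverse (Suc n)) - {s}. P (slope f x s)}" for s n
  proof -
    have "continuous_on (ball s (inverse (Suc n)) - {s}) (\<lambda>x. slope f x s)"
      unfolding slope_def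
      by (intro continuous_intros continuous_on_subset[OF f]) auto
    then have "open ((ball s (inverse (Suc n)) - {s}) \<inter> (\<lambda>x. slope f x s) -` {y. P y})"
      by (rule continuous_open_preimage) (auto intro: P)
    then show ?thesis by (simp add: vimage_def Int_def)
  qed
  then have "(\<Union>s. {x \<in> ball s (inverse (Suc n)) - {s}. P (slope f x s)}) \<in> sets borel" for n
    by (intro borel_open open_UN) auto
  then show ?thesis unfolding eq by (intro sets.countable_INT) auto
qed

text \<open>
  Let \<open>E\<close> be the part of the set in a bounded interval. If \<open>U\<close> is an open set slightly larger than
  \<open>E\<close>, small slopes give an open \<open>V \<subseteq> U\<close> on which \<open>f\<close> grows by at most \<open>p\<close> times the measure of \<open>U\<close>,
  while large slopes inside \<open>V\<close> force growth of at least \<open>q\<close> times the measure of \<open>E\<close>. As \<open>p < q\<close>, the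
  measure of \<open>E\<close> must vanish.
\<close>

lemma null_oscillating_slopes:
  fixes f :: "real \<Rightarrow> real"
  assumes f: "mono f" "continuous_on UNIV f" and pq: "0 \<le> p" "p < q"
  shows "negligible {x. (\<exists>\<^sub>F s in at x. slope f x s < p) \<and> (\<exists>\<^sub>F s in at x. q < slope f x s)}"
    (is "negligible ?E")
proof -
  have Eb: "?E \<in> sets borel"
    using borel_frequently_slope[OF f(2), of "\<lambda>y. y < p"] borel_frequently_slope[OF f(2), of "\<lambda>y. q < y"]
    by (auto simp: Collect_conj_eq open_Collect_less)
  have "negligible (?E \<inter> {-r<..<r})" for r :: real
  proof -
    let ?A = "?E \<inter> {-r<..<r}"
    have Ab: "?A \<in> sets borel" using Eb by auto
    have fin: "emeasure lborel ?A < \<infinity>"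
      using emeasure_bounded_finite[of ?A] bounded_subset[of "{-r<..<r}" ?A] by auto
    have le: "ennreal q * emeasure lborel ?A \<le> ennreal p * (emeasure lborel ?A + ennreal e)" if e: "0 < e" for e
    proof -
      obtain U where U: "open U" "?A \<subseteq> U" "emeasure lborel (U - ?A) < ennreal e"
        using outer_regular_lborel[OF Ab e] by auto
      obtain V where V: "open V" "V \<subseteq> U" "negligible (?A - V)"
        "emeasure (interval_measure f) V \<le> ennreal p * emeasure lborel U"
        using cover_small_slopes[OF f pq(1) U(1,2)] by blast
      have "negligible (?A - ?A \<inter> V)" using V(3) by (simp add: Diff_Int_distrib Diff_Int)
      then have "ennreal q * emeasure lborel ?A \<le> ennreal q * emeasure lborel (?A \<inter> V)"
        using Ab V(1) by (intro mult_left_mono emeasure_lborel_le_covered) auto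
      also have "\<dots> \<le> emeasure (interval_measure f) V"
        using V(1) Ab pq by (intro emeasure_le_large_slopes f) auto
      also have "\<dots> \<le> ennreal p * emeasure lborel U" by (rule V(4))
      also have "\<dots> \<le> ennreal p * (emeasure lborel ?A + emeasure lborel (U - ?A))"
        using U Ab emeasure_subadditive[of ?A lborel "U - ?A"]
        by (intro mult_left_mono) (auto simp: Un_absorb1)
      also have "\<dots> \<le> ennreal p * (emeasure lborel ?A + ennreal e)"
        using U(3) by (intro mult_left_mono add_left_mono) auto
      finally show ?thesis .
    qed
    obtain a where a: "emeasure lborel ?A = ennreal a" "0 \<le> a"
      using fin by (cases "emeasure lborel ?A") auto
    have qa: "q * a \<le> p * (a + e)" if "0 < e" for e
      using le[OF that] a pq that by (simp add: ennreal_le_iff flip: ennreal_mult ennreal_plus)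
    (* dividing by \<open>p + 1\<close> rather than \<open>p\<close> includes the case \<open>p = 0\<close> *)
    have "q * a \<le> p * a + e" if e: "0 < e" for e
    proof -
      have "q * a \<le> p * (a + e / (p + 1))" using qa[of "e / (p + 1)"] e pq by simp
      also have "\<dots> = p * a + e * (p / (p + 1))" by (simp add: algebra_simps)
      also have "\<dots> \<le> p * a + e * 1" using e pq by (intro add_left_mono mult_left_mono) auto
      finally show ?thesis by simp
    qed
    then have "q * a \<le> p * a" by (rule field_le_epsilon)
    then have "(q - p) * a \<le> 0" by (simp add: algebra_simps)
    then have "a = 0" using pq a(2) by (simp add: mult_le_0_iff)
    then show ?thesis
      using a Ab by (simp add: negligible_iff_null_sets null_sets_completion_iff null_sets_def)
  qed
  then have "negligible (\<Union>n. ?E \<inter> {-real n<..<real n})"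
    by (intro negligible_countable_Union) auto
  moreover have "(\<Union>n. ?E \<inter> {-real n<..<real n}) = ?E"
  proof -
    have "\<exists>n. x \<in> {-real n<..<real n}" for x
      using reals_Archimedean2[of "\<bar>x\<bar>"] by (auto simp: abs_less_iff) (smt (verit))
    then show ?thesis by blast
  qed
  ultimately show ?thesis by simp
qed

text \<open>
  Rational levels suffice to detect oscillation, which leaves countably many exceptional null
  sets below.
\<close>

lemma tendsto_of_no_oscillation:
  fixes h :: "'b \<Rightarrow> real"
  assumes F: "F \<noteq> bot" and bdd: "\<forall>\<^sub>F s in F. 0 \<le> h s \<and> h s \<le> L"
    and osc: "\<And>p q. p \<in> \<rat> \<Longrightarrow> q \<in> \<rat> \<Longrightarrow> 0 \<le> p \<Longrightarrow> p < q \<Longrightarrow>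
      \<not> ((\<exists>\<^sub>F s in F. h s < p) \<and> (\<exists>\<^sub>F s in F. q < h s))"
  shows "\<exists>l. (h \<longlongrightarrow> l) F"
proof -
  define A where "A = {r. \<forall>\<^sub>F s in F. r \<le> h s}"
  have 0: "0 \<in> A" unfolding A_def using bdd by (auto elim: eventually_mono)
  have ub: "r \<le> L" if "r \<in> A" for r
  proof -
    have "\<forall>\<^sub>F s in F. r \<le> L" using that bdd unfolding A_def by (auto elim: eventually_elim2)
    then show ?thesis using F by simp
  qed
  then have bA: "bdd_above A" by (auto simp: bdd_above_def)
  have "(h \<longlongrightarrow> Sup A) F"
  proof (rule order_tendstoI)
    fix a assume "a < Sup A"
    then obtain r where "r \<in> A" "a < r" using 0 less_cSupD[of A a] by blast
    then show "\<forall>\<^sub>F s in F. a < h s" unfolding A_def by (auto elim: eventually_mono)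
  next
    fix a assume a: "Sup A < a"
    obtain q where q: "q \<in> \<rat>" "Sup A < q" "q < a" using Rats_dense_in_real[OF a] by blast
    obtain p where p: "p \<in> \<rat>" "Sup A < p" "p < q" using Rats_dense_in_real[OF q(2)] by blast
    have "p \<notin> A" using p(2) cSup_upper[OF _ bA, of p] by auto
    then have "\<exists>\<^sub>F s in F. h s < p" unfolding A_def frequently_def by (simp add: not_less)
    moreover have "0 \<le> p" using cSup_upper[OF 0 bA] p by simp
    ultimately have "\<not> (\<exists>\<^sub>F s in F. q < h s)" using osc[of p q] p q by blast
    then show "\<forall>\<^sub>F s in F. h s < a" unfolding frequently_def using q
      by (auto elim!: eventually_mono)
  qed
  then show ?thesis by blast
qed

text \<open>
  Lebesgue's differentiation theorem. The Lipschitz bound excludes infinite derivatives, so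
  only oscillation between two levels has to be ruled out.
\<close>

theorem mono_lipschitz_differentiable_ae:
  fixes f :: "real \<Rightarrow> real"
  assumes mono: "mono f" and lip: "L-lipschitz_on UNIV f"
  shows "AE x in lebesgue. f differentiable (at x)"
proof -
  have cont: "continuous_on UNIV f" using lip by (rule lipschitz_on_continuous_on)
  define N where "N = (\<Union>(p, q)\<in>{(p, q). p \<in> \<rat> \<and> q \<in> \<rat> \<and> 0 \<le> p \<and> p < q}.
    {x. (\<exists>\<^sub>F s in at x. slope f x s < p) \<and> (\<exists>\<^sub>F s in at x. q < slope f x s)})"
  have "countable {(p::real, q). p \<in> \<rat> \<and> q \<in> \<rat> \<and> 0 \<le> p \<and> p < q}"
    by (rule countable_subset[OF _ countable_SIGMA[OF countable_rat, of "\<lambda>_. \<rat>"]])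
      (auto simp: countable_rat)
  then have "negligible N"
    unfolding N_def by (intro negligible_countable_Union)
      (auto intro!: null_oscillating_slopes mono cont simp: split_beta)
  then have "N \<in> null_sets lebesgue" by (simp add: negligible_iff_null_sets)
  then show ?thesis
  proof (rule AE_I', intro subsetI)
    fix x assume x: "x \<in> {x \<in> space lebesgue. \<not> f differentiable at x}"
    show "x \<in> N"
    proof (rule ccontr)
      assume "x \<notin> N"
      moreover have "0 \<le> slope f x s \<and> slope f x s \<le> L" if "s \<noteq> x" for s
      proof -
        have "\<bar>f s - f x\<bar> \<le> L * \<bar>s - x\<bar>"
          using lipschitz_onD[OF lip, of s x] by (simp add: dist_real_def)
        then have "\<bar>slope f x s\<bar> \<le> L"
          using that by (simp add: slope_def abs_divide divide_simps)
        moreover have "0 \<le> slope f x s"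
          using mono that by (cases "s < x")
            (auto simp: slope_def mono_def divide_nonpos_neg)
        ultimately show ?thesis by auto
      qed
      then have "\<forall>\<^sub>F s in at x. 0 \<le> slope f x s \<and> slope f x s \<le> L"
        by (auto simp: eventually_at_filter)
      ultimately have "\<exists>l. (slope f x \<longlongrightarrow> l) (at x)"
        by (intro tendsto_of_no_oscillation) (auto simp: N_def)
      then obtain l where "(slope f x \<longlongrightarrow> l) (at x)" by blast
      then have "(f has_real_derivative l) (at x)"
        by (simp add: has_field_derivative_iff slope_def[abs_def])
      then show False using x by (auto simp: real_differentiable_def)
    qed
  qed
qed

section \<open>Metric derivatives of Lipschitz curves\<close>

lemma AE_not_in_finite:
  fixes T :: "real set"
  assumes "finite T"
  shows "AE t in lebesgue. t \<notin> T"
  using negligible_finite[OF assms] by (simp only: AE_not_in negligible_iff_null_sets)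

lemma nn_integral_has_integral_on:
  fixes f :: "real \<Rightarrow> real"
  assumes "(f has_integral I) S" "\<And>x. x \<in> S \<Longrightarrow> 0 \<le> f x"
  shows "(\<integral>\<^sup>+x\<in>S. ennreal (f x) \<partial>lebesgue) = ennreal I"
  using nn_integral_has_integral_lebesgue'[of S f I] assms by (simp add: nn_integral_completion)

lemma nn_integral_exhaustion_le:
  fixes g :: "real \<Rightarrow> ennreal"
  assumes "\<And>n. (\<lambda>t. g t * indicator (A n) t) \<in> borel_measurable lebesgue" "incseq A"
    and "\<And>n. (\<integral>\<^sup>+t\<in>A n. g t \<partial>lebesgue) \<le> C"
  shows "(\<integral>\<^sup>+t\<in>(\<Union>n. A n). g t \<partial>lebesgue) \<le> C"
proof -
  have "g t * indicator (\<Union>n. A n) t \<le> (SUP n. g t * indicator (A n) t)" for t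
  proof (cases "t \<in> (\<Union>n. A n)")
    case True
    then obtain n where "t \<in> A n" by blast
    then show ?thesis using True by (auto intro!: SUP_upper2[of n])
  qed simp
  then have "(\<integral>\<^sup>+t\<in>(\<Union>n. A n). g t \<partial>lebesgue) \<le> (\<integral>\<^sup>+t. (SUP n. g t * indicator (A n) t) \<partial>lebesgue)"
    by (intro nn_integral_mono)
  also have "\<dots> = (SUP n. \<integral>\<^sup>+t\<in>A n. g t \<partial>lebesgue)"
  proof (rule nn_integral_monotone_convergence_SUP[OF _ assms(1)])
    show "incseq (\<lambda>n t. g t * indicator (A n) t)"
      using assms(2) by (auto simp: incseq_def le_fun_def indicator_def subset_iff)
  qed
  also have "\<dots> \<le> C" by (intro SUP_least assms(3))
  finally show ?thesis .
qed

text \<open>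
  The fundamental theorem of calculus for Lipschitz functions. Adding a linear function makes
  \<open>f\<close> monotone, which gives the derivative almost everywhere. The integral of the difference
  quotient \<open>(f (x + h) - f x) / h\<close> over \<open>[a, b]\<close> is the difference of two averages of \<open>f\<close> near \<open>b\<close> and
  \<open>a\<close>, and bounded convergence applies as \<open>h\<close> tends to zero.
\<close>

lemma lipschitz_real_ae_derivative:
  fixes f :: "real \<Rightarrow> real"
  assumes lip: "L-lipschitz_on UNIV f"
  obtains g Z where "negligible Z" "\<And>x. x \<notin> Z \<Longrightarrow> (f has_real_derivative g x) (at x)"
    "\<And>x. \<bar>g x\<bar> \<le> L"
    "\<And>a b. a \<le> b \<Longrightarrow> (g has_integral f b - f a) {a..b}"
proof -
  have L: "0 \<le> L" using lip by (rule lipschitz_on_nonneg)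
  have bound: "\<bar>f y - f x\<bar> \<le> L * \<bar>y - x\<bar>" for x y
    using lipschitz_onD[OF lip, of y x] by (simp add: dist_real_def)
  have cont: "continuous_on S f" for S
    using lip lipschitz_on_continuous_on continuous_on_subset by blast
  let ?f = "\<lambda>x. f x + L * x"
  have lip': "(L + L)-lipschitz_on UNIV ?f"
  proof (rule lipschitz_onI)
    fix x y :: real
    have "?f x - ?f y = (f x - f y) + L * (x - y)" by (simp add: algebra_simps)
    then have "\<bar>?f x - ?f y\<bar> \<le> \<bar>f x - f y\<bar> + L * \<bar>x - y\<bar>"
      using abs_triangle_ineq[of "f x - f y" "L * (x - y)"] L by (simp only: abs_mult abs_of_nonneg)
    then show "dist (?f x) (?f y) \<le> (L + L) * dist x y"
      using bound[of x y] by (simp add: dist_real_def algebra_simps)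
  qed (use L in simp)
  have "mono ?f"
  proof (rule monoI)
    fix x y :: real assume "x \<le> y"
    then show "?f x \<le> ?f y" using bound[of y x] by (auto simp: abs_le_iff algebra_simps)
  qed
  from mono_lipschitz_differentiable_ae[OF this lip']
  obtain Z where Z: "Z \<in> null_sets lebesgue" "{x. \<not> ?f differentiable (at x)} \<subseteq> Z"
    by (auto simp: eventually_ae_filter)
  have diff: "f differentiable (at x)" if "x \<notin> Z" for x
  proof -
    have "?f differentiable (at x)" using Z(2) that by blast
    moreover have "(\<lambda>x. L * x) differentiable (at x)" by simp
    ultimately have "(\<lambda>x. ?f x - L * x) differentiable (at x)" by (rule differentiable_diff)
    then show ?thesis by simp
  qed
  define g where "g x = (if x \<in> Z then 0 else deriv f x)" for x
  have der: "(f has_real_derivative g x) (at x)" if "x \<notin> Z" for x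
    using diff[OF that] that by (simp add: g_def DERIV_deriv_iff_real_differentiable)
  define h where "h n = inverse (real (Suc n))" for n
  have h: "0 < h n" "h n \<le> 1" for n by (auto simp: h_def field_simps)
  have h0: "h \<longlonglongrightarrow> 0" unfolding h_def by (rule LIMSEQ_inverse_real_of_nat)
  have h_at: "filterlim h (at 0) sequentially"
    unfolding filterlim_at using h0 h(1) by (auto intro!: always_eventually simp: less_imp_neq[symmetric])
  define q where "q n x = (f (x + h n) - f x) / h n" for n x
  have q_bound: "\<bar>q n x\<bar> \<le> L" for n x
    using bound[of "x + h n" x] h(1)[of n] by (simp add: q_def abs_divide divide_le_eq)
  have q_lim: "(\<lambda>n. q n x) \<longlonglongrightarrow> g x" if "x \<notin> Z" for x
  proof -
    have "((\<lambda>k. (f (x + k) - f x) / k) \<longlongrightarrow> g x) (at 0)"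
      using der[OF that] by (simp add: DERIV_def)
    from filterlim_compose[OF this h_at] show ?thesis by (simp add: q_def)
  qed
  have g_bound: "\<bar>g x\<bar> \<le> L" for x
  proof (cases "x \<in> Z")
    case False
    have "(\<lambda>n. \<bar>q n x\<bar>) \<longlonglongrightarrow> \<bar>g x\<bar>" using q_lim[OF False] by (rule tendsto_rabs)
    then show ?thesis by (rule tendsto_upperbound) (simp_all add: q_bound)
  qed (use L in \<open>simp add: g_def\<close>)
  have negZ: "negligible Z" using Z(1) by (simp add: negligible_iff_null_sets)
  have int: "(g has_integral f b - f a) {a..b}" if ab: "a \<le> b" for a b
  proof -
    obtain F where F: "\<And>x. x \<in> {a-1..b+1} \<Longrightarrow> (F has_vector_derivative f x) (at x within {a-1..b+1})"
      using antiderivative_continuous[OF cont] by blast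
    have F': "(F has_real_derivative f x) (at x)" if "a - 1 < x" "x < b + 1" for x
      using F[of x] that at_within_Icc_at[of "a - 1" x "b + 1"]
      by (auto simp: has_real_derivative_iff_has_vector_derivative)
    have ftc: "((\<lambda>x. f (x + k)) has_integral (F (b + k) - F (a + k))) {a..b}" if "0 \<le> k" "k \<le> 1" for k
    proof (rule fundamental_theorem_of_calculus[OF ab])
      fix x assume x: "x \<in> {a..b}"
      have "(F has_vector_derivative f (x + k)) (at (x + k) within (\<lambda>x. x + k) ` {a..b})"
        using x that by (intro has_vector_derivative_within_subset[OF F]) auto
      moreover have "((\<lambda>x. x + k) has_vector_derivative 1) (at x within {a..b})"
        by (auto intro!: derivative_eq_intros)
      ultimately show "((\<lambda>x. F (x + k)) has_vector_derivative f (x + k)) (at x within {a..b})"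
        using vector_diff_chain_within[of "\<lambda>x. x + k" 1 x "{a..b}" F "f (x + k)"] by (simp add: o_def)
    qed
    define I where "I n = ((F (b + h n) - F (a + h n)) - (F b - F a)) / h n" for n
    have qint: "(q n has_integral I n) {a..b}" for n
      unfolding q_def I_def divide_inverse
      using has_integral_mult_left[OF has_integral_diff[OF ftc[of "h n"] ftc[of 0]], of "inverse (h n)"] h[of n] by simp
    have "(\<lambda>n. (F (b + h n) - F b) / h n - (F (a + h n) - F a) / h n) \<longlonglongrightarrow> f b - f a"
    proof (intro tendsto_diff)
      have *: "(\<lambda>n. (F (x + h n) - F x) / h n) \<longlonglongrightarrow> f x" if "a - 1 < x" "x < b + 1" for x
        using filterlim_compose[OF F'[OF that, unfolded DERIV_def] h_at] by simp
      show "(\<lambda>n. (F (b + h n) - F b) / h n) \<longlonglongrightarrow> f b" using ab by (intro *) auto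
      show "(\<lambda>n. (F (a + h n) - F a) / h n) \<longlonglongrightarrow> f a" using ab by (intro *) auto
    qed
    then have I: "I \<longlonglongrightarrow> f b - f a"
      by (rule Lim_transform_eventually) (auto simp: I_def diff_divide_distrib)
    define q' where "q' n x = (if x \<in> Z then 0 else q n x)" for n x
    have q'int: "(q' n has_integral I n) {a..b}" for n
      by (rule has_integral_spike[OF negZ _ qint]) (auto simp: q'_def)
    have q'_le: "norm (q' n x) \<le> L" for n x using q_bound L by (auto simp: q'_def)
    have q'_lim: "(\<lambda>n. q' n x) \<longlonglongrightarrow> g x" for x using q_lim by (auto simp: q'_def g_def)
    have q'_int: "q' n integrable_on {a..b}" for n using q'int by blast
    note dc = dominated_convergence[of q' "{a..b}" "\<lambda>_. L" g, OF q'_int _ q'_le q'_lim, OF integrable_const_ivl]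
    have "integral {a..b} (q' n) = I n" for n using q'int by (rule integral_unique)
    then have "integral {a..b} g = f b - f a" using dc(2) I LIMSEQ_unique by auto
    with dc(1) show ?thesis by (simp add: has_integral_integral)
  qed
  show thesis
    by (rule that[OF negZ der g_bound int])
qed

definition metric_quotient :: "(real \<Rightarrow> 'a::metric_space) \<Rightarrow> real \<Rightarrow> real \<Rightarrow> real" where
  "metric_quotient \<gamma> t s = dist (\<gamma> t) (\<gamma> s) / \<bar>t - s\<bar>"

text \<open>
  The functions \<open>\<phi> r t = dist (\<gamma> r) (\<gamma> t)\<close> with \<open>r\<close> rational recover all distances along the
  curve. The supremum \<open>m\<close> of the absolute values of their derivatives is a lower bound for the
  difference quotients of the curve in the limit, and distances are at most integrals of \<open>m\<close>.
  Conversely those quotients are at most the slopes of the primitive \<open>M\<close> of \<open>m\<close>, whose derivative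
  \<open>G\<close> satisfies \<open>m \<le> G\<close>. Both \<open>m\<close> and \<open>G\<close> have the same integral, so they agree almost everywhere and
  squeeze the quotient.
\<close>

lemma metric_derivative_ae_window:
  fixes \<gamma> :: "real \<Rightarrow> 'a::metric_space"
  assumes lip: "L-lipschitz_on UNIV \<gamma>" and ab: "a \<le> b"
  obtains Z m where "negligible Z"
    "\<And>t. t \<in> {a<..<b} - Z \<Longrightarrow> (metric_quotient \<gamma> t \<longlongrightarrow> m t) (at t)"
    "m integrable_on {a..b}" "\<And>t. 0 \<le> m t"
    "\<And>s t. a \<le> s \<Longrightarrow> s \<le> t \<Longrightarrow> t \<le> b \<Longrightarrow> dist (\<gamma> s) (\<gamma> t) \<le> integral {s..t} m"
proof -
  have L: "0 \<le> L" using lip by (rule lipschitz_on_nonneg)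
  have bound: "dist (\<gamma> y) (\<gamma> x) \<le> L * \<bar>y - x\<bar>" for x y
    using lipschitz_onD[OF lip, of y x] by (simp add: dist_real_def)
  define \<phi> where "\<phi> r t = dist (\<gamma> r) (\<gamma> t)" for r t
  have \<phi>_diff: "\<bar>\<phi> r t - \<phi> r s\<bar> \<le> dist (\<gamma> t) (\<gamma> s)" for r s t
    unfolding \<phi>_def using abs_dist_diff_le[of "\<gamma> t" "\<gamma> r" "\<gamma> s"] by (simp add: dist_commute)
  have \<phi>_lip: "L-lipschitz_on UNIV (\<phi> r)" for r
  proof (rule lipschitz_onI[OF _ L])
    show "dist (\<phi> r x) (\<phi> r y) \<le> L * dist x y" for x y
      using order_trans[OF \<phi>_diff[of r x y] bound[of x y]] by (simp add: dist_real_def)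
  qed
  have "\<forall>r. \<exists>g Z. negligible Z \<and> (\<forall>x. x \<notin> Z \<longrightarrow> (\<phi> r has_real_derivative g x) (at x)) \<and>
      (\<forall>x. \<bar>g x\<bar> \<le> L) \<and> (\<forall>a b. a \<le> b \<longrightarrow> (g has_integral \<phi> r b - \<phi> r a) {a..b})"
    using lipschitz_real_ae_derivative[OF \<phi>_lip] by metis
  then obtain g Z where gZ: "\<And>r. negligible (Z r)"
      "\<And>r x. x \<notin> Z r \<Longrightarrow> (\<phi> r has_real_derivative g r x) (at x)"
      "\<And>r x. \<bar>g r x\<bar> \<le> L" "\<And>r a b. a \<le> b \<Longrightarrow> (g r has_integral \<phi> r b - \<phi> r a) {a..b}"
    by metis
  (* \<open>m\<close> will turn out to be the metric derivative *)
  define m where "m x = (SUP r\<in>\<rat>. \<bar>g r x\<bar>)" for x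
  have bdd: "bdd_above ((\<lambda>r. \<bar>g r x\<bar>) ` \<rat>)" for x
    using gZ(3) by (auto simp: bdd_above_def)
  have ne: "(\<rat>::real set) \<noteq> {}" by auto
  have gm: "\<bar>g r x\<bar> \<le> m x" if "r \<in> \<rat>" for r x
    unfolding m_def using that bdd by (intro cSUP_upper) auto
  have mL: "m x \<le> L" for x unfolding m_def using ne gZ(3) by (intro cSUP_least) auto
  have m0: "0 \<le> m x" for x using gm[of 0 x] by simp
  have mint: "m integrable_on {s..t}" for s t
  proof (cases "s \<le> t")
    case True
    have "(\<lambda>x. \<bar>g r x\<bar>) \<in> borel_measurable (lebesgue_on {s..t})" for r
      using gZ(4)[OF True] by (intro borel_measurable_abs integrable_imp_measurable) blast
    then have "m \<in> borel_measurable (lebesgue_on {s..t})"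
      unfolding m_def by (intro borel_measurable_cSUP countable_rat bdd) auto
    then show ?thesis
      by (rule measurable_bounded_by_integrable_imp_integrable_real[where g = "\<lambda>_. L"])
        (use m0 mL in auto)
  qed auto
  have dist_le: "dist (\<gamma> s) (\<gamma> t) \<le> integral {s..t} m" if st: "s \<le> t" for s t
  proof -
    have le: "\<phi> r t - \<phi> r s \<le> integral {s..t} m" if r: "r \<in> \<rat>" for r
    proof (rule has_integral_le[OF gZ(4)[OF st] integrable_integral[OF mint]])
      show "g r x \<le> m x" for x using gm[OF r, of x] by linarith
    qed
    have "dist (\<gamma> s) (\<gamma> t) \<le> integral {s..t} m + e" if e: "0 < e" for e
    proof -
      define d where "d = e / (2 * (L + 1))"
      have d: "0 < d" using e L by (simp add: d_def)
      (* a rational time close to \<open>s\<close> replaces \<open>s\<close>, at the price of \<open>L * d \<le> e / 2\<close> *)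
      obtain r where r: "r \<in> \<rat>" "s < r" "r < s + d" using Rats_dense_in_real[of s "s + d"] d by auto
      have "dist (\<gamma> r) (\<gamma> s) \<le> L * d"
        using bound[of r s] r mult_left_mono[of "\<bar>r - s\<bar>" d L] L by linarith
      also have "L * d \<le> (L + 1) * d" using d by simp
      also have "\<dots> = e / 2" using L by (simp add: d_def field_simps)
      finally have "dist (\<gamma> r) (\<gamma> s) \<le> e / 2" .
      moreover have "dist (\<gamma> s) (\<gamma> t) \<le> dist (\<gamma> r) (\<gamma> s) + dist (\<gamma> r) (\<gamma> t)"
        using dist_triangle3[of "\<gamma> s" "\<gamma> t" "\<gamma> r"] by simp
      ultimately show ?thesis using le[OF r(1)] by (simp add: \<phi>_def)
    qed
    then show ?thesis by (rule field_le_epsilon)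
  qed
  define M where "M t = integral {a..t} m" for t
  have M_diff: "M t - M s = integral {s..t} m" if "a \<le> s" "s \<le> t" for s t
    unfolding M_def using Henstock_Kurzweil_Integration.integral_combine[OF that mint] by simp
  have Mle: "integral {s..t} m \<le> L * (t - s)" "0 \<le> integral {s..t} m" if "s \<le> t" for s t
    using integral_le[OF mint, of "\<lambda>_. L" s t] mL that m0 by (auto simp: mult.commute intro: Henstock_Kurzweil_Integration.integral_nonneg[OF mint])
  have M_inc: "0 \<le> M t - M s \<and> M t - M s \<le> L * (t - s)" if st: "s \<le> t" for s t
  proof -
    consider "a \<le> s" | "s < a" "a \<le> t" | "t < a" using st by linarith
    then show ?thesis
    proof cases
      case 1 then show ?thesis using M_diff Mle st by simp
    next
      case 2
      then have "L * (t - a) \<le> L * (t - s)" using L by (intro mult_left_mono) auto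
      with 2 show ?thesis using M_diff[of a t] Mle[of a t] by (simp add: M_def)
    next
      case 3 then show ?thesis using st L by (simp add: M_def)
    qed
  qed
  have "L-lipschitz_on UNIV M"
  proof (rule lipschitz_onI[OF _ L])
    fix x y show "dist (M x) (M y) \<le> L * dist x y"
      using M_inc[of x y] M_inc[of y x] by (cases "x \<le> y") (auto simp: dist_real_def)
  qed
  then obtain G Y where GY: "negligible Y" "\<And>x. x \<notin> Y \<Longrightarrow> (M has_real_derivative G x) (at x)"
    "\<And>a b. a \<le> b \<Longrightarrow> (G has_integral M b - M a) {a..b}"
    using lipschitz_real_ae_derivative[of L M] by metis
  define Z0 where "Z0 = Y \<union> (\<Union>r\<in>\<rat>. Z r)"
  have Z0: "negligible Z0" unfolding Z0_def
    by (intro negligible_Un GY(1) negligible_countable_Union countable_image countable_rat) (auto simp: gZ)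
  have quot_le: "metric_quotient \<gamma> t s \<le> (M s - M t) / (s - t)" if "a < t" "a < s" for s t
  proof -
    consider "s < t" | "s = t" | "t < s" by linarith
    then show ?thesis
    proof cases
      case 1
      then have "dist (\<gamma> t) (\<gamma> s) \<le> M t - M s"
        using dist_le[of s t] M_diff[of s t] that by (simp add: dist_commute)
      moreover have "(M s - M t) / (s - t) = (M t - M s) / (t - s)"
        by (metis minus_diff_eq minus_divide_divide)
      ultimately show ?thesis using 1 by (simp add: metric_quotient_def divide_right_mono)
    next
      case 3
      then have "dist (\<gamma> t) (\<gamma> s) \<le> M s - M t" using dist_le[of t s] M_diff[of t s] that by simp
      then show ?thesis using 3 by (simp add: metric_quotient_def divide_right_mono)
    qed (simp add: metric_quotient_def)
  qed
  have G_lim: "((\<lambda>s. (M s - M t) / (s - t)) \<longlongrightarrow> G t) (at t)" if "t \<notin> Z0" for t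
    using GY(2)[of t] that by (simp add: Z0_def has_field_derivative_iff)
  have g_lim: "((\<lambda>s. \<bar>\<phi> r s - \<phi> r t\<bar> / \<bar>s - t\<bar>) \<longlongrightarrow> \<bar>g r t\<bar>) (at t)" if "t \<notin> Z0" "r \<in> \<rat>" for r t
    using tendsto_rabs[of "\<lambda>s. (\<phi> r s - \<phi> r t) / (s - t)" "g r t" "at t"] gZ(2)[of t r] that
    by (simp add: Z0_def has_field_derivative_iff abs_divide)
  have g_le: "\<bar>\<phi> r s - \<phi> r t\<bar> / \<bar>s - t\<bar> \<le> metric_quotient \<gamma> t s" for r s t
    using \<phi>_diff[of r s t] by (simp add: metric_quotient_def divide_right_mono dist_commute abs_minus_commute)
  have mG: "m t \<le> G t" if t: "t \<notin> Z0" "a < t" for t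
    unfolding m_def
  proof (rule cSUP_least[OF ne])
    fix r :: real assume r: "r \<in> \<rat>"
    have "\<forall>\<^sub>F s in at t. a < s" using t(2)
      by (intro order_tendstoD(1)[OF tendsto_ident_at])
    then have "\<forall>\<^sub>F s in at t. \<bar>\<phi> r s - \<phi> r t\<bar> / \<bar>s - t\<bar> \<le> (M s - M t) / (s - t)"
      by eventually_elim (use g_le quot_le[OF t(2)] order_trans in blast)
    then show "\<bar>g r t\<bar> \<le> G t"
      by (rule tendsto_le[OF _ G_lim[OF t(1)] g_lim[OF t(1) r], rotated]) auto
  qed
  have "((\<lambda>x. G x - m x) has_integral (M b - M a - integral {a..b} m)) {a..b}"
    by (intro has_integral_diff GY(3) ab integrable_integral mint)
  then have "((\<lambda>x. G x - m x) has_integral 0) {a..b}" using M_diff[of a b] ab by simp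
  then have hz: "((\<lambda>x. if x \<in> insert a Z0 then 0 else G x - m x) has_integral 0) {a..b}"
    by (rule has_integral_spike[of "insert a Z0", rotated 2]) (auto simp: Z0)
  (* \<open>D\<close> is \<open>G - m\<close> with the exceptional points removed, a nonnegative function with integral
     zero *)
  define D where "D x = (if x \<in> {a..b} then if x \<in> insert a Z0 then 0 else G x - m x else 0)" for x
  have "(D has_integral 0) UNIV"
    using hz unfolding D_def by (simp only: has_integral_restrict_UNIV)
  moreover have "0 \<le> D x" for x using mG by (auto simp: D_def)
  ultimately have "D \<in> borel_measurable lebesgue" "integral\<^sup>N lebesgue D = 0"
    by (auto simp: has_integral_iff_nn_integral_lebesgue)
  then have "AE x in lebesgue. ennreal (D x) = 0" by (subst (asm) nn_integral_0_iff_AE) auto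
  then obtain Z1 where Z1: "Z1 \<in> null_sets lebesgue" "{x. ennreal (D x) \<noteq> 0} \<subseteq> Z1"
    by (auto simp: eventually_ae_filter)
  define ZZ where "ZZ = Z0 \<union> Z1"
  show thesis
  proof (rule that[of ZZ m])
    show "negligible ZZ" unfolding ZZ_def using Z0 Z1(1) by (intro negligible_Un) (simp_all add: negligible_iff_null_sets)
    fix t assume t: "t \<in> {a<..<b} - ZZ"
    then have tZ: "t \<notin> Z0" "a < t" "t < b" and D0: "D t = 0" using Z1(2) \<open>\<And>x. 0 \<le> D x\<close>
      by (auto simp: ZZ_def subset_iff ennreal_eq_0_iff) (metis order_antisym)
    have Gm: "G t = m t" using D0 tZ by (auto simp: D_def)
    have at_a: "\<forall>\<^sub>F s in at t. a < s" using tZ(2)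
      by (intro order_tendstoD(1)[OF tendsto_ident_at])
    show "(metric_quotient \<gamma> t \<longlongrightarrow> m t) (at t)"
    proof (rule order_tendstoI)
      fix c assume "c < m t"
      then obtain r where r: "r \<in> \<rat>" "c < \<bar>g r t\<bar>" unfolding m_def using less_cSUP_iff[OF ne bdd] by auto
      from order_tendstoD(1)[OF g_lim[OF tZ(1) r(1)] r(2)]
      show "\<forall>\<^sub>F s in at t. c < metric_quotient \<gamma> t s"
        by eventually_elim (use g_le less_le_trans in blast)
    next
      fix c assume "m t < c"
      then have "\<forall>\<^sub>F s in at t. (M s - M t) / (s - t) < c"
        using order_tendstoD(2)[OF G_lim[OF tZ(1)]] Gm by simp
      then show "\<forall>\<^sub>F s in at t. metric_quotient \<gamma> t s < c"
        using at_a by eventually_elim (use quot_le[OF tZ(2)] le_less_trans in blast)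
    qed
  qed (use mint m0 dist_le in auto)
qed

section \<open>Piecewise locally Lipschitz curves\<close>

text \<open>
  Extending the curve by its end values reduces a compact interval to the whole line.
\<close>

lemma metric_derivative_lipschitz_window:
  fixes \<gamma> :: "real \<Rightarrow> 'a::metric_space"
  assumes lip: "L-lipschitz_on {a..b} \<gamma>" and ab: "a \<le> b" and I: "{a..b} \<subseteq> I"
  obtains Z where "negligible Z"
    "\<And>t. t \<in> {a<..<b} - Z \<Longrightarrow> (metric_quotient \<gamma> t \<longlongrightarrow> metric_derivative I \<gamma> t) (at t)"
    "\<And>s t. a \<le> s \<Longrightarrow> s \<le> t \<Longrightarrow> t \<le> b \<Longrightarrow>
       ennreal (dist (\<gamma> s) (\<gamma> t)) \<le> (\<integral>\<^sup>+r\<in>{s..t}. ennreal (metric_derivative I \<gamma> r) \<partial>lebesgue)"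
proof -
  define c where "c t = max a (min b t)" for t
  have c: "c t \<in> {a..b}" for t using ab by (auto simp: c_def)
  have c_id: "c t = t" if "t \<in> {a..b}" for t using that by (auto simp: c_def)
  have c1: "dist (c s) (c t) \<le> dist s t" for s t
    by (auto simp: c_def dist_real_def max_def min_def)
  have lip': "L-lipschitz_on UNIV (\<gamma> \<circ> c)"
  proof (rule lipschitz_onI)
    show "0 \<le> L" using lip by (rule lipschitz_on_nonneg)
    show "dist ((\<gamma> \<circ> c) s) ((\<gamma> \<circ> c) t) \<le> L * dist s t" for s t
      using lipschitz_onD[OF lip c c, of s t] mult_left_mono[OF c1[of s t] \<open>0 \<le> L\<close>] by simp
  qed
  obtain Z m where mZ: "negligible Z"
    "\<And>t. t \<in> {a<..<b} - Z \<Longrightarrow> (metric_quotient (\<gamma> \<circ> c) t \<longlongrightarrow> m t) (at t)"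
    "m integrable_on {a..b}" "\<And>t. 0 \<le> m t"
    "\<And>s t. a \<le> s \<Longrightarrow> s \<le> t \<Longrightarrow> t \<le> b \<Longrightarrow> dist ((\<gamma> \<circ> c) s) ((\<gamma> \<circ> c) t) \<le> integral {s..t} m"
    by (rule metric_derivative_ae_window[OF lip' ab]) (rule that)
  have lim: "(metric_quotient \<gamma> t \<longlongrightarrow> m t) (at t)" if t: "t \<in> {a<..<b} - Z" for t
  proof -
    have "\<forall>\<^sub>F s in at t. s \<in> {a<..<b}" using t by (intro eventually_at_in_open') auto
    then have "\<forall>\<^sub>F s in at t. metric_quotient (\<gamma> \<circ> c) t s = metric_quotient \<gamma> t s"
      by eventually_elim (use t in \<open>simp add: metric_quotient_def c_id\<close>)
    then show ?thesis by (rule Lim_transform_eventually[OF mZ(2)[OF t]])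
  qed
  have md: "metric_derivative I \<gamma> t = m t" if t: "t \<in> {a<..<b} - Z" for t
  proof -
    have "t \<in> interior I"
      using t I by (intro interiorI[of "{a<..<b}"]) auto
    then have "at t within I = at t" by (rule at_within_interior)
    then show ?thesis
      using lim[OF t] unfolding metric_derivative_def metric_quotient_def
      by (intro tendsto_Lim) auto
  qed
  show thesis
  proof (rule that[OF mZ(1)])
    show "(metric_quotient \<gamma> t \<longlongrightarrow> metric_derivative I \<gamma> t) (at t)" if "t \<in> {a<..<b} - Z" for t
      using lim[OF that] md[OF that] by simp
    fix s t assume st: "a \<le> s" "s \<le> t" "t \<le> b"
    have "dist (\<gamma> s) (\<gamma> t) \<le> integral {s..t} m" using mZ(5)[OF st] st by (simp add: c_id)
    moreover have "(m has_integral integral {s..t} m) {s..t}"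
      using integrable_subinterval_real[OF mZ(3), of s t] st by (auto simp: has_integral_integral)
    then have "(\<integral>\<^sup>+r\<in>{s..t}. ennreal (m r) \<partial>lebesgue) = ennreal (integral {s..t} m)"
      by (rule nn_integral_has_integral_on) (simp add: mZ(4))
    moreover have "(\<integral>\<^sup>+r\<in>{s..t}. ennreal (m r) \<partial>lebesgue) =
      (\<integral>\<^sup>+r\<in>{s..t}. ennreal (metric_derivative I \<gamma> r) \<partial>lebesgue)"
    proof (rule nn_integral_cong_AE)
      have "negligible (Z \<union> {a, b})" using mZ(1) by (intro negligible_Un) auto
      then have "AE r in lebesgue. r \<notin> Z \<union> {a, b}"
        by (simp only: AE_not_in negligible_iff_null_sets)
      then show "AE r in lebesgue. ennreal (m r) * indicator {s..t} r =
          ennreal (metric_derivative I \<gamma> r) * indicator {s..t} r"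
        by eventually_elim (use md st in \<open>auto simp: indicator_def\<close>)
    qed
    ultimately show "ennreal (dist (\<gamma> s) (\<gamma> t)) \<le>
        (\<integral>\<^sup>+r\<in>{s..t}. ennreal (metric_derivative I \<gamma> r) \<partial>lebesgue)"
      by (metis ennreal_leI)
  qed
qed

text \<open>
  The form in which piecewise Lipschitz regularity is used: only the finite set of bad times
  matters. The balls lie inside \<open>I\<close>, so the end points of \<open>I\<close> that belong to it are bad times too.
\<close>

definition lipschitz_off :: "real set \<Rightarrow> real set \<Rightarrow> (real \<Rightarrow> 'a::metric_space) \<Rightarrow> bool" where
  "lipschitz_off T I \<gamma> \<longleftrightarrow> is_interval I \<and> continuous_on I \<gamma> \<and> finite T \<and>
     (\<forall>t\<in>I - T. \<exists>u>0. cball t u \<subseteq> I \<and> (\<exists>L. L-lipschitz_on (cball t u) \<gamma>))"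

text \<open>
  The bad times are the finite subdivision points; any other time of \<open>I\<close> lies strictly between
  two consecutive ones.
\<close>

lemma ploc_lipschitz_curve_imp_lipschitz_off:
  assumes "ploc_lipschitz_curve I \<gamma>"
  obtains T where "lipschitz_off T I \<gamma>"
proof -
  obtain n :: nat and \<tau> where I: "is_interval I" "continuous_on I \<gamma>"
    and \<tau>: "\<tau> 0 = (INF s\<in>I. ereal s)" "\<tau> n = (SUP s\<in>I. ereal s)"
      "\<And>i. i < n \<Longrightarrow> \<tau> i < \<tau> (Suc i)"
      "\<And>i. i < n \<Longrightarrow> loc_lipschitz_curve {s\<in>I. \<tau> i < ereal s \<and> ereal s < \<tau> (Suc i)} \<gamma>"
    using assms unfolding ploc_lipschitz_curve_def by blast
  define T where "T = {t. \<exists>i\<le>n. \<tau> i = ereal t}"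
  have "T \<subseteq> (\<lambda>i. real_of_ereal (\<tau> i)) ` {..n}" unfolding T_def by force
  then have "finite T" by (rule finite_surj[rotated]) auto
  have lo: "\<tau> 0 \<le> \<tau> j" if "j \<le> n" for j
    using that
  proof (induction j)
    case (Suc j)
    then show ?case using \<tau>(3)[of j] by (auto intro: order.trans less_imp_le)
  qed simp
  have hi: "\<tau> j \<le> \<tau> n" if "j \<le> n" for j
    using that
  proof (induction rule: inc_induct)
    case (step j)
    then show ?case using \<tau>(3)[of j] by (auto intro: order.trans less_imp_le)
  qed simp
  have "\<exists>u>0. cball t u \<subseteq> I \<and> (\<exists>L. L-lipschitz_on (cball t u) \<gamma>)" if t: "t \<in> I - T" for t
  proof -
    have "\<tau> 0 \<le> ereal t" "ereal t \<le> \<tau> n" using t unfolding \<tau>(1,2) by (auto intro: INF_lower SUP_upper)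
    moreover have ne: "ereal t \<noteq> \<tau> i" if "i \<le> n" for i using t that unfolding T_def by force
    ultimately have t0n: "\<tau> 0 < ereal t" "ereal t < \<tau> n"
      using ne[of 0] ne[of n] by (metis le0 order.strict_iff_order, metis order.refl order.strict_iff_order)
    (* the piece that contains \<open>t\<close> ends at the first subdivision point beyond \<open>t\<close> *)
    define i where "i = (LEAST i. ereal t < \<tau> i)"
    have i: "ereal t < \<tau> i" "i \<le> n" unfolding i_def using t0n(2) by (auto intro: LeastI Least_le)
    have "i \<noteq> 0" using i t0n(1) by (metis less_asym)
    then obtain j where j: "i = Suc j" by (cases i) auto
    have "\<not> ereal t < \<tau> j" using not_less_Least[of j "\<lambda>i. ereal t < \<tau> i"] j unfolding i_def by simp
    then have tj: "\<tau> j < ereal t" "ereal t < \<tau> (Suc j)" "j < n" using ne[of j] i j by auto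
    define P where "P = {s\<in>I. \<tau> j < ereal s \<and> ereal s < \<tau> (Suc j)}"
    define O' where "O' = {s. \<tau> j < ereal s \<and> ereal s < \<tau> (Suc j)}"
    have "open O'" unfolding O'_def by (intro open_Collect_conj open_Collect_less continuous_intros)
    moreover have "t \<in> O'" using tj unfolding O'_def by simp
    ultimately obtain w where w: "0 < w" "cball t w \<subseteq> O'" using open_contains_cball by blast
    have OI: "O' \<subseteq> I"
    proof
      fix s assume "s \<in> O'"
      then have "\<tau> 0 < ereal s" "ereal s < \<tau> n"
        using lo[of j] hi[of "Suc j"] tj(3) unfolding O'_def by (auto intro: le_less_trans less_le_trans)
      then obtain x y where "x \<in> I" "x < s" "y \<in> I" "s < y"
        unfolding \<tau>(1,2) by (auto simp: INF_less_iff less_SUP_iff)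
      then show "s \<in> I" using I(1) unfolding is_interval_1 by (meson less_imp_le)
    qed
    have "loc_lipschitz_curve P \<gamma>" using \<tau>(4)[OF tj(3)] unfolding P_def .
    moreover have "t \<in> P" using t tj unfolding P_def by simp
    ultimately obtain u L where u: "0 < u" "L-lipschitz_on (cball t u \<inter> P) \<gamma>"
      unfolding loc_lipschitz_curve_def by blast
    have sub: "cball t (min u w) \<subseteq> cball t u \<inter> P"
      using w(2) OI unfolding P_def O'_def by (auto simp: subset_iff)
    show ?thesis
    proof (intro exI conjI)
      show "0 < min u w" using u w by simp
      show "cball t (min u w) \<subseteq> I" using sub unfolding P_def by auto
      show "L-lipschitz_on (cball t (min u w)) \<gamma>" using u(2) sub by (rule lipschitz_on_subset)
    qed
  qed
  then have "lipschitz_off T I \<gamma>" unfolding lipschitz_off_def using I \<open>finite T\<close> by blast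
  then show thesis by (rule that)
qed

lemma lipschitz_off_Icc_imp_ploc:
  assumes off: "lipschitz_off T {a..b} f" and ab: "a < b"
  shows "ploc_lipschitz_curve {a..b} f"
proof -
  define S where "S = insert a (insert b (T \<inter> {a..b}))"
  have S: "finite S" "S \<noteq> {}" using off unfolding S_def lipschitz_off_def by auto
  define xs where "xs = sorted_list_of_set S"
  have xs: "set xs = S" "sorted_wrt (<) xs" "xs \<noteq> []"
    using S unfolding xs_def by (auto simp: sorted_list_of_set_eq_Nil_iff)
  define n where "n = length xs - 1"
  have len: "length xs = Suc n" using xs(3) unfolding n_def by (cases xs) auto
  have nth_less: "xs ! i < xs ! j" if "i < j" "j \<le> n" for i j
    using sorted_wrt_nth_less[OF xs(2), of i j] that len by simp
  have memS: "xs ! i \<in> S" if "i \<le> n" for i using xs(1) len that nth_mem[of i xs] by auto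
  have S_sub: "S \<subseteq> {a..b}" unfolding S_def using ab by auto
  have idx: "\<exists>i\<le>n. xs ! i = s" if "s \<in> S" for s
    using that xs(1) len by (metis in_set_conv_nth less_Suc_eq_le)
  have x0: "xs ! 0 = a"
  proof -
    obtain i where "i \<le> n" "xs ! i = a" using idx[of a] unfolding S_def by auto
    then show ?thesis using nth_less[of 0 i] memS[of 0] S_sub by (cases "i = 0") (auto simp: subset_iff)
  qed
  have xn: "xs ! n = b"
  proof -
    obtain i where "i \<le> n" "xs ! i = b" using idx[of b] unfolding S_def by auto
    then show ?thesis using nth_less[of i n] memS[of n] S_sub by (cases "i = n") (auto simp: subset_iff)
  qed
  have "loc_lipschitz_curve {s\<in>{a..b}. xs ! i < s \<and> s < xs ! Suc i} f" if i: "i < n" for i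
    unfolding loc_lipschitz_curve_def
  proof
    fix t assume t: "t \<in> {s\<in>{a..b}. xs ! i < s \<and> s < xs ! Suc i}"
    have "t \<notin> S"
    proof
      assume "t \<in> S"
      then obtain j where j: "j \<le> n" "xs ! j = t" using idx by blast
      then consider "j < i" | "j = i" | "j = Suc i" | "Suc i < j" by linarith
      then show False
        using t j i nth_less[of j i] nth_less[of "Suc i" j] by cases auto
    qed
    then have "t \<in> {a..b} - T" using t unfolding S_def by auto
    then obtain u L where "0 < u" "cball t u \<subseteq> {a..b}" "L-lipschitz_on (cball t u) f"
      using off unfolding lipschitz_off_def by blast
    then show "\<exists>u>0. \<exists>L. L-lipschitz_on (cball t u \<inter> {s\<in>{a..b}. xs ! i < s \<and> s < xs ! Suc i}) f"
      by (meson Int_lower1 lipschitz_on_subset)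
  qed
  moreover have "(INF s\<in>{a..b}. ereal s) = ereal a" "(SUP s\<in>{a..b}. ereal s) = ereal b"
    using ab by (auto intro!: antisym INF_greatest SUP_least INF_lower SUP_upper)
  ultimately show ?thesis
    using off ab x0 xn nth_less unfolding ploc_lipschitz_curve_def lipschitz_off_def
    by (intro conjI exI[of _ n] exI[of _ "\<lambda>i. ereal (xs ! i)"]) auto
qed

lemma lipschitz_curve_UNIV_imp_ploc:
  assumes "lipschitz_curve UNIV \<gamma>"
  shows "ploc_lipschitz_curve UNIV \<gamma>"
proof -
  obtain L where L: "L-lipschitz_on UNIV \<gamma>" using assms unfolding lipschitz_curve_def by blast
  have inf: "(INF s. ereal s) = -\<infinity>"
    by (rule ereal_bot) (rule INF_lower, simp)
  have sup: "(SUP s. ereal s) = \<infinity>"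
    by (rule ereal_top) (rule SUP_upper, simp)
  have "loc_lipschitz_curve A \<gamma>" for A
    unfolding loc_lipschitz_curve_def using lipschitz_on_subset[OF L]
    by (intro ballI exI[of _ 1]) auto
  then show ?thesis
    unfolding ploc_lipschitz_curve_def
    using lipschitz_on_continuous_on[OF L] inf sup
    by (intro conjI exI[of _ 1] exI[of _ "\<lambda>i. if i = (0::nat) then -\<infinity> else \<infinity> :: ereal"]) auto
qed

lemma lipschitz_off_open: 
  assumes "lipschitz_off T I \<gamma>"
  shows "open (I - T)"
proof -
  have "I - T = interior I - T"
    using assms interior_subset unfolding lipschitz_off_def by (auto simp: mem_interior_cball) blast+
  then show ?thesis
    using assms finite_imp_closed unfolding lipschitz_off_def by (metis open_Diff open_interior)
qed

lemma lipschitz_off_local: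
  fixes \<gamma> :: "real \<Rightarrow> 'a::metric_space"
  assumes "lipschitz_off T I \<gamma>" "t \<in> I - T"
  obtains u L where "0 < u" "cball t u \<subseteq> I" "L-lipschitz_on (cball t u) \<gamma>"
  using assms unfolding lipschitz_off_def by blast

lemma lipschitz_off_quotient_limit:
  fixes \<gamma> :: "real \<Rightarrow> 'a::metric_space"
  assumes off: "lipschitz_off T I \<gamma>"
  shows "AE t in lebesgue. t \<in> I \<longrightarrow> (metric_quotient \<gamma> t \<longlongrightarrow> metric_derivative I \<gamma> t) (at t)"
proof -
  define R where "R = {(p, q). p \<in> \<rat> \<and> q \<in> \<rat> \<and> p < q \<and> {p..q} \<subseteq> I \<and> (\<exists>L. L-lipschitz_on {p..q} \<gamma>)}"
  have "countable R"
    by (rule countable_subset[OF _ countable_SIGMA[OF countable_rat, of "\<lambda>_. \<rat>"]])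
      (auto simp: countable_rat R_def)
  have "\<forall>i\<in>R. \<exists>Z. negligible Z \<and> (\<forall>t \<in> {fst i<..<snd i} - Z.
      (metric_quotient \<gamma> t \<longlongrightarrow> metric_derivative I \<gamma> t) (at t))"
  proof
    fix i assume "i \<in> R"
    then obtain L where "L-lipschitz_on {fst i..snd i} \<gamma>" "fst i \<le> snd i" "{fst i..snd i} \<subseteq> I"
      unfolding R_def by auto
    from metric_derivative_lipschitz_window[OF this]
    show "\<exists>Z. negligible Z \<and> (\<forall>t \<in> {fst i<..<snd i} - Z.
      (metric_quotient \<gamma> t \<longlongrightarrow> metric_derivative I \<gamma> t) (at t))" by metis
  qed
  then obtain Z where Z: "\<And>i. i \<in> R \<Longrightarrow> negligible (Z i)"
    "\<And>i t. i \<in> R \<Longrightarrow> t \<in> {fst i<..<snd i} - Z i \<Longrightarrow>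
      (metric_quotient \<gamma> t \<longlongrightarrow> metric_derivative I \<gamma> t) (at t)"
    by metis
  have "negligible (T \<union> (\<Union>i\<in>R. Z i))"
  proof (intro negligible_Un negligible_countable_Union countable_image \<open>countable R\<close>)
    show "negligible T" using off unfolding lipschitz_off_def by (intro negligible_finite) auto
  qed (use Z(1) in auto)
  then have "AE t in lebesgue. t \<notin> T \<union> (\<Union>i\<in>R. Z i)"
    by (simp only: AE_not_in negligible_iff_null_sets)
  then show ?thesis
  proof eventually_elim
    fix t assume t: "t \<notin> T \<union> (\<Union>i\<in>R. Z i)"
    show "t \<in> I \<longrightarrow> (metric_quotient \<gamma> t \<longlongrightarrow> metric_derivative I \<gamma> t) (at t)"
    proof
      assume "t \<in> I"
      with t obtain u L where u: "0 < u" "cball t u \<subseteq> I" "L-lipschitz_on (cball t u) \<gamma>"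
        using lipschitz_off_local[OF off] by blast
      obtain p where p: "p \<in> \<rat>" "t - u < p" "p < t" using Rats_dense_in_real[of "t - u" t] u by auto
      obtain q where q: "q \<in> \<rat>" "t < q" "q < t + u" using Rats_dense_in_real[of t "t + u"] u by auto
      have sub: "{p..q} \<subseteq> cball t u" using p q by (auto simp: dist_real_def)
      then have "(p, q) \<in> R"
        using p q u lipschitz_on_subset[OF u(3) sub] unfolding R_def by auto
      then show "(metric_quotient \<gamma> t \<longlongrightarrow> metric_derivative I \<gamma> t) (at t)"
        using Z(2)[of "(p, q)" t] t p q by auto
    qed
  qed
qed

text \<open>
  Almost everywhere on \<open>I\<close> the metric derivative is the limit of difference quotients with steps
  \<open>h n\<close>, each continuous on an open set; completeness of Lebesgue measure takes care of the
  exceptional set.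
\<close>

lemma lipschitz_off_measurable:
  fixes \<gamma> :: "real \<Rightarrow> 'a::metric_space"
  assumes off: "lipschitz_off T I \<gamma>"
  shows "(\<lambda>t. indicator I t * metric_derivative I \<gamma> t) \<in> borel_measurable lebesgue"
proof -
  define J where "J = I - T"
  have J: "open J" unfolding J_def by (rule lipschitz_off_open[OF off])
  have cont: "continuous_on J \<gamma>"
    using off unfolding lipschitz_off_def J_def by (auto intro: continuous_on_subset)
  define h where "h n = inverse (real (Suc n))" for n
  have h: "0 < h n" for n by (auto simp: h_def)
  have h0: "h \<longlonglongrightarrow> 0" unfolding h_def by (rule LIMSEQ_inverse_real_of_nat)
  define A where "A n = J \<inter> {t. t + h n \<in> J}" for n
  have A: "open (A n)" for n
  proof -
    have "open ((\<lambda>t. t + h n) -` J)" by (intro continuous_open_vimage J continuous_intros) 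
    then show ?thesis unfolding A_def using J by (auto simp: vimage_def)
  qed
  define D where "D n t = (if t \<in> A n then metric_quotient \<gamma> t (t + h n) else 0)" for n t
  have D: "D n \<in> borel_measurable borel" for n
    unfolding D_def
  proof (rule borel_measurable_continuous_on_if)
    show "A n \<in> sets borel" using A by simp
    have "continuous_on (A n) (\<lambda>t. \<gamma> (t + h n))"
      by (rule continuous_on_compose2[OF cont]) (auto simp: A_def intro!: continuous_intros)
    moreover have "continuous_on (A n) \<gamma>"
      by (rule continuous_on_subset[OF cont]) (auto simp: A_def)
    ultimately show "continuous_on (A n) (\<lambda>t. metric_quotient \<gamma> t (t + h n))"
      unfolding metric_quotient_def using h[of n] by (intro continuous_intros) auto
  qed auto
  define d where "d t = lim (\<lambda>n. D n t)" for t
  have "d \<in> borel_measurable borel" unfolding d_def by (intro borel_measurable_lim_metric D)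
  then have d: "d \<in> borel_measurable lebesgue" by (simp add: measurable_completion)
  have lim: "d t = metric_derivative I \<gamma> t"
    if t: "t \<in> J" "(metric_quotient \<gamma> t \<longlongrightarrow> metric_derivative I \<gamma> t) (at t)" for t
  proof -
    have "(\<lambda>n. t + h n) \<longlonglongrightarrow> t + 0" by (intro tendsto_intros h0)
    then have lt: "(\<lambda>n. t + h n) \<longlonglongrightarrow> t" by simp
    then have "filterlim (\<lambda>n. t + h n) (at t) sequentially"
      unfolding filterlim_at using h by (auto intro!: always_eventually simp: less_imp_neq[symmetric])
    from filterlim_compose[OF t(2) this]
    have "(\<lambda>n. metric_quotient \<gamma> t (t + h n)) \<longlonglongrightarrow> metric_derivative I \<gamma> t" .
    moreover have "\<forall>\<^sub>F n in sequentially. t + h n \<in> J" using topological_tendstoD[OF lt J t(1)] .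
    then have "\<forall>\<^sub>F n in sequentially. metric_quotient \<gamma> t (t + h n) = D n t"
      by eventually_elim (use t in \<open>auto simp: D_def A_def\<close>)
    ultimately have "(\<lambda>n. D n t) \<longlonglongrightarrow> metric_derivative I \<gamma> t" by (rule Lim_transform_eventually)
    then show ?thesis unfolding d_def by (rule limI)
  qed
  have Jm: "(\<lambda>t. indicator J t * d t) \<in> borel_measurable lebesgue"
    using d J by (intro borel_measurable_times borel_measurable_indicator) auto
  show ?thesis
  proof (rule borel_measurable_AE[OF Jm])
    have "AE t in lebesgue. t \<notin> T"
      using off unfolding lipschitz_off_def by (intro AE_not_in_finite) auto
    with lipschitz_off_quotient_limit[OF off]
    show "AE t in lebesgue. indicator J t * d t = indicator I t * metric_derivative I \<gamma> t"
      by eventually_elim (use lim in \<open>auto simp: J_def indicator_def\<close>)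
  qed
qed

lemma weighted_speed_measurable:
  fixes \<gamma> :: "real \<Rightarrow> 'a::metric_space" and K :: "'a \<Rightarrow> real"
  assumes off: "lipschitz_off T I \<gamma>" and K: "continuous_on UNIV K"
  shows "(\<lambda>t. ennreal (K (\<gamma> t) * metric_derivative I \<gamma> t) * indicator I t) \<in> borel_measurable lebesgue"
proof -
  define J where "J = I - T"
  have J: "open J" unfolding J_def by (rule lipschitz_off_open[OF off])
  have "continuous_on J \<gamma>"
    using off unfolding lipschitz_off_def J_def by (auto intro: continuous_on_subset)
  then have "continuous_on J (\<lambda>t. K (\<gamma> t))" by (rule continuous_on_compose2[OF K]) auto
  then have "(\<lambda>t. if t \<in> J then K (\<gamma> t) else 0) \<in> borel_measurable borel"
    using J by (intro borel_measurable_continuous_on_if) auto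
  then have "(\<lambda>t. if t \<in> J then K (\<gamma> t) else 0) \<in> borel_measurable lebesgue"
    by (simp add: measurable_completion)
  then have "(\<lambda>t. (if t \<in> J then K (\<gamma> t) else 0) * (indicator I t * metric_derivative I \<gamma> t))
      \<in> borel_measurable lebesgue"
    by (intro borel_measurable_times lipschitz_off_measurable[OF off])
  moreover have "AE t in lebesgue. (if t \<in> J then K (\<gamma> t) else 0) * (indicator I t * metric_derivative I \<gamma> t) =
      K (\<gamma> t) * metric_derivative I \<gamma> t * indicator I t"
  proof -
    have "AE t in lebesgue. t \<notin> T"
      using off unfolding lipschitz_off_def by (intro AE_not_in_finite) auto
    then show ?thesis by eventually_elim (auto simp: J_def indicator_def)
  qed
  ultimately have "(\<lambda>t. K (\<gamma> t) * metric_derivative I \<gamma> t * indicator I t) \<in> borel_measurable lebesgue"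
    by (rule borel_measurable_AE)
  then have "(\<lambda>t. ennreal (K (\<gamma> t) * metric_derivative I \<gamma> t * indicator I t)) \<in> borel_measurable lebesgue"
    by (rule measurable_compose[OF _ measurable_ennreal])
  then show ?thesis by (simp add: ennreal_mult'' ennreal_indicator)
qed

section \<open>The chain distance\<close>

text \<open>
  \<open>chain K e x y c\<close>: finitely many hops of length less than \<open>e\<close> lead from \<open>x\<close> to \<open>y\<close> at total cost \<open>c\<close>.
  Taking the larger of the two weights makes the cost symmetric.
\<close>

inductive chain :: "('a::metric_space \<Rightarrow> real) \<Rightarrow> real \<Rightarrow> 'a \<Rightarrow> 'a \<Rightarrow> real \<Rightarrow> bool"
  for K e x where
  chain_refl: "chain K e x x 0"
| chain_step: "chain K e x y c \<Longrightarrow> dist y z < e \<Longrightarrow> chain K e x z (c + max (K y) (K z) * dist y z)"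

definition mesh_dist :: "('a::metric_space \<Rightarrow> real) \<Rightarrow> real \<Rightarrow> 'a \<Rightarrow> 'a \<Rightarrow> ennreal" where
  "mesh_dist K e x y = (INF c\<in>{c. chain K e x y c}. ennreal c)"

definition chain_dist :: "('a::metric_space \<Rightarrow> real) \<Rightarrow> 'a \<Rightarrow> 'a \<Rightarrow> ennreal" where
  "chain_dist K x y = (SUP e\<in>{0<..}. mesh_dist K e x y)"

lemma chain_trans: "chain K e y z d \<Longrightarrow> chain K e x y c \<Longrightarrow> chain K e x z (c + d)"
proof (induction rule: chain.induct)
  case (chain_step z d w)
  then have "chain K e x w ((c + d) + max (K z) (K w) * dist z w)" by (intro chain.chain_step) auto
  then show ?case by (simp add: add.assoc)
qed simp

lemma chain_single: "dist x y < e \<Longrightarrow> chain K e x y (max (K x) (K y) * dist x y)"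
  using chain_step[OF chain_refl, of x y e K] by simp

lemma chain_sym: "chain K e x y c \<Longrightarrow> chain K e y x c"
proof (induction rule: chain.induct)
  case (chain_step y c z)
  then show ?case
    using chain_trans[OF chain_step.IH chain_single[of z y e K]]
    by (simp add: dist_commute max.commute add.commute)
qed (rule chain_refl)

lemma chain_antimono: "chain K e x y c \<Longrightarrow> e \<le> e' \<Longrightarrow> chain K e' x y c"
  by (induction rule: chain.induct) (auto intro: chain.intros)

lemma chain_nonneg:
  assumes "chain K e x y c" "\<And>p. 0 \<le> K p"
  shows "0 \<le> c"
  using assms(1)
proof (induction rule: chain.induct)
  case (chain_step y c z)
  then show ?case using assms(2)[of y] by (intro add_nonneg_nonneg mult_nonneg_nonneg) auto
qed simp

lemma mesh_dist_le: "chain K e x y c \<Longrightarrow> mesh_dist K e x y \<le> ennreal c"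
  unfolding mesh_dist_def by (rule INF_lower) simp

lemma mesh_dist_refl [simp]: "mesh_dist K e x x = 0"
  using mesh_dist_le[OF chain_refl, of K e x] by simp

lemma mesh_dist_commute: "mesh_dist K e x y = mesh_dist K e y x"
proof -
  have "Collect (chain K e x y) = Collect (chain K e y x)" by (auto intro: chain_sym)
  then show ?thesis unfolding mesh_dist_def by simp
qed

lemma mesh_dist_single: "dist x y < e \<Longrightarrow> mesh_dist K e x y \<le> ennreal (max (K x) (K y) * dist x y)"
  by (intro mesh_dist_le chain_single)

lemma mesh_dist_antimono: "e \<le> e' \<Longrightarrow> mesh_dist K e' x y \<le> mesh_dist K e x y"
  unfolding mesh_dist_def by (rule INF_superset_mono) (auto intro: chain_antimono)

lemma mesh_dist_chainE:
  assumes "mesh_dist K e x y < ennreal c"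
  obtains c' where "chain K e x y c'" "c' < c"
  using assms unfolding mesh_dist_def INF_less_iff by (auto simp: ennreal_less_iff) (metis ennreal_leI not_le)

lemma mesh_dist_triangle:
  assumes K: "\<And>p. 0 \<le> K p"
  shows "mesh_dist K e x z \<le> mesh_dist K e x y + mesh_dist K e y z"
proof (rule ennreal_le_epsilon)
  fix r :: real assume r: "0 < r" and fin: "mesh_dist K e x y + mesh_dist K e y z < top"
  define a b where "a = enn2real (mesh_dist K e x y)" and "b = enn2real (mesh_dist K e y z)"
  have ab: "mesh_dist K e x y = ennreal a" "mesh_dist K e y z = ennreal b" "0 \<le> a" "0 \<le> b"
    using fin unfolding a_def b_def by (auto simp: ennreal_add_less_top)
  obtain c where c: "chain K e x y c" "c < a + r / 2"
    using mesh_dist_chainE[of K e x y "a + r / 2"] ab r by (auto simp: ennreal_less_iff)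
  obtain d where d: "chain K e y z d" "d < b + r / 2"
    using mesh_dist_chainE[of K e y z "b + r / 2"] ab r by (auto simp: ennreal_less_iff)
  have "mesh_dist K e x z \<le> ennreal (c + d)" by (rule mesh_dist_le[OF chain_trans[OF d(1) c(1)]])
  also have "\<dots> \<le> ennreal (a + b + r)" using c d by (intro ennreal_leI) auto
  also have "\<dots> = mesh_dist K e x y + mesh_dist K e y z + ennreal r"
    using ab r by (simp add: ennreal_plus)
  finally show "mesh_dist K e x z \<le> mesh_dist K e x y + mesh_dist K e y z + ennreal r" .
qed

lemma mesh_dist_triangle3:
  assumes K: "\<And>p. 0 \<le> K p"
    and "mesh_dist K e x u \<le> A" "mesh_dist K e u v \<le> B" "mesh_dist K e v y \<le> D"
  shows "mesh_dist K e x y \<le> A + B + D"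
proof -
  have "mesh_dist K e x y \<le> mesh_dist K e x u + mesh_dist K e u v + mesh_dist K e v y"
    using mesh_dist_triangle[of K e x y v, OF K] mesh_dist_triangle[of K e x v u, OF K]
    by (meson add_right_mono order.trans)
  also have "\<dots> \<le> A + B + D" using assms(2-4) by (intro add_mono)
  finally show ?thesis .
qed

lemma mesh_dist_le_chain_dist: "0 < e \<Longrightarrow> mesh_dist K e x y \<le> chain_dist K x y"
  unfolding chain_dist_def by (rule SUP_upper) simp

lemma chain_dist_leI:
  assumes "0 < e0" "\<And>e. 0 < e \<Longrightarrow> e \<le> e0 \<Longrightarrow> mesh_dist K e x y \<le> C"
  shows "chain_dist K x y \<le> C"
  unfolding chain_dist_def
proof (rule SUP_least)
  fix e :: real assume "e \<in> {0<..}"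
  then have "mesh_dist K e x y \<le> mesh_dist K (min e e0) x y" by (intro mesh_dist_antimono) auto
  also have "\<dots> \<le> C" using \<open>e \<in> {0<..}\<close> assms(1) by (intro assms(2)) auto
  finally show "mesh_dist K e x y \<le> C" .
qed

lemma chain_dist_refl [simp]: "chain_dist K x x = 0"
  using chain_dist_leI[of 1 K x x 0] by simp

lemma chain_dist_commute: "chain_dist K x y = chain_dist K y x"
  unfolding chain_dist_def by (simp add: mesh_dist_commute)

lemma chain_dist_triangle:
  assumes "\<And>p. 0 \<le> K p"
  shows "chain_dist K x z \<le> chain_dist K x y + chain_dist K y z"
proof (rule chain_dist_leI[of 1])
  fix e :: real assume "0 < e"
  then show "mesh_dist K e x z \<le> chain_dist K x y + chain_dist K y z"
    by (intro order.trans[OF mesh_dist_triangle[where y = y, OF assms]] add_mono mesh_dist_le_chain_dist)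
qed simp

text \<open>
  Along a chain the increments of a calibration telescope, and each is paid for by its hop.
\<close>

lemma calibration_le_mesh_dist:
  fixes u :: "'a::metric_space \<Rightarrow> real"
  assumes u: "\<And>p q. dist p q < e \<Longrightarrow> u q - u p \<le> max (K p) (K q) * dist p q"
  shows "ennreal (u y - u x) \<le> mesh_dist K e x y"
proof -
  have "u y - u x \<le> c" if "chain K e x y c" for y c
    using that
  proof (induction rule: chain.induct)
    case (chain_step y c z)
    then show ?case using u[of y z] by simp
  qed simp
  then show ?thesis unfolding mesh_dist_def by (intro INF_greatest ennreal_leI) auto
qed

text \<open>
  Calibrated by a truncated multiple of the distance from \<open>u\<close>. Truncation at \<open>2 * r\<close> keeps the
  calibration constant outside the ball in which \<open>K\<close> exceeds \<open>m\<close>, also for the hop that leaves the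
  ball.
\<close>

lemma chain_dist_ge_near:
  fixes K :: "'a::metric_space \<Rightarrow> real"
  assumes K: "\<And>p. 0 \<le> K p" "continuous_on UNIV K" and m: "0 \<le> m" "m < K p"
  obtains r where "0 < r"
    "\<And>u v. u \<in> ball p r \<Longrightarrow> v \<in> ball p r \<Longrightarrow> ennreal (m * dist u v) \<le> chain_dist K u v"
proof -
  have "open {q. m < K q}" by (intro open_Collect_less continuous_intros K(2))
  then obtain R where R: "0 < R" "ball p R \<subseteq> {q. m < K q}" using m(2) openE[of "{q. m < K q}" p] by blast
  define r where "r = R / 4"
  have r: "0 < r" using R by (simp add: r_def)
  show thesis
  proof (rule that[OF r])
    fix u v assume uv: "u \<in> ball p r" "v \<in> ball p r"
    define h where "h q = m * min (dist u q) (2 * r)" for q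
    have "ennreal (h v - h u) \<le> mesh_dist K r u v"
    proof (rule calibration_le_mesh_dist)
      fix q q' :: 'a assume qq: "dist q q' < r"
      show "h q' - h q \<le> max (K q) (K q') * dist q q'"
      proof (cases "dist p q < R")
        case True
        have "min (dist u q') (2 * r) - min (dist u q) (2 * r) \<le> dist q q'"
          using dist_triangle[of u q' q] zero_le_dist[of q q'] by linarith
        then have "h q' - h q \<le> m * dist q q'"
          unfolding h_def right_diff_distrib[symmetric] using m(1) by (rule mult_left_mono)
        also have "\<dots> \<le> max (K q) (K q') * dist q q'"
          using True R(2) by (intro mult_right_mono) (auto simp: subset_iff intro: less_imp_le less_max_iff_disj[THEN iffD2] )
        finally show ?thesis .
      next
        case False
        then have "2 * r \<le> dist u q"
          using uv dist_triangle[of p q u] r by (auto simp: r_def)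
        then have "h q' \<le> h q" using m(1) by (auto simp: h_def intro!: mult_left_mono)
        moreover have "0 \<le> max (K q) (K q') * dist q q'"
          using K(1)[of q] by (intro mult_nonneg_nonneg) auto
        ultimately show ?thesis by simp
      qed
    qed
    also have "h v - h u = m * dist u v"
      using uv r dist_triangle3[of u v p] by (auto simp: h_def dist_commute)
    finally show "ennreal (m * dist u v) \<le> chain_dist K u v"
      using mesh_dist_le_chain_dist[OF r] order.trans by blast
  qed
qed

lemma proper_compact_cball:
  assumes "proper_metric TYPE('a::metric_space)"
  shows "compact (cball (p::'a) r)"
  using assms unfolding proper_metric_def by auto

lemma proper_bounded_above:
  fixes K :: "'a::metric_space \<Rightarrow> real"
  assumes "proper_metric TYPE('a)" "continuous_on UNIV K" "bounded B"
  obtains M where "0 < M" "\<And>p. p \<in> B \<Longrightarrow> K p \<le> M"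
proof -
  obtain x r where "B \<subseteq> cball x r" using assms(3) unfolding bounded_subset_cball by blast
  have "compact (K ` cball x r)"
    using proper_compact_cball[OF assms(1)] assms(2)
    by (intro compact_continuous_image) (auto intro: continuous_on_subset)
  then obtain M where M: "\<And>y. y \<in> K ` cball x r \<Longrightarrow> norm y \<le> M"
    using compact_imp_bounded bounded_iff by metis
  show thesis
  proof (rule that[of "max 1 M"])
    fix p assume "p \<in> B"
    then have "norm (K p) \<le> M" using \<open>B \<subseteq> cball x r\<close> by (intro M) auto
    then show "K p \<le> max 1 M" by simp
  qed simp
qed

text \<open>
  The point \<open>p\<close> may be a zero of \<open>K\<close>, but a small annulus around it contains none, and leaving the
  ball requires crossing the annulus. The calibration varies only in the middle third, so that
  a hop of length at most \<open>r / 6\<close> on which it changes starts in the annulus, where \<open>K\<close> is bounded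
  below.
\<close>

lemma chain_dist_separates:
  fixes K :: "'a::metric_space \<Rightarrow> real"
  assumes proper: "proper_metric TYPE('a)"
    and K: "\<And>p. 0 \<le> K p" "continuous_on UNIV K" and fin: "finite {p. K p = 0}" and r0: "0 < r0"
  obtains \<eta> where "0 < \<eta>" "\<And>v. chain_dist K p v < ennreal \<eta> \<Longrightarrow> dist p v < r0"
proof -
  obtain d where d: "0 < d" "\<And>q. q \<in> {p. K p = 0} \<Longrightarrow> q \<noteq> p \<Longrightarrow> d \<le> dist p q"
    using finite_set_avoid[OF fin, of p] by blast
  define r where "r = min r0 (d / 2)"
  have r: "0 < r" "r \<le> r0" "r < d" using r0 d(1) by (auto simp: r_def)
  define A where "A = cball p r - ball p (r / 6)"
  have "compact A" unfolding A_def by (intro compact_diff proper_compact_cball proper) auto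
  have A_pos: "0 < K q" if "q \<in> A" for q
  proof -
    have "q \<noteq> p" "dist p q < d" using that r unfolding A_def by auto
    then have "K q \<noteq> 0" using d(2)[of q] by auto
    then show ?thesis using K(1)[of q] by simp
  qed
  obtain m where m: "0 < m" "\<And>q. q \<in> A \<Longrightarrow> m \<le> K q"
  proof (cases "A = {}")
    case True then show thesis by (intro that[of 1]) auto
  next
    case False
    obtain q where "q \<in> A" "\<And>q'. q' \<in> A \<Longrightarrow> K q \<le> K q'"
      using continuous_attains_inf[OF \<open>compact A\<close> False continuous_on_subset[OF K(2)]] by blast
    then show thesis using A_pos by (intro that[of "K q"]) auto
  qed
  define u where "u q = m * min (max (dist p q - r / 3) 0) (r / 3)" for q
  have cal: "ennreal (u v - u p) \<le> mesh_dist K (r / 6) p v" for v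
  proof (rule calibration_le_mesh_dist)
    fix q q' :: 'a assume qq: "dist q q' < r / 6"
    have tri: "dist p q' \<le> dist p q + dist q q'" "dist p q \<le> dist p q' + dist q q'"
      using dist_triangle[of p q' q] dist_triangle[of p q q'] by (simp_all add: dist_commute)
    show "u q' - u q \<le> max (K q) (K q') * dist q q'"
    proof (cases "q \<in> A")
      case True
      have "min (max (dist p q' - r / 3) 0) (r / 3) - min (max (dist p q - r / 3) 0) (r / 3) \<le> dist q q'"
        using tri zero_le_dist[of q q'] by linarith
      then have "u q' - u q \<le> m * dist q q'"
        unfolding u_def right_diff_distrib[symmetric] using m(1) by (intro mult_left_mono) auto
      also have "\<dots> \<le> max (K q) (K q') * dist q q'"
        using m(2)[OF True] by (intro mult_right_mono) auto
      finally show ?thesis .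
    next
      case False
      then have "dist p q < r / 6 \<or> r < dist p q" unfolding A_def by auto
      then have "u q' = u q" using tri qq r by (auto simp: u_def)
      moreover have "0 \<le> max (K q) (K q') * dist q q'"
        using K(1)[of q] by (intro mult_nonneg_nonneg) auto
      ultimately show ?thesis by simp
    qed
  qed
  show thesis
  proof (rule that[of "m * (r / 3)"])
    show "0 < m * (r / 3)" using m r by simp
    fix v assume v: "chain_dist K p v < ennreal (m * (r / 3))"
    show "dist p v < r0"
    proof (rule ccontr)
      assume "\<not> dist p v < r0"
      then have "u v = m * (r / 3)" "u p = 0" using r by (auto simp: u_def)
      then have "ennreal (m * (r / 3)) \<le> mesh_dist K (r / 6) p v" using cal[of v] by (simp only: diff_zero)
      also have "\<dots> \<le> chain_dist K p v" using r by (intro mesh_dist_le_chain_dist) auto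
      finally show False using v by simp
    qed
  qed
qed

text \<open>
  Calibrated by a primitive of \<open>k - \<omega>\<close>, cut off at zero from below, as a function of the
  distance to \<open>S\<close>. The correction \<open>\<omega>\<close> absorbs the variation of \<open>k\<close> along one hop; it is chosen as
  \<open>1 / R\<close> so that on \<open>[0, R]\<close> it removes no more than \<open>1\<close> from an integral larger than \<open>C + 1\<close>.
\<close>

lemma mesh_dist_confines:
  fixes K :: "'a::metric_space \<Rightarrow> real"
  assumes K: "\<And>p. 0 \<le> K p" 
    and k_cont: "continuous_on {0..} k" and k_nonneg: "\<And>t. 0 \<le> t \<Longrightarrow> 0 \<le> k t"
    and k_integral: "(\<integral>\<^sup>+t\<in>{0..}. ennreal (k t) \<partial>lebesgue) = \<infinity>"
    and K_lower: "\<And>x. k (infdist x S) \<le> K x" and C: "0 \<le> C"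
  obtains R e where "0 < e" "\<And>x p. x \<in> S \<Longrightarrow> mesh_dist K e x p \<le> ennreal C \<Longrightarrow> infdist p S \<le> R"
proof -
  have kc: "continuous_on {0..r} k" for r by (rule continuous_on_subset[OF k_cont]) auto
  have kint: "k integrable_on {a..b}" if "0 \<le> a" for a b
    using that by (intro integrable_continuous_interval continuous_on_subset[OF k_cont]) auto
  obtain n :: nat where n: "C + 1 < integral {0..real n} k"
  proof (rule ccontr)
    assume neg: "\<not> thesis"
    have meas: "(\<lambda>t. ennreal (k t) * indicator {0..real n} t) \<in> borel_measurable lebesgue" for n
    proof -
      have "(\<lambda>t. if t \<in> {0..real n} then k t else 0) \<in> borel_measurable borel"
        by (intro borel_measurable_continuous_on_if kc) auto
      then have "(\<lambda>t. ennreal (if t \<in> {0..real n} then k t else 0)) \<in> borel_measurable lebesgue"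
        by (simp add: measurable_completion)
      then show ?thesis by (rule measurable_cong[THEN iffD1, rotated]) (simp add: indicator_def)
    qed
    have "(\<integral>\<^sup>+t\<in>(\<Union>n. {0..real n}). ennreal (k t) \<partial>lebesgue) \<le> ennreal (C + 1)"
    proof (rule nn_integral_exhaustion_le[OF meas])
      have "integral {0..real n} k \<le> C + 1" for n using neg that by (meson not_le)
      then show "(\<integral>\<^sup>+t\<in>{0..real n}. ennreal (k t) \<partial>lebesgue) \<le> ennreal (C + 1)" for n
        using nn_integral_has_integral_on[OF integrable_integral[OF kint[of 0 "real n"]]] k_nonneg
        by (simp add: ennreal_leI del: ennreal_plus)
    qed (auto simp: incseq_def)
    moreover have "(\<Union>n. {0..real n}) = {0..}" using real_arch_simple by auto
    ultimately show False using k_integral by (simp add: top_unique)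
  qed
  define R where "R = real n"
  have "0 < n" using n C by (cases n) auto
  then have R: "0 < R" by (simp add: R_def)
  define \<omega> where "\<omega> = 1 / R"
  have "uniformly_continuous_on {0..R} k" by (rule compact_uniformly_continuous[OF kc]) simp
  then obtain e where e: "0 < e" "\<And>s t. s \<in> {0..R} \<Longrightarrow> t \<in> {0..R} \<Longrightarrow> dist s t < e \<Longrightarrow> dist (k s) (k t) < \<omega>"
    unfolding uniformly_continuous_on_def using R by (metis \<omega>_def zero_less_divide_1_iff)
  define h where "h t = max 0 (k t - \<omega>)" for t
  have hint: "h integrable_on {a..b}" if "0 \<le> a" for a b
    unfolding h_def using that
    by (intro integrable_continuous_interval continuous_intros continuous_on_subset[OF k_cont]) auto
  define U where "U s = integral {0..min s R} h" for s
  have U_diff: "U b - U a = integral {min a R..min b R} h" if "0 \<le> a" "a \<le> b" for a b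
  proof -
    have "0 \<le> min a R" "min a R \<le> min b R" using that R by linarith+
    from Henstock_Kurzweil_Integration.integral_combine[OF this hint] show ?thesis by (simp add: U_def)
  qed
  have h0: "0 \<le> h t" for t by (simp add: h_def)
  have U_inc: "0 \<le> U b - U a" if "0 \<le> a" "a \<le> b" for a b
    unfolding U_diff[OF that] using that R h0 by (intro Henstock_Kurzweil_Integration.integral_nonneg hint) auto
  have UR: "C < U s" if "R < s" for s
  proof -
    have "integral {0..R} k - 1 = integral {0..R} (\<lambda>t. k t - \<omega>)"
      using kint[of 0 R] R by (subst Henstock_Kurzweil_Integration.integral_diff) (auto simp: \<omega>_def)
    also have "\<dots> \<le> integral {0..R} h"
      using kint[of 0 R] by (intro integral_le hint Henstock_Kurzweil_Integration.integrable_diff) (auto simp: h_def)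
    finally show ?thesis using that n by (simp add: U_def R_def)
  qed
  define u where "u p = U (infdist p S)" for p
  have cal: "ennreal (u p - u x) \<le> mesh_dist K e x p" for x p
  proof (rule calibration_le_mesh_dist)
    fix p q :: 'a assume pq: "dist p q < e"
    define a b where "a = infdist p S" and "b = infdist q S"
    have ab0: "0 \<le> a" "0 \<le> b" unfolding a_def b_def by (auto simp: infdist_nonneg)
    have ab: "b - a \<le> dist p q" unfolding a_def b_def
      using infdist_triangle[of q S p] by (simp add: dist_commute)
    have nonneg: "0 \<le> max (K p) (K q) * dist p q"
      using K[of p] by (intro mult_nonneg_nonneg) auto
    consider "b \<le> a" | "a < b" "R \<le> a" | "a < b" "a < R" by linarith
    then have "U b - U a \<le> max (K p) (K q) * dist p q"
    proof cases
      case 1 then show ?thesis using U_inc[of b a] ab0 nonneg by simp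
    next
      case 2 then show ?thesis using nonneg by (simp add: U_def)
    next
      case 3
      have "U b - U a \<le> integral {a..min b R} (\<lambda>_. k a)"
        unfolding U_diff[OF ab0(1) less_imp_le[OF 3(1)]]
      proof (subst min_absorb1, use 3 in simp, rule integral_le)
        fix t assume t: "t \<in> {a..min b R}"
        then have "dist t a < e" using ab pq by (auto simp: dist_real_def)
        then have "dist (k t) (k a) < \<omega>" using t ab0 3 by (intro e(2)) auto
        then show "h t \<le> k a" using k_nonneg[OF ab0(1)] by (auto simp: h_def dist_real_def)
      qed (use hint ab0 in auto)
      also have "\<dots> = k a * (min b R - a)" using 3 by simp
      also have "\<dots> \<le> max (K p) (K q) * dist p q"
        using ab 3 k_nonneg[OF ab0(1)] K_lower[of p] unfolding a_def[symmetric]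
        by (intro mult_mono) auto
      finally show ?thesis .
    qed
    then show "u q - u p \<le> max (K p) (K q) * dist p q" by (simp add: u_def a_def b_def)
  qed
  show thesis
  proof (rule that[OF e(1)])
    fix x p assume x: "x \<in> S" and le: "mesh_dist K e x p \<le> ennreal C"
    show "infdist p S \<le> R"
    proof (rule ccontr)
      assume "\<not> infdist p S \<le> R"
      then have "C < u p" unfolding u_def by (intro UR) auto
      moreover have "u x = 0" using x R by (simp add: u_def U_def)
      moreover have "ennreal (u p - u x) \<le> ennreal C" using cal[of p x] le by (rule order.trans)
      ultimately show False using C by (simp add: ennreal_le_iff)
    qed
  qed
qed

text \<open>
  Removes the distinction between finite and infinite end points: in both cases the end values
  are approached at times in \<open>I\<close>.
\<close>

lemma joins_approx:
  fixes \<gamma> :: "real \<Rightarrow> 'a::metric_space"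
  assumes j: "joins I \<gamma> x y" and e: "0 < e"
  obtains u v where "u \<in> I" "v \<in> I" "u \<le> v" "{u..v} \<subseteq> I" "dist x (\<gamma> u) < e" "dist (\<gamma> v) y < e"
proof -
  obtain a b where ab: "I \<noteq> {}" "I = {t. a \<le> ereal t \<and> ereal t \<le> b}" "end_value \<gamma> a x" "end_value \<gamma> b y"
    using j unfolding joins_def by blast
  obtain t where t: "t \<in> I" using ab(1) by blast
  obtain u where u: "u \<in> I" "u \<le> t" "dist x (\<gamma> u) < e"
  proof (cases a)
    case (real r)
    then have "ereal r \<le> b" using ab(2) t by (auto intro: order.trans[of _ "ereal t"])
    then show thesis using real ab t e by (intro that[of r]) auto
  next
    case PInf then show thesis using ab t by auto
  next
    case MInf
    then have "(\<gamma> \<longlongrightarrow> x) at_bot" using ab(3) by simp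
    then have "\<forall>\<^sub>F s in at_bot. dist (\<gamma> s) x < e" using e by (rule tendstoD)
    then obtain N where N: "\<And>s. s \<le> N \<Longrightarrow> dist (\<gamma> s) x < e" unfolding eventually_at_bot_linorder by blast
    have "min N t \<in> I" using MInf ab(2) t by (auto intro: order.trans[of _ "ereal t"])
    then show thesis using N[of "min N t"] by (intro that[of "min N t"]) (auto simp: dist_commute)
  qed
  obtain v where v: "v \<in> I" "t \<le> v" "dist (\<gamma> v) y < e"
  proof (cases b)
    case (real r)
    then have "a \<le> ereal r" using ab(2) t by (auto intro: order.trans[of _ "ereal t"])
    then show thesis using real ab t e by (intro that[of r]) auto
  next
    case MInf then show thesis using ab t by auto
  next
    case PInf
    then have "(\<gamma> \<longlongrightarrow> y) at_top" using ab(4) by simp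
    then have "\<forall>\<^sub>F s in at_top. dist (\<gamma> s) y < e" using e by (rule tendstoD)
    then obtain N where N: "\<And>s. s \<ge> N \<Longrightarrow> dist (\<gamma> s) y < e" unfolding eventually_at_top_linorder by blast
    have "max N t \<in> I" using PInf ab(2) t by (auto intro: order.trans[of _ "ereal t"])
    then show thesis using N[of "max N t"] by (intro that[of "max N t"]) auto
  qed
  have "{u..v} \<subseteq> I"
  proof
    fix s assume s: "s \<in> {u..v}"
    have "a \<le> ereal s" using u(1) s unfolding ab(2) by (auto intro: order.trans[of _ "ereal u"])
    moreover have "ereal s \<le> b" using v(1) s unfolding ab(2) by (auto intro: order.trans[of _ "ereal v"])
    ultimately show "s \<in> I" unfolding ab(2) by simp
  qed
  then show thesis using that u v by (meson order.trans)
qed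

text \<open>
  Sampling a curve at equidistant times gives a chain whose total hop length is at most the
  length of the curve.
\<close>

lemma length_curve_chain:
  fixes \<gamma> :: "real \<Rightarrow> 'a::metric_space"
  assumes uv: "u \<le> v" "{u..v} \<subseteq> I" and cont: "continuous_on {u..v} \<gamma>" and e: "0 < e"
    and len: "curve_length I \<gamma> \<le> ennreal l" "0 \<le> l"
    and M: "\<And>t. t \<in> {u..v} \<Longrightarrow> K (\<gamma> t) \<le> M" "0 \<le> M"
  shows "mesh_dist K e (\<gamma> u) (\<gamma> v) \<le> ennreal (M * l)"
proof -
  have "uniformly_continuous_on {u..v} \<gamma>" by (rule compact_uniformly_continuous[OF cont]) simp
  then obtain d where d: "0 < d" "\<And>s t. s \<in> {u..v} \<Longrightarrow> t \<in> {u..v} \<Longrightarrow> dist s t < d \<Longrightarrow> dist (\<gamma> s) (\<gamma> t) < e"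
    unfolding uniformly_continuous_on_def using e by metis
  obtain n where n: "(v - u) / d < real n" using reals_Archimedean2 by blast
  define N where "N = Suc n"
  have N: "(v - u) / real N < d"
  proof -
    have "v - u < real n * d" using n d(1) by (simp add: divide_less_eq)
    also have "\<dots> \<le> real N * d" using d(1) by (simp add: N_def)
    finally show ?thesis by (simp add: N_def divide_less_eq mult.commute)
  qed
  define t where "t i = u + real i * ((v - u) / real N)" for i
  have step: "t (Suc i) - t i = (v - u) / real N" for i unfolding t_def of_nat_Suc distrib_right by simp
  have t_in: "t i \<in> {u..v}" if "i \<le> N" for i
  proof -
    have "real i * ((v - u) / real N) \<le> real N * ((v - u) / real N)"
      using that uv by (intro mult_right_mono) auto
    then show ?thesis using uv by (auto simp: t_def N_def)
  qed
  have chain: "chain K e (\<gamma> u) (\<gamma> (t j)) (\<Sum>i<j. max (K (\<gamma> (t i))) (K (\<gamma> (t (Suc i)))) * dist (\<gamma> (t i)) (\<gamma> (t (Suc i))))"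
    if "j \<le> N" for j
    using that
  proof (induction j)
    case 0 then show ?case by (simp add: t_def chain_refl)
  next
    case (Suc j)
    have "0 \<le> (v - u) / real N" using uv by simp
    then have "dist (t j) (t (Suc j)) < d" using step[of j] N unfolding dist_real_def by linarith
    then have "dist (\<gamma> (t j)) (\<gamma> (t (Suc j))) < e" using Suc.prems t_in by (intro d(2)) auto
    then show ?case using chain_step[OF Suc.IH] Suc.prems by simp
  qed
  let ?S = "\<Sum>i<N. dist (\<gamma> (t i)) (\<gamma> (t (Suc i)))"
  have "ennreal ?S \<le> curve_length I \<gamma>"
    unfolding curve_length_def
  proof (rule Sup_upper, rule CollectI, intro exI conjI)
    show "1 \<le> N" by (simp add: N_def)
    show "\<forall>i\<le>N. t i \<in> I" using t_in uv by blast
    show "\<forall>i<N. t i \<le> t (Suc i)" using step uv by (metis diff_ge_0_iff_ge divide_nonneg_nonneg of_nat_0_le_iff)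
  qed simp
  then have S: "?S \<le> l" using len by (metis ennreal_le_iff order.trans)
  have "(\<Sum>i<N. max (K (\<gamma> (t i))) (K (\<gamma> (t (Suc i)))) * dist (\<gamma> (t i)) (\<gamma> (t (Suc i)))) \<le> (\<Sum>i<N. M * dist (\<gamma> (t i)) (\<gamma> (t (Suc i))))"
    using M t_in by (intro sum_mono mult_right_mono) auto
  also have "\<dots> = M * ?S" by (simp add: sum_distrib_left)
  also have "\<dots> \<le> M * l" using S M by (intro mult_left_mono) auto
  finally have *: "(\<Sum>i<N. max (K (\<gamma> (t i))) (K (\<gamma> (t (Suc i)))) * dist (\<gamma> (t i)) (\<gamma> (t (Suc i)))) \<le> M * l" .
  have "t N = v" by (simp add: t_def N_def)
  then have "mesh_dist K e (\<gamma> u) (\<gamma> v) \<le> ennreal (\<Sum>i<N. max (K (\<gamma> (t i))) (K (\<gamma> (t (Suc i)))) * dist (\<gamma> (t i)) (\<gamma> (t (Suc i))))"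
    using mesh_dist_le[OF chain[of N]] by simp
  also have "\<dots> \<le> ennreal (M * l)" using * by (rule ennreal_leI)
  finally show ?thesis .
qed

lemma dist_le_curve_length:
  assumes "s \<in> I" "t \<in> I" "s \<le> t"
  shows "ennreal (dist (\<gamma> s) (\<gamma> t)) \<le> curve_length I \<gamma>"
  unfolding curve_length_def
proof (rule Sup_upper, rule CollectI, intro exI conjI)
  show "1 \<le> (1::nat)" by simp
  show "\<forall>i\<le>1. (if i = (0::nat) then s else t) \<in> I" "\<forall>i<1. (if i = (0::nat) then s else t) \<le> (if Suc i = 0 then s else t)"
    using assms by auto
qed simp

text \<open>
  A curve of length at most \<open>dist x y + 1\<close> stays in a bounded set, where properness bounds \<open>K\<close>;
  the bound does not depend on the mesh.
\<close>

lemma chain_dist_finite: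
  fixes K :: "'a::metric_space \<Rightarrow> real"
  assumes proper: "proper_metric TYPE('a)" and length: "length_metric TYPE('a)"
    and K: "\<And>p. 0 \<le> K p" "continuous_on UNIV K"
  shows "chain_dist K x y < \<infinity>"
proof -
  define l where "l = dist x y + 1"
  have "Inf {curve_length I \<gamma> | I \<gamma>. joins I \<gamma> x y} < ennreal l"
    using length unfolding length_metric_def l_def by (metis ennreal_less_iff less_add_one zero_le_dist)
  then obtain I \<gamma> where j: "joins I \<gamma> x y" and len: "curve_length I \<gamma> < ennreal l"
    unfolding Inf_less_iff by blast
  have l: "0 \<le> l" by (simp add: l_def)
  obtain M where M: "0 < M" "\<And>p. p \<in> cball x (l + 1) \<union> cball y 1 \<Longrightarrow> K p \<le> M"
    using proper_bounded_above[OF proper K(2), of "cball x (l + 1) \<union> cball y 1"] by auto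
  have "chain_dist K x y \<le> ennreal (M + M * l + M)"
  proof (rule chain_dist_leI[of 1])
    fix e :: real assume e: "0 < e" "e \<le> 1"
    obtain u v where uv: "u \<in> I" "v \<in> I" "u \<le> v" "{u..v} \<subseteq> I" "dist x (\<gamma> u) < e" "dist (\<gamma> v) y < e"
      using joins_approx[OF j e(1)] by blast
    have near: "K (\<gamma> t) \<le> M" if "t \<in> {u..v}" for t
    proof (rule M(2), rule UnI1)
      have "ennreal (dist (\<gamma> u) (\<gamma> t)) < ennreal l"
        using dist_le_curve_length[of u I t \<gamma>] uv that len by (auto intro: le_less_trans)
      then have "dist (\<gamma> u) (\<gamma> t) < l" by (simp add: ennreal_less_iff)
      then show "\<gamma> t \<in> cball x (l + 1)" using dist_triangle[of x "\<gamma> t" "\<gamma> u"] uv(5) e(2) by simp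
    qed
    have end_le: "ennreal (max (K p) (K q) * dist p q) \<le> ennreal M" if "K p \<le> M" "K q \<le> M" "dist p q < e" for p q
      using mult_mono[of "max (K p) (K q)" M "dist p q" 1] that e M(1) by (intro ennreal_leI) auto
    have x: "K x \<le> M" and y: "K y \<le> M" using M(2) l by auto
    have cont: "continuous_on {u..v} \<gamma>"
      using j uv(4) unfolding joins_def by (blast intro: continuous_on_subset)
    have "mesh_dist K e x y \<le> ennreal M + ennreal (M * l) + ennreal M"
    proof (rule mesh_dist_triangle3[OF K(1)])
      show "mesh_dist K e x (\<gamma> u) \<le> ennreal M"
        using mesh_dist_single[OF uv(5)] end_le[OF x near[of u] uv(5)] uv(3) by (auto intro: order.trans)
      show "mesh_dist K e (\<gamma> v) y \<le> ennreal M"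
        using mesh_dist_single[OF uv(6)] end_le[OF near[of v] y uv(6)] uv(3) by (auto intro: order.trans)
      show "mesh_dist K e (\<gamma> u) (\<gamma> v) \<le> ennreal (M * l)"
        using len near M(1) l by (intro length_curve_chain[OF uv(3,4) cont e(1)]) auto
    qed
    also have "\<dots> = ennreal (M + M * l + M)"
      using M(1) l by (simp flip: ennreal_plus)
    finally show "mesh_dist K e x y \<le> ennreal (M + M * l + M)" .
  qed simp
  then show ?thesis by (rule le_less_trans) simp
qed

section \<open>Chains along curves\<close>

lemma nn_integral_Icc_split:
  fixes g :: "real \<Rightarrow> ennreal"
  assumes meas: "(\<lambda>t. g t * indicator I t) \<in> borel_measurable lebesgue"
    and I: "{a..c} \<subseteq> I" and abc: "a \<le> b" "b \<le> c"
  shows "(\<integral>\<^sup>+t\<in>{a..b}. g t \<partial>lebesgue) + (\<integral>\<^sup>+t\<in>{b..c}. g t \<partial>lebesgue) = (\<integral>\<^sup>+t\<in>{a..c}. g t \<partial>lebesgue)"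
proof -
  have m: "(\<lambda>t. g t * indicator A t) \<in> borel_measurable lebesgue" if "A \<subseteq> {a..c}" "A \<in> sets borel" for A
  proof -
    have "(\<lambda>t. (g t * indicator I t) * indicator A t) \<in> borel_measurable lebesgue"
      using that by (intro borel_measurable_times_ennreal meas borel_measurable_indicator) auto
    also have "(\<lambda>t. (g t * indicator I t) * indicator A t) = (\<lambda>t. g t * indicator A t)"
      using that(1) I by (auto simp: fun_eq_iff indicator_def)
    finally show ?thesis .
  qed
  have "(\<integral>\<^sup>+t\<in>{a..b}. g t \<partial>lebesgue) + (\<integral>\<^sup>+t\<in>{b..c}. g t \<partial>lebesgue) =
      (\<integral>\<^sup>+t. g t * indicator {a..b} t + g t * indicator {b..c} t \<partial>lebesgue)"
    using abc by (intro nn_integral_add[symmetric] m) auto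
  also have "\<dots> = (\<integral>\<^sup>+t\<in>{a..c}. g t \<partial>lebesgue)"
  proof (rule nn_integral_cong_AE)
    have "AE t in lebesgue. t \<notin> {b}"
      by (rule AE_not_in_finite) simp
    then show "AE t in lebesgue. g t * indicator {a..b} t + g t * indicator {b..c} t = g t * indicator {a..c} t"
      by eventually_elim (use abc in \<open>auto simp: indicator_def\<close>)
  qed
  finally show ?thesis .
qed

text \<open>
  A single hop shows that the mesh distance is continuous with respect to the metric.
\<close>

lemma mesh_dist_small:
  fixes K :: "'a::metric_space \<Rightarrow> real"
  assumes K: "\<And>p. 0 \<le> K p" "continuous_on UNIV K" and e: "0 < e" and \<epsilon>: "0 < \<epsilon>"
  obtains d where "0 < d" "\<And>y. dist y x < d \<Longrightarrow> mesh_dist K e y x \<le> ennreal \<epsilon>"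
proof -
  have "open {q. K q < K x + 1}" by (intro open_Collect_less continuous_intros K(2))
  then obtain r where r: "0 < r" "ball x r \<subseteq> {q. K q < K x + 1}"
    using openE[of "{q. K q < K x + 1}" x] by auto
  (* \<open>K x + 1\<close> bounds \<open>K\<close> near \<open>x\<close> and is positive even if \<open>x\<close> is a zero of \<open>K\<close> *)
  define d where "d = min (min e r) (\<epsilon> / (K x + 1))"
  have Kx: "0 < K x + 1" using K(1)[of x] by simp
  show thesis
  proof (rule that)
    show "0 < d" using e r Kx \<epsilon> by (simp add: d_def)
    fix y assume y: "dist y x < d"
    have "max (K y) (K x) \<le> K x + 1"
      using r(2) y by (auto simp: d_def dist_commute subset_iff intro: less_imp_le)
    then have "max (K y) (K x) * dist y x \<le> (K x + 1) * (\<epsilon> / (K x + 1))"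
      using y K(1)[of x] by (intro mult_mono) (auto simp: d_def)
    also have "\<dots> = \<epsilon>" using Kx by simp
    finally show "mesh_dist K e y x \<le> ennreal \<epsilon>"
      using mesh_dist_single[of y x e K] y by (auto simp: d_def intro: order.trans ennreal_leI)
  qed
qed

text \<open>
  The estimate with an error \<open>\<delta> * (v - u)\<close> is additive in the interval, so by bisection it needs
  to hold only for small intervals. On those a single hop suffices: its length is at most the
  integral of the metric derivative, and \<open>K\<close> oscillates by less than \<open>2 * \<eta>\<close>, an error that the
  Lipschitz bound makes proportional to the length of the interval.
\<close>

lemma mesh_dist_le_weighted_length_smooth:
  fixes \<gamma> :: "real \<Rightarrow> 'a::metric_space"
  assumes off: "lipschitz_off T I \<gamma>" and K: "\<And>p. 0 \<le> K p" "continuous_on UNIV K"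
    and e: "0 < e" and uv: "u \<le> v" "{u..v} \<subseteq> I - T"
  shows "mesh_dist K e (\<gamma> u) (\<gamma> v) \<le> (\<integral>\<^sup>+t\<in>{u..v}. ennreal (K (\<gamma> t) * metric_derivative I \<gamma> t) \<partial>lebesgue)"
proof -
  define md where "md = metric_derivative I \<gamma>"
  define G where "G a b = (\<integral>\<^sup>+t\<in>{a..b}. ennreal (K (\<gamma> t) * md t) \<partial>lebesgue)" for a b
  have meas: "(\<lambda>t. ennreal (K (\<gamma> t) * md t) * indicator I t) \<in> borel_measurable lebesgue"
    unfolding md_def by (rule weighted_speed_measurable[OF off K(2)])
  have md_meas: "(\<lambda>t. ennreal (md t) * indicator {a..b} t) \<in> borel_measurable lebesgue" if "{a..b} \<subseteq> I" for a b
  proof -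
    have "(\<lambda>t. ennreal (1 * md t) * indicator I t) \<in> borel_measurable lebesgue"
      unfolding md_def by (rule weighted_speed_measurable[OF off continuous_on_const])
    then have "(\<lambda>t. (ennreal (1 * md t) * indicator I t) * indicator {a..b} t) \<in> borel_measurable lebesgue"
      by (rule borel_measurable_times_ennreal) (rule borel_measurable_indicator, simp)
    then show ?thesis
      by (rule measurable_cong[THEN iffD1, rotated]) (use that in \<open>auto simp: indicator_def\<close>)
  qed
  have approx: "mesh_dist K e (\<gamma> u) (\<gamma> v) \<le> G u v + ennreal (\<delta> * (v - u))" if \<delta>: "0 < \<delta>" for \<delta>
  proof -
    have "u \<le> u \<longrightarrow> v \<le> v \<longrightarrow> mesh_dist K e (\<gamma> u) (\<gamma> v) \<le> G u v + ennreal (\<delta> * (v - u))"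
      using uv(1)
    proof (induction rule: Bolzano[where P = "\<lambda>a b. u \<le> a \<longrightarrow> b \<le> v \<longrightarrow>
          mesh_dist K e (\<gamma> a) (\<gamma> b) \<le> G a b + ennreal (\<delta> * (b - a))"])
      case (trans a b c)
      show ?case
      proof (intro impI)
        assume ac: "u \<le> a" "c \<le> v"
        have "mesh_dist K e (\<gamma> a) (\<gamma> c) \<le> mesh_dist K e (\<gamma> a) (\<gamma> b) + mesh_dist K e (\<gamma> b) (\<gamma> c)"
          by (rule mesh_dist_triangle[OF K(1)])
        also have "\<dots> \<le> (G a b + ennreal (\<delta> * (b - a))) + (G b c + ennreal (\<delta> * (c - b)))"
          using trans ac by (intro add_mono) auto
        also have "\<dots> = (G a b + G b c) + (ennreal (\<delta> * (b - a)) + ennreal (\<delta> * (c - b)))"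
          by (simp add: ac_simps)
        also have "G a b + G b c = G a c"
        proof -
          have "{a..c} \<subseteq> I" using ac subsetD[OF uv(2)] by auto
          then show ?thesis
            unfolding G_def using trans by (intro nn_integral_Icc_split[OF meas]) auto
        qed
        also have "ennreal (\<delta> * (b - a)) + ennreal (\<delta> * (c - b)) = ennreal (\<delta> * (c - a))"
          using trans \<delta> by (simp add: algebra_simps flip: ennreal_plus)
        finally show "mesh_dist K e (\<gamma> a) (\<gamma> c) \<le> G a c + ennreal (\<delta> * (c - a))" .
      qed
    next
      case (local x)
      then have "x \<in> I - T" using uv(2) by auto
      then obtain r L where r: "0 < r" "cball x r \<subseteq> I" "L-lipschitz_on (cball x r) \<gamma>"
        using lipschitz_off_local[OF off] by blast
      have L: "0 \<le> L" using r(3) by (rule lipschitz_on_nonneg)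
      define \<eta> where "\<eta> = \<delta> / (2 * (L + 1))"
      have \<eta>: "0 < \<eta>" "2 * \<eta> * L \<le> \<delta>" using L \<delta> by (auto simp: \<eta>_def field_simps)
      define \<kappa> where "\<kappa> = K (\<gamma> x)"
      have "continuous_on (cball x r) \<gamma>" using r(3) by (rule lipschitz_on_continuous_on)
      then have "continuous_on (cball x r) (\<lambda>t. K (\<gamma> t))" by (rule continuous_on_compose2[OF K(2)]) auto
      then obtain d0 where d0: "0 < d0" "\<And>t. t \<in> cball x r \<Longrightarrow> dist t x < d0 \<Longrightarrow> dist (K (\<gamma> t)) \<kappa> < \<eta>"
        using \<eta>(1) r(1) unfolding continuous_on_iff \<kappa>_def by (metis centre_in_cball less_imp_le)
      define d where "d = min (min d0 r) (e / (L + 1))"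
      have d: "0 < d" using d0 r e L by (simp add: d_def)
      show ?case
      proof (intro exI conjI allI impI)
        show "0 < d" by (rule d)
        fix a b assume ab: "a \<le> x \<and> x \<le> b \<and> b - a < d" "u \<le> a" "b \<le> v"
        have sub: "{a..b} \<subseteq> cball x r" using ab by (auto simp: d_def dist_real_def)
        have near: "\<bar>K (\<gamma> t) - \<kappa>\<bar> < \<eta>" if "t \<in> {a..b}" for t
          using d0(2)[of t] sub that ab by (auto simp: d_def dist_real_def subset_iff)
        have lip: "dist (\<gamma> a) (\<gamma> b) \<le> L * (b - a)"
        proof -
          have "a \<in> cball x r" "b \<in> cball x r" using subsetD[OF sub, of a] subsetD[OF sub, of b] ab by auto
          from lipschitz_onD[OF r(3) this] show ?thesis using ab by (simp add: dist_real_def)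
        qed
        also have "\<dots> \<le> (L + 1) * (b - a)" using ab by (intro mult_right_mono) auto
        also have "\<dots> < (L + 1) * (e / (L + 1))" using ab L by (intro mult_strict_left_mono) (auto simp: d_def)
        also have "\<dots> = e" using L by simp
        finally have link: "dist (\<gamma> a) (\<gamma> b) < e" .
        (* a lower bound of \<open>K\<close> along the curve on \<open>[a, b]\<close> *)
        define c where "c = max 0 (\<kappa> - \<eta>)"
        have "ennreal (dist (\<gamma> a) (\<gamma> b)) \<le> (\<integral>\<^sup>+t\<in>{a..b}. ennreal (md t) \<partial>lebesgue)"
        proof -
          have "a \<le> b" "{a..b} \<subseteq> I" using ab sub r(2) by auto
          show ?thesis
          proof (rule metric_derivative_lipschitz_window[OF lipschitz_on_subset[OF r(3) sub] \<open>a \<le> b\<close> \<open>{a..b} \<subseteq> I\<close>])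
            assume "\<And>s t. a \<le> s \<Longrightarrow> s \<le> t \<Longrightarrow> t \<le> b \<Longrightarrow>
              ennreal (dist (\<gamma> s) (\<gamma> t)) \<le> (\<integral>\<^sup>+r\<in>{s..t}. ennreal (metric_derivative I \<gamma> r) \<partial>lebesgue)"
            from this[of a b] show ?thesis using \<open>a \<le> b\<close> by (simp add: md_def)
          qed
        qed
        then have "ennreal c * ennreal (dist (\<gamma> a) (\<gamma> b)) \<le> ennreal c * (\<integral>\<^sup>+t\<in>{a..b}. ennreal (md t) \<partial>lebesgue)"
          by (rule mult_left_mono) simp
        also have "\<dots> = (\<integral>\<^sup>+t. ennreal c * (ennreal (md t) * indicator {a..b} t) \<partial>lebesgue)"
          using sub r(2) by (intro nn_integral_cmult[symmetric] md_meas) auto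
        also have "\<dots> \<le> G a b"
          unfolding G_def
        proof (rule nn_integral_mono)
          fix t :: real
          show "ennreal c * (ennreal (md t) * indicator {a..b} t) \<le> ennreal (K (\<gamma> t) * md t) * indicator {a..b} t"
          proof (cases "t \<in> {a..b} \<and> 0 \<le> md t")
            case True
            then have "c \<le> K (\<gamma> t)" using near[of t] K(1)[of "\<gamma> t"] by (auto simp: c_def)
            then show ?thesis using True by (auto simp: c_def mult_right_mono intro!: ennreal_leI simp flip: ennreal_mult)
          qed (auto simp: ennreal_neg)
        qed
        finally have low: "ennreal (c * dist (\<gamma> a) (\<gamma> b)) \<le> G a b" by (simp add: c_def ennreal_mult)
        have "max (K (\<gamma> a)) (K (\<gamma> b)) \<le> c + 2 * \<eta>"
          using near[of a] near[of b] ab by (auto simp: c_def)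
        then have "max (K (\<gamma> a)) (K (\<gamma> b)) * dist (\<gamma> a) (\<gamma> b) \<le> (c + 2 * \<eta>) * dist (\<gamma> a) (\<gamma> b)"
          by (rule mult_right_mono) simp
        also have "\<dots> = c * dist (\<gamma> a) (\<gamma> b) + 2 * \<eta> * dist (\<gamma> a) (\<gamma> b)" by (simp add: algebra_simps)
        also have "2 * \<eta> * dist (\<gamma> a) (\<gamma> b) \<le> 2 * \<eta> * (L * (b - a))"
          using lip \<eta> by (intro mult_left_mono) auto
        also have "\<dots> = (2 * \<eta> * L) * (b - a)" by simp
        also have "\<dots> \<le> \<delta> * (b - a)" using \<eta> ab by (intro mult_right_mono) auto
        finally have up: "max (K (\<gamma> a)) (K (\<gamma> b)) * dist (\<gamma> a) (\<gamma> b) \<le> c * dist (\<gamma> a) (\<gamma> b) + \<delta> * (b - a)" by simp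
        have "mesh_dist K e (\<gamma> a) (\<gamma> b) \<le> ennreal (c * dist (\<gamma> a) (\<gamma> b) + \<delta> * (b - a))"
          using mesh_dist_single[OF link, of K] ennreal_leI[OF up] by (rule order.trans)
        also have "\<dots> = ennreal (c * dist (\<gamma> a) (\<gamma> b)) + ennreal (\<delta> * (b - a))"
          using ab \<delta> by (intro ennreal_plus) (auto simp: c_def)
        also have "\<dots> \<le> G a b + ennreal (\<delta> * (b - a))" using low by (rule add_right_mono)
        finally show "mesh_dist K e (\<gamma> a) (\<gamma> b) \<le> G a b + ennreal (\<delta> * (b - a))" .
      qed
    qed
    then show ?thesis by simp
  qed
  have "mesh_dist K e (\<gamma> u) (\<gamma> v) \<le> G u v"
  proof (rule ennreal_le_epsilon)
    fix \<epsilon> :: real assume \<epsilon>: "0 < \<epsilon>"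
    define \<delta> where "\<delta> = \<epsilon> / (v - u + 1)"
    have "0 < \<delta>" "\<delta> * (v - u) \<le> \<epsilon>" using \<epsilon> uv(1) by (auto simp: \<delta>_def field_simps)
    then show "mesh_dist K e (\<gamma> u) (\<gamma> v) \<le> G u v + ennreal \<epsilon>"
      using approx[of \<delta>] by (meson add_left_mono ennreal_leI order.trans)
  qed
  then show ?thesis unfolding G_def md_def .
qed

lemma mesh_dist_le_limit:
  fixes K :: "'a::metric_space \<Rightarrow> real"
  assumes K: "\<And>p. 0 \<le> K p" "continuous_on UNIV K" and e: "0 < e"
    and lim: "(g \<longlongrightarrow> y) F" "F \<noteq> bot" and le: "\<forall>\<^sub>F s in F. mesh_dist K e x (g s) \<le> C"
  shows "mesh_dist K e x y \<le> C"
proof (rule ennreal_le_epsilon)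
  fix \<epsilon> :: real assume "0 < \<epsilon>"
  then obtain d where d: "0 < d" "\<And>q. dist q y < d \<Longrightarrow> mesh_dist K e q y \<le> ennreal \<epsilon>"
    using mesh_dist_small[OF K e] by blast
  have "\<forall>\<^sub>F s in F. dist (g s) y < d \<and> mesh_dist K e x (g s) \<le> C"
    using tendstoD[OF lim(1) d(1)] le by (rule eventually_conj)
  then obtain s where s: "dist (g s) y < d" "mesh_dist K e x (g s) \<le> C"
    using eventually_happens'[OF lim(2)] by blast
  have "mesh_dist K e x y \<le> mesh_dist K e x (g s) + mesh_dist K e (g s) y"
    by (rule mesh_dist_triangle[OF K(1)])
  also have "\<dots> \<le> C + ennreal \<epsilon>" using s d(2) by (intro add_mono) auto
  finally show "mesh_dist K e x y \<le> C + ennreal \<epsilon>" .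
qed

text \<open>
  Bad times need no Lipschitz estimate: the inequality for intervals that avoid them passes to
  the closure by continuity of the curve, and intervals are then joined by bisection.
\<close>

lemma mesh_dist_le_weighted_length:
  fixes \<gamma> :: "real \<Rightarrow> 'a::metric_space"
  assumes off: "lipschitz_off T I \<gamma>" and K: "\<And>p. 0 \<le> K p" "continuous_on UNIV K"
    and e: "0 < e" and uv: "u \<le> v" "{u..v} \<subseteq> I"
  shows "mesh_dist K e (\<gamma> u) (\<gamma> v) \<le> (\<integral>\<^sup>+t\<in>{u..v}. ennreal (K (\<gamma> t) * metric_derivative I \<gamma> t) \<partial>lebesgue)"
proof -
  define G where "G a b = (\<integral>\<^sup>+t\<in>{a..b}. ennreal (K (\<gamma> t) * metric_derivative I \<gamma> t) \<partial>lebesgue)" for a b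
  have meas: "(\<lambda>t. ennreal (K (\<gamma> t) * metric_derivative I \<gamma> t) * indicator I t) \<in> borel_measurable lebesgue"
    by (rule weighted_speed_measurable[OF off K(2)])
  have G_mono: "G a b \<le> G a' b'" if "{a..b} \<subseteq> {a'..b'}" for a b a' b'
    unfolding G_def using that by (intro nn_integral_mono) (auto simp: indicator_def)
  have cont: "continuous_on {u..v} \<gamma>" and T: "finite T"
    using off uv(2) unfolding lipschitz_off_def by (auto intro: continuous_on_subset)
  have "u \<le> u \<longrightarrow> v \<le> v \<longrightarrow> mesh_dist K e (\<gamma> u) (\<gamma> v) \<le> G u v"
    using uv(1)
  proof (induction rule: Bolzano[where P = "\<lambda>a b. u \<le> a \<longrightarrow> b \<le> v \<longrightarrow> mesh_dist K e (\<gamma> a) (\<gamma> b) \<le> G a b"])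
    case (trans a b c)
    show ?case
    proof (intro impI)
      assume ac: "u \<le> a" "c \<le> v"
      have "mesh_dist K e (\<gamma> a) (\<gamma> c) \<le> mesh_dist K e (\<gamma> a) (\<gamma> b) + mesh_dist K e (\<gamma> b) (\<gamma> c)"
        by (rule mesh_dist_triangle[OF K(1)])
      also have "\<dots> \<le> G a b + G b c" using trans ac by (intro add_mono) auto
      also have "\<dots> = G a c"
        unfolding G_def using trans ac uv(2) by (intro nn_integral_Icc_split[OF meas]) auto
      finally show "mesh_dist K e (\<gamma> a) (\<gamma> c) \<le> G a c" .
    qed
  next
    case (local x)
    obtain d where d: "0 < d" "\<And>t. t \<in> T \<Longrightarrow> t \<noteq> x \<Longrightarrow> d \<le> dist x t"
      using finite_set_avoid[OF T, of x] by blast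
    have smooth: "mesh_dist K e (\<gamma> a) (\<gamma> b) \<le> G a b"
      if "u \<le> a" "a \<le> b" "b \<le> v" "x - d < a" "b < x + d" "b < x \<or> x < a" for a b
      unfolding G_def
    proof (rule mesh_dist_le_weighted_length_smooth[OF off K e \<open>a \<le> b\<close>])
      show "{a..b} \<subseteq> I - T" using that uv(2) d(2) by (force simp: dist_real_def)
    qed
    have half: "mesh_dist K e (\<gamma> a) (\<gamma> x) \<le> G (min a x) (max a x)"
      if a: "u \<le> a" "a \<le> v" "\<bar>a - x\<bar> < d" for a
    proof (cases "a = x")
      case False
      let ?J = "{min a x<..<max a x}"
      have "(\<gamma> \<longlongrightarrow> \<gamma> x) (at x within {u..v})" using cont local unfolding continuous_on_def by auto
      then have lim: "(\<gamma> \<longlongrightarrow> \<gamma> x) (at x within ?J)"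
        by (rule tendsto_within_subset) (use a local in auto)
      have ne: "at x within ?J \<noteq> bot"
        using False by (cases "a < x") (auto simp: at_within_eq_bot_iff)
      show ?thesis
      proof (rule mesh_dist_le_limit[OF K e lim ne])
        have "mesh_dist K e (\<gamma> a) (\<gamma> s) \<le> G (min a x) (max a x)" if s: "s \<in> ?J" for s
        proof -
          have "mesh_dist K e (\<gamma> (min a s)) (\<gamma> (max a s)) \<le> G (min a s) (max a s)"
            using a s local d(1) by (intro smooth) (auto simp: min_def max_def split: if_splits)
          also have "\<dots> \<le> G (min a x) (max a x)"
            using s by (intro G_mono) (auto simp: min_def max_def split: if_splits)
          finally show ?thesis by (cases "a \<le> s") (auto simp: mesh_dist_commute)
        qed
        then show "\<forall>\<^sub>F s in at x within ?J. mesh_dist K e (\<gamma> a) (\<gamma> s) \<le> G (min a x) (max a x)"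
          by (auto simp: eventually_at_filter)
      qed
    qed simp
    show ?case
    proof (intro exI conjI allI impI)
      show "0 < d" by (rule d(1))
      fix a b assume ab: "a \<le> x \<and> x \<le> b \<and> b - a < d" "u \<le> a" "b \<le> v"
      have "mesh_dist K e (\<gamma> a) (\<gamma> b) \<le> mesh_dist K e (\<gamma> a) (\<gamma> x) + mesh_dist K e (\<gamma> x) (\<gamma> b)"
        by (rule mesh_dist_triangle[OF K(1)])
      also have "\<dots> \<le> G a x + G x b"
        using half[of a] half[of b] ab local
        by (intro add_mono) (auto simp: mesh_dist_commute[of K e "\<gamma> x"] min_def max_def split: if_splits)
      also have "\<dots> = G a b"
        unfolding G_def using ab uv(2) by (intro nn_integral_Icc_split[OF meas]) auto
      finally show "mesh_dist K e (\<gamma> a) (\<gamma> b) \<le> G a b" .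
    qed
  qed
  then show ?thesis unfolding G_def by simp
qed

lemma chain_dist_le_weighted_dist:
  fixes K :: "'a::metric_space \<Rightarrow> real"
  assumes K: "\<And>p. 0 \<le> K p" "continuous_on UNIV K"
  shows "chain_dist K x y \<le> weighted_dist K x y"
  unfolding weighted_dist_def
proof (rule Inf_greatest, clarify)
  fix I and \<gamma> :: "real \<Rightarrow> 'a" assume ploc: "ploc_lipschitz_curve I \<gamma>" and j: "joins I \<gamma> x y"
  obtain T where off: "lipschitz_off T I \<gamma>" using ploc_lipschitz_curve_imp_lipschitz_off[OF ploc] .
  show "chain_dist K x y \<le> weighted_length K I \<gamma>"
  proof (rule chain_dist_leI[of 1])
    fix e :: real assume e: "0 < e"
    show "mesh_dist K e x y \<le> weighted_length K I \<gamma>"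
    proof (rule ennreal_le_epsilon)
      fix \<epsilon> :: real assume \<epsilon>: "0 < \<epsilon>"
      obtain d1 where d1: "0 < d1" "\<And>q. dist q x < d1 \<Longrightarrow> mesh_dist K e q x \<le> ennreal (\<epsilon> / 2)"
        using mesh_dist_small[OF K e half_gt_zero[OF \<epsilon>]] by blast
      obtain d2 where d2: "0 < d2" "\<And>q. dist q y < d2 \<Longrightarrow> mesh_dist K e q y \<le> ennreal (\<epsilon> / 2)"
        using mesh_dist_small[OF K e half_gt_zero[OF \<epsilon>]] by blast
      obtain u v where uv: "u \<le> v" "{u..v} \<subseteq> I" "dist x (\<gamma> u) < min d1 d2" "dist (\<gamma> v) y < min d1 d2"
        using joins_approx[OF j, of "min d1 d2"] d1(1) d2(1) by (metis min_less_iff_conj)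
      have mid: "mesh_dist K e (\<gamma> u) (\<gamma> v) \<le> weighted_length K I \<gamma>"
        using mesh_dist_le_weighted_length[OF off K e uv(1,2)]
      proof (rule order.trans)
        show "(\<integral>\<^sup>+t\<in>{u..v}. ennreal (K (\<gamma> t) * metric_derivative I \<gamma> t) \<partial>lebesgue) \<le> weighted_length K I \<gamma>"
          unfolding weighted_length_def using uv(2) by (intro nn_integral_mono) (auto simp: indicator_def)
      qed
      have "mesh_dist K e x y \<le> ennreal (\<epsilon> / 2) + weighted_length K I \<gamma> + ennreal (\<epsilon> / 2)"
      proof (rule mesh_dist_triangle3[OF K(1) _ mid])
        show "mesh_dist K e x (\<gamma> u) \<le> ennreal (\<epsilon> / 2)"
          using d1(2)[of "\<gamma> u"] uv(3) by (simp add: mesh_dist_commute dist_commute)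
        show "mesh_dist K e (\<gamma> v) y \<le> ennreal (\<epsilon> / 2)" using d2(2) uv(4) by simp
      qed
      also have "\<dots> = weighted_length K I \<gamma> + ennreal \<epsilon>"
      proof -
        have "ennreal (\<epsilon> / 2) + ennreal (\<epsilon> / 2) = ennreal \<epsilon>" using \<epsilon> by (simp flip: ennreal_plus)
        then show ?thesis by (metis add.assoc add.commute)
      qed
      finally show "mesh_dist K e x y \<le> weighted_length K I \<gamma> + ennreal \<epsilon>" .
    qed
  qed simp
qed

text \<open>
  A chain becomes a map on \<open>[0, c]\<close> that sits at the point reached once the accumulated cost has
  been spent. Jumps cost at most \<open>\<delta>\<close>, hence the additive error. The estimate towards \<open>y\<close> carries
  no error, and this is what keeps the error from accumulating in the induction. The set \<open>B\<close> and
  the bound \<open>M\<close> come from confinement, as every point of the chain is reached at cost at most \<open>C\<close>.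
\<close>

lemma chain_parametrization:
  fixes K :: "'a::metric_space \<Rightarrow> real"
  assumes chain: "chain K e x y c" and K: "\<And>p. 0 \<le> K p"
    and B: "\<And>p. mesh_dist K e x p \<le> ennreal C \<Longrightarrow> p \<in> B \<and> K p \<le> M"
    and \<delta>: "M * e \<le> \<delta>" "0 \<le> \<delta>" and c: "c \<le> C"
  shows "\<exists>g. (\<forall>s. g s \<in> B) \<and>
    (\<forall>s t. 0 \<le> s \<longrightarrow> s \<le> t \<longrightarrow> t \<le> c \<longrightarrow> mesh_dist K e (g s) (g t) \<le> ennreal (t - s + \<delta>)) \<and>
    (\<forall>s. 0 \<le> s \<longrightarrow> s \<le> c \<longrightarrow> mesh_dist K e (g s) y \<le> ennreal (c - s) \<and> mesh_dist K e x (g s) \<le> ennreal (s + \<delta>))"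
  using chain c
proof (induction rule: chain.induct)
  case chain_refl
  then show ?case using B[of x] \<delta>(2) by (intro exI[of _ "\<lambda>_. x"]) auto
next
  case (chain_step y c z)
  define w where "w = max (K y) (K z) * dist y z"
  have w0: "0 \<le> w" using K[of y] unfolding w_def by (intro mult_nonneg_nonneg) auto
  have c0: "0 \<le> c" using chain_nonneg[OF chain_step.hyps(1) K] .
  have cw: "c + w \<le> C" using chain_step.prems by (simp add: w_def)
  have "c \<le> C" using cw w0 by simp
  from chain_step.IH[OF this] obtain g where g: "\<And>s. g s \<in> B"
    "\<And>s t. 0 \<le> s \<Longrightarrow> s \<le> t \<Longrightarrow> t \<le> c \<Longrightarrow> mesh_dist K e (g s) (g t) \<le> ennreal (t - s + \<delta>)"
    "\<And>s. 0 \<le> s \<Longrightarrow> s \<le> c \<Longrightarrow> mesh_dist K e (g s) y \<le> ennreal (c - s)"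
    "\<And>s. 0 \<le> s \<Longrightarrow> s \<le> c \<Longrightarrow> mesh_dist K e x (g s) \<le> ennreal (s + \<delta>)"
    by metis
  have z_cost: "mesh_dist K e x z \<le> ennreal (c + w)"
    unfolding w_def by (intro mesh_dist_le chain.chain_step chain_step.hyps)
  have z: "z \<in> B" "K z \<le> M"
    using B[OF order.trans[OF z_cost ennreal_leI[OF cw]]] by auto
  have "mesh_dist K e x y \<le> ennreal C"
    by (rule order.trans[OF mesh_dist_le[OF chain_step.hyps(1)] ennreal_leI[OF \<open>c \<le> C\<close>]])
  then have y: "K y \<le> M" using B by blast
  have w: "w \<le> \<delta>"
  proof -
    have "w \<le> M * e" unfolding w_def
      using y z K[of y] chain_step.hyps(2) by (intro mult_mono) auto
    then show ?thesis using \<delta>(1) by simp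
  qed
  have to_z: "mesh_dist K e (g s) z \<le> ennreal (c + w - s)" if "0 \<le> s" "s \<le> c" for s
  proof -
    have "mesh_dist K e (g s) z \<le> mesh_dist K e (g s) y + mesh_dist K e y z"
      by (rule mesh_dist_triangle[OF K])
    also have "\<dots> \<le> ennreal (c - s) + ennreal w"
      unfolding w_def using that by (intro add_mono g mesh_dist_single chain_step.hyps) auto
    also have "\<dots> = ennreal (c + w - s)" using that w0 by (simp add: algebra_simps flip: ennreal_plus)
    finally show ?thesis .
  qed
  define g' where "g' s = (if s \<le> c then g s else z)" for s
  show ?case
    unfolding w_def[symmetric]
  proof (intro exI[of _ g'] conjI allI impI)
    show "g' s \<in> B" for s using g z by (simp add: g'_def)
    show "mesh_dist K e (g' s) (g' t) \<le> ennreal (t - s + \<delta>)"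
      if s: "0 \<le> s" and t: "s \<le> t" "t \<le> c + w" for s t
    proof -
      consider "t \<le> c" | "s \<le> c" "c < t" | "c < s" using t by linarith
      then show "mesh_dist K e (g' s) (g' t) \<le> ennreal (t - s + \<delta>)"
      proof cases
        case 1 then show ?thesis using g(2) s t by (simp add: g'_def)
      next
        case 2
        then have "mesh_dist K e (g' s) (g' t) \<le> ennreal (c + w - s)" using to_z s by (simp add: g'_def)
        also have "\<dots> \<le> ennreal (t - s + \<delta>)" using w 2 by (intro ennreal_leI) simp
        finally show ?thesis .
      next
        case 3 then show ?thesis using t by (simp add: g'_def)
      qed
    qed
    fix s assume s: "0 \<le> s" and sc: "s \<le> c + w"
    show "mesh_dist K e (g' s) z \<le> ennreal (c + w - s)"
      using to_z s by (simp add: g'_def)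
    show "mesh_dist K e x (g' s) \<le> ennreal (s + \<delta>)"
    proof (cases "s \<le> c")
      case False
      then have "ennreal (c + w) \<le> ennreal (s + \<delta>)" using w \<delta>(2) by (intro ennreal_leI) simp
      then show ?thesis using False z_cost by (simp add: g'_def)
    qed (use g s in \<open>simp add: g'_def\<close>)
  qed
qed

text \<open>
  Tychonoff's theorem for the topology of pointwise convergence.
\<close>

lemma compact_functions:
  fixes B :: "'a::metric_space set"
  assumes "compact B"
  shows "compact {f :: 'i \<Rightarrow> 'a. \<forall>t. f t \<in> B}"
proof -
  have "compactin (product_topology (\<lambda>_. euclidean) UNIV) (PiE UNIV (\<lambda>_::'i. B))"
    using assms by (simp add: compactin_PiE)
  moreover have "PiE UNIV (\<lambda>_::'i. B) = {f. \<forall>t. f t \<in> B}" by auto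
  ultimately show ?thesis by (simp add: euclidean_product_topology)
qed

text \<open>
  The product topology on functions of a real variable is not first countable, so no
  subsequence is extracted; a cluster point, approached along indices that depend on the two
  arguments considered, is all that is needed below.
\<close>

lemma pointwise_cluster:
  fixes F :: "nat \<Rightarrow> 'i \<Rightarrow> 'a::metric_space"
  assumes "compact B" "\<And>n t. F n t \<in> B"
  obtains f where "\<And>s t \<epsilon> N. 0 < \<epsilon> \<Longrightarrow> \<exists>n\<ge>N. dist (F n s) (f s) < \<epsilon> \<and> dist (F n t) (f t) < \<epsilon>"
proof -
  let ?F = "filtermap F sequentially"
  have "?F \<noteq> bot" by (simp add: filtermap_bot_iff)
  moreover have "eventually (\<lambda>h. h \<in> {f. \<forall>t. f t \<in> B}) ?F"
    using assms(2) by (simp add: eventually_filtermap)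
  ultimately obtain f where f: "inf (nhds f) ?F \<noteq> bot"
    using compact_functions[OF assms(1), where 'i = 'i] unfolding compact_filter by blast
  show thesis
  proof (rule that)
    fix s t :: 'i and \<epsilon> :: real and N assume \<epsilon>: "0 < \<epsilon>"
    have ev: "eventually (\<lambda>h. dist (h i) (f i) < \<epsilon>) (nhds f)" for i
    proof -
      have "open ((\<lambda>h. h i) -` ball (f i) \<epsilon> :: ('i \<Rightarrow> 'a) set)"
        by (rule open_vimage[OF open_ball]) simp
      then show ?thesis unfolding eventually_nhds
        using \<epsilon> by (intro exI[of _ "(\<lambda>h. h i) -` ball (f i) \<epsilon>"]) (auto simp: dist_commute)
    qed
    have "eventually (\<lambda>h. \<exists>n\<ge>N. h = F n) ?F"
      unfolding eventually_filtermap using eventually_ge_at_top[of N] by eventually_elim auto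
    then have "eventually (\<lambda>h. (dist (h s) (f s) < \<epsilon> \<and> dist (h t) (f t) < \<epsilon>) \<and> (\<exists>n\<ge>N. h = F n)) (inf (nhds f) ?F)"
      unfolding eventually_inf using eventually_conj[OF ev[of s] ev[of t]] by blast
    then show "\<exists>n\<ge>N. dist (F n s) (f s) < \<epsilon> \<and> dist (F n t) (f t) < \<epsilon>"
      using eventually_happens'[OF f] by blast
  qed
qed

section \<open>Geodesics of the chain distance\<close>

text \<open>
  Lower semicontinuity of the chain distance, in the form that suits cluster points.
\<close>

lemma chain_dist_le_limit:
  fixes K :: "'a::metric_space \<Rightarrow> real"
  assumes K: "\<And>p. 0 \<le> K p" "continuous_on UNIV K" and A: "0 \<le> A"
    and e: "e \<longlonglongrightarrow> 0" "\<And>n. 0 < e n" and E: "E \<longlonglongrightarrow> 0"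
    and le: "\<And>n. mesh_dist K (e n) (P n) (Q n) \<le> ennreal (A + E n)"
    and cluster: "\<And>\<epsilon> N. 0 < \<epsilon> \<Longrightarrow> \<exists>n\<ge>N. dist (P n) p < \<epsilon> \<and> dist (Q n) q < \<epsilon>"
  shows "chain_dist K p q \<le> ennreal A"
proof (rule chain_dist_leI[of 1])
  fix r :: real assume r: "0 < r"
  show "mesh_dist K r p q \<le> ennreal A"
  proof (rule ennreal_le_epsilon)
    fix \<epsilon> :: real assume \<epsilon>: "0 < \<epsilon>"
    then have \<epsilon>3: "0 < \<epsilon> / 3" by simp
    obtain d1 where d1: "0 < d1" "\<And>y. dist y p < d1 \<Longrightarrow> mesh_dist K r y p \<le> ennreal (\<epsilon> / 3)"
      using mesh_dist_small[OF K r \<epsilon>3] by blast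
    obtain d2 where d2: "0 < d2" "\<And>y. dist y q < d2 \<Longrightarrow> mesh_dist K r y q \<le> ennreal (\<epsilon> / 3)"
      using mesh_dist_small[OF K r \<epsilon>3] by blast
    have "\<forall>\<^sub>F n in sequentially. e n < r \<and> E n < \<epsilon> / 3"
      using order_tendstoD(2)[OF e(1) r] order_tendstoD(2)[OF E \<epsilon>3] by (rule eventually_conj)
    then obtain N where N: "\<And>n. n \<ge> N \<Longrightarrow> e n < r \<and> E n < \<epsilon> / 3"
      unfolding eventually_sequentially by blast
    have "0 < min d1 d2" using d1 d2 by simp
    then obtain n where n: "n \<ge> N" "dist (P n) p < d1" "dist (Q n) q < d2"
      using cluster[of "min d1 d2" N] by auto
    have "mesh_dist K r p q \<le> ennreal (\<epsilon> / 3) + ennreal (A + \<epsilon> / 3) + ennreal (\<epsilon> / 3)"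
    proof (rule mesh_dist_triangle3[OF K(1)])
      show "mesh_dist K r p (P n) \<le> ennreal (\<epsilon> / 3)" using d1(2)[OF n(2)] by (simp add: mesh_dist_commute)
      show "mesh_dist K r (Q n) q \<le> ennreal (\<epsilon> / 3)" by (rule d2(2)[OF n(3)])
      have "mesh_dist K r (P n) (Q n) \<le> mesh_dist K (e n) (P n) (Q n)"
        using N[OF n(1)] by (intro mesh_dist_antimono) simp
      also have "\<dots> \<le> ennreal (A + E n)" by (rule le)
      also have "\<dots> \<le> ennreal (A + \<epsilon> / 3)" using N[OF n(1)] by (intro ennreal_leI) simp
      finally show "mesh_dist K r (P n) (Q n) \<le> ennreal (A + \<epsilon> / 3)" .
    qed
    also have "\<dots> = ennreal A + ennreal \<epsilon>" using \<epsilon> A by (simp flip: ennreal_plus)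
    finally show "mesh_dist K r p q \<le> ennreal A + ennreal \<epsilon>" .
  qed
qed simp

text \<open>
  A finite union of balls is bounded, and properness does the rest.
\<close>

lemma compact_infdist_le:
  fixes S :: "'a::metric_space set"
  assumes proper: "proper_metric TYPE('a)" and S: "finite S" "S \<noteq> {}"
  shows "compact {p. infdist p S \<le> R}"
proof -
  have "closed {p. infdist p S \<le> R}" by (intro closed_Collect_le continuous_intros)
  moreover have "{p. infdist p S \<le> R} \<subseteq> (\<Union>z\<in>S. cball z (R + 1))"
  proof
    fix p assume "p \<in> {p. infdist p S \<le> R}"
    then have "(INF z\<in>S. dist p z) < R + 1" using S(2) by (simp add: infdist_notempty)
    then obtain z where "z \<in> S" "dist p z < R + 1"
      using cINF_less_iff[OF S(2), of "dist p"] by (auto intro: bdd_belowI[of _ 0])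
    then show "p \<in> (\<Union>z\<in>S. cball z (R + 1))" by (auto simp: dist_commute intro!: bexI[of _ z])
  qed
  then have "bounded {p. infdist p S \<le> R}"
    by (rule bounded_subset[rotated]) (use S(1) in auto)
  ultimately show ?thesis using proper unfolding proper_metric_def by blast
qed

locale weighted_space =
  fixes K :: "'a::metric_space \<Rightarrow> real" and k :: "real \<Rightarrow> real"
  assumes proper: "proper_metric TYPE('a)" and length: "length_metric TYPE('a)"
    and K_nonneg: "\<And>p. 0 \<le> K p" and K_cont: "continuous_on UNIV K"
    and finite_zeros: "finite {p. K p = 0}"
    and k_cont: "continuous_on {0..} k" and k_nonneg: "\<And>t. 0 \<le> t \<Longrightarrow> 0 \<le> k t"
    and k_integral: "(\<integral>\<^sup>+t\<in>{0..}. ennreal (k t) \<partial>lebesgue) = \<infinity>"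
    and K_lower: "\<And>p. k (infdist p {p. K p = 0}) \<le> K p"
begin

text \<open>
  The chain distance is finite under the assumptions of the locale; as a real number it is a
  metric.
\<close>

definition cost :: "'a \<Rightarrow> 'a \<Rightarrow> real" where
  "cost x y = enn2real (chain_dist K x y)"

lemma chain_dist_eq: "chain_dist K x y = ennreal (cost x y)"
  using chain_dist_finite[OF proper length K_nonneg K_cont, of x y] unfolding cost_def by simp

lemma cost_nonneg: "0 \<le> cost x y"
  by (simp add: cost_def)

lemma cost_refl [simp]: "cost x x = 0"
  by (simp add: cost_def)

lemma cost_commute: "cost x y = cost y x"
  by (simp add: cost_def chain_dist_commute)

lemma cost_triangle: "cost x z \<le> cost x y + cost y z"
proof -
  have "ennreal (cost x z) \<le> ennreal (cost x y + cost y z)"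
    using chain_dist_triangle[of K x z y] K_nonneg cost_nonneg
    by (simp add: chain_dist_eq ennreal_plus)
  then show ?thesis by (subst (asm) ennreal_le_iff) (auto simp: cost_nonneg)
qed

lemma cost_separates:
  assumes "0 < r"
  obtains \<eta> where "0 < \<eta>" "\<And>v. cost p v < \<eta> \<Longrightarrow> dist p v < r"
proof -
  obtain \<eta> where "0 < \<eta>" "\<And>v. chain_dist K p v < ennreal \<eta> \<Longrightarrow> dist p v < r"
    using chain_dist_separates[OF proper K_nonneg K_cont finite_zeros assms, of p] by blast
  then show thesis by (intro that[of \<eta>]) (auto simp: chain_dist_eq ennreal_less_iff cost_nonneg)
qed

lemma cost_eq_0: "cost x y = 0 \<longleftrightarrow> x = y"
proof
  assume 0: "cost x y = 0"
  have "dist x y \<le> 0 + r" if "0 < r" for r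
    using cost_separates[OF that, of x] 0 by (metis add_0 less_imp_le)
  then have "dist x y \<le> 0" by (rule field_le_epsilon)
  then show "x = y" by simp
qed simp

text \<open>
  Nearly optimal chains of mesh \<open>e n\<close>, parametrised on \<open>[0, 1]\<close> by the fraction of the cost spent,
  take values in one compact set. Their errors \<open>E n\<close> vanish in the limit, and \<open>f\<close> is a pointwise
  cluster point.
\<close>

lemma geodesic_exists:
  assumes x: "K x = 0"
  obtains f where "f 0 = x" "f 1 = y"
    "\<And>s t. 0 \<le> s \<Longrightarrow> s \<le> t \<Longrightarrow> t \<le> 1 \<Longrightarrow> cost (f s) (f t) \<le> cost x y * (t - s)"
proof -
  define S where "S = {p. K p = 0}"
  define C where "C = cost x y"
  have C: "0 \<le> C" unfolding C_def by (rule cost_nonneg)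
  have S: "finite S" "x \<in> S" using finite_zeros x by (auto simp: S_def)
  have C1: "0 \<le> C + 1" and K_lower': "\<And>p. k (infdist p S) \<le> K p" using C K_lower by (simp_all add: S_def)
  obtain e0 R where e0: "0 < e0" "\<And>x p. x \<in> S \<Longrightarrow> mesh_dist K e0 x p \<le> ennreal (C + 1) \<Longrightarrow> infdist p S \<le> R"
    by (rule mesh_dist_confines[of K k S "C + 1", OF K_nonneg k_cont k_nonneg k_integral K_lower' C1], assumption) (rule that)
  define B where "B = {p. infdist p S \<le> R}"
  have B: "compact B" unfolding B_def using S by (intro compact_infdist_le proper) auto
  obtain M where M: "0 < M" "\<And>p. p \<in> B \<Longrightarrow> K p \<le> M"
    using proper_bounded_above[OF proper K_cont compact_imp_bounded[OF B]] by blast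
  define r where "r n = inverse (real (Suc n))" for n
  have r: "0 < r n" "r n \<le> 1" for n by (auto simp: r_def field_simps)
  have r0: "r \<longlonglongrightarrow> 0" unfolding r_def by (rule LIMSEQ_inverse_real_of_nat)
  define e where "e n = min e0 (r n)" for n
  have e: "0 < e n" "e n \<le> e0" "e n \<le> r n" for n using e0 r by (auto simp: e_def)
  have e_lim: "e \<longlonglongrightarrow> 0"
    by (rule tendsto_sandwich[OF _ _ tendsto_const r0]) (use e in \<open>auto simp: less_imp_le\<close>)
  define E where "E n = r n + M * e n" for n
  have E: "E \<longlonglongrightarrow> 0"
    using tendsto_add[OF r0 tendsto_mult_left[OF e_lim, of M]] by (simp add: E_def[abs_def])
  have "\<forall>n. \<exists>F. (\<forall>t. F t \<in> B) \<and>
      (\<forall>s t. 0 \<le> s \<longrightarrow> s \<le> t \<longrightarrow> t \<le> 1 \<longrightarrow> mesh_dist K (e n) (F s) (F t) \<le> ennreal (C * (t - s) + E n)) \<and>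
      (\<forall>s. 0 \<le> s \<longrightarrow> s \<le> 1 \<longrightarrow> mesh_dist K (e n) (F s) y \<le> ennreal (C * (1 - s) + E n) \<and>
         mesh_dist K (e n) x (F s) \<le> ennreal (C * s + E n))" (is "\<forall>n. \<exists>F. ?P n F")
  proof
    fix n
    have "mesh_dist K (e n) x y \<le> chain_dist K x y" by (rule mesh_dist_le_chain_dist[OF e(1)])
    also have "\<dots> < ennreal (C + r n)" using r C by (simp add: chain_dist_eq C_def ennreal_less_iff)
    finally obtain c where c: "chain K (e n) x y c" "c < C + r n" using mesh_dist_chainE by blast
    have c0: "0 \<le> c" using chain_nonneg[OF c(1) K_nonneg] .
    have conf: "p \<in> B \<and> K p \<le> M" if "mesh_dist K (e n) x p \<le> ennreal (C + 1)" for p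
    proof -
      have "mesh_dist K e0 x p \<le> ennreal (C + 1)"
        using mesh_dist_antimono[OF e(2)] that by (rule order.trans)
      then have "p \<in> B" using e0(2) S(2) by (simp add: B_def)
      then show ?thesis using M(2) by simp
    qed
    have "c \<le> C + 1" using c(2) r(2)[of n] by simp
    from chain_parametrization[OF c(1) K_nonneg conf order_refl _ this]
    obtain g where g: "\<forall>s. g s \<in> B"
      "\<forall>s t. 0 \<le> s \<longrightarrow> s \<le> t \<longrightarrow> t \<le> c \<longrightarrow> mesh_dist K (e n) (g s) (g t) \<le> ennreal (t - s + M * e n)"
      "\<forall>s. 0 \<le> s \<longrightarrow> s \<le> c \<longrightarrow> mesh_dist K (e n) (g s) y \<le> ennreal (c - s) \<and>
        mesh_dist K (e n) x (g s) \<le> ennreal (s + M * e n)"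
      using M(1) e(1)[of n] by (auto simp: less_imp_le)
    define F where "F t = g (c * t)" for t
    have scale: "c * t \<le> C * t + r n" if "0 \<le> t" "t \<le> 1" for t
    proof -
      have "c * t \<le> (C + r n) * t" using c(2) that by (intro mult_right_mono) auto
      also have "\<dots> \<le> C * t + r n" using that r[of n] by (simp add: distrib_right mult_left_le)
      finally show ?thesis .
    qed
    have Me: "0 \<le> M * e n" using M(1) e(1)[of n] by simp
    show "\<exists>F. ?P n F"
    proof (intro exI[of _ F] conjI allI impI)
      show "F t \<in> B" for t using g(1) by (simp add: F_def)
      show "mesh_dist K (e n) (F s) (F t) \<le> ennreal (C * (t - s) + E n)"
        if "0 \<le> s" "s \<le> t" "t \<le> 1" for s t
      proof -
        have "mesh_dist K (e n) (F s) (F t) \<le> ennreal (c * t - c * s + M * e n)"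
          unfolding F_def using g(2) that c0 by (simp add: mult_left_mono mult_left_le)
        also have "\<dots> \<le> ennreal (C * (t - s) + E n)"
          using scale[of "t - s"] that by (intro ennreal_leI) (simp add: E_def algebra_simps)
        finally show ?thesis .
      qed
      fix s :: real assume s: "0 \<le> s" "s \<le> 1"
      have cs: "0 \<le> c * s" "c * s \<le> c" using s c0 by (auto simp: mult_left_le)
      have "mesh_dist K (e n) (F s) y \<le> ennreal (c - c * s)" using g(3) cs by (simp add: F_def)
      also have "\<dots> \<le> ennreal (C * (1 - s) + E n)"
        using scale[of "1 - s"] s Me by (intro ennreal_leI) (simp add: E_def algebra_simps)
      finally show "mesh_dist K (e n) (F s) y \<le> ennreal (C * (1 - s) + E n)" .
      have "mesh_dist K (e n) x (F s) \<le> ennreal (c * s + M * e n)" using g(3) cs by (simp add: F_def)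
      also have "\<dots> \<le> ennreal (C * s + E n)"
        using scale[OF s] by (intro ennreal_leI) (simp add: E_def algebra_simps)
      finally show "mesh_dist K (e n) x (F s) \<le> ennreal (C * s + E n)" .
    qed
  qed
  then obtain F where F: "\<And>n t. F n t \<in> B"
    "\<And>n s t. 0 \<le> s \<Longrightarrow> s \<le> t \<Longrightarrow> t \<le> 1 \<Longrightarrow> mesh_dist K (e n) (F n s) (F n t) \<le> ennreal (C * (t - s) + E n)"
    "\<And>n s. 0 \<le> s \<Longrightarrow> s \<le> 1 \<Longrightarrow> mesh_dist K (e n) (F n s) y \<le> ennreal (C * (1 - s) + E n)"
    "\<And>n s. 0 \<le> s \<Longrightarrow> s \<le> 1 \<Longrightarrow> mesh_dist K (e n) x (F n s) \<le> ennreal (C * s + E n)"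
    by metis
  obtain f where f: "\<And>s t \<epsilon> N. 0 < \<epsilon> \<Longrightarrow> \<exists>n\<ge>N. dist (F n s) (f s) < \<epsilon> \<and> dist (F n t) (f t) < \<epsilon>"
    by (rule pointwise_cluster[of B F, OF B F(1)]) (rule that)
  have le: "cost p q \<le> A"
    if "0 \<le> A" "\<And>n. mesh_dist K (e n) (P n) (Q n) \<le> ennreal (A + E n)"
      "\<And>\<epsilon> N. 0 < \<epsilon> \<Longrightarrow> \<exists>n\<ge>N. dist (P n) p < \<epsilon> \<and> dist (Q n) q < \<epsilon>" for P Q p q A
    using chain_dist_le_limit[OF K_nonneg K_cont that(1) e_lim e(1) E that(2,3)] that(1)
    by (simp add: chain_dist_eq ennreal_le_iff)
  show thesis
  proof (rule that)
    have "cost x (f 0) \<le> 0"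
    proof (rule le[of 0 "\<lambda>_. x" "\<lambda>n. F n 0"])
      show "mesh_dist K (e n) x (F n 0) \<le> ennreal (0 + E n)" for n using F(4)[of 0 n] by simp
      show "\<exists>n\<ge>N. dist x x < \<epsilon> \<and> dist (F n 0) (f 0) < \<epsilon>" if "0 < \<epsilon>" for \<epsilon> N
        using f[OF that, of N 0 0] that by auto
    qed simp
    then show "f 0 = x" using cost_nonneg[of x "f 0"] cost_eq_0[of x "f 0"] by simp
    have "cost (f 1) y \<le> 0"
    proof (rule le[of 0 "\<lambda>n. F n 1" "\<lambda>_. y"])
      show "mesh_dist K (e n) (F n 1) y \<le> ennreal (0 + E n)" for n using F(3)[of 1 n] by simp
      show "\<exists>n\<ge>N. dist (F n 1) (f 1) < \<epsilon> \<and> dist y y < \<epsilon>" if "0 < \<epsilon>" for \<epsilon> N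
        using f[OF that, of N 1 1] that by auto
    qed simp
    then show "f 1 = y" using cost_nonneg[of "f 1" y] cost_eq_0[of "f 1" y] by simp
    show "cost (f s) (f t) \<le> cost x y * (t - s)" if "0 \<le> s" "s \<le> t" "t \<le> 1" for s t
      unfolding C_def[symmetric] using that C F(2) f by (intro le[of _ "\<lambda>n. F n s" "\<lambda>n. F n t"]) auto
  qed
qed

definition geodesic :: "'a \<Rightarrow> 'a \<Rightarrow> (real \<Rightarrow> 'a) \<Rightarrow> bool" where
  "geodesic x y f \<longleftrightarrow> f 0 = x \<and> f 1 = y \<and>
    (\<forall>s\<in>{0..1}. \<forall>t\<in>{0..1}. cost (f s) (f t) \<le> cost x y * \<bar>t - s\<bar>)"

lemma ex_geodesic:
  assumes "K x = 0"
  obtains f where "geodesic x y f"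
proof -
  obtain f where f: "f 0 = x" "f 1 = y"
    "\<And>s t. 0 \<le> s \<Longrightarrow> s \<le> t \<Longrightarrow> t \<le> 1 \<Longrightarrow> cost (f s) (f t) \<le> cost x y * (t - s)"
    using geodesic_exists[OF assms] by metis
  have "cost (f s) (f t) \<le> cost x y * \<bar>t - s\<bar>" if "s \<in> {0..1}" "t \<in> {0..1}" for s t
    using f(3)[of s t] f(3)[of t s] that by (cases "s \<le> t") (auto simp: cost_commute)
  then show thesis using f by (intro that[of f]) (auto simp: geodesic_def)
qed

lemma geodesicD:
  assumes "geodesic x y f"
  shows "f 0 = x" "f 1 = y" "\<And>s t. s \<in> {0..1} \<Longrightarrow> t \<in> {0..1} \<Longrightarrow> cost (f s) (f t) \<le> cost x y * \<bar>t - s\<bar>"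
  using assms unfolding geodesic_def by auto

lemma geodesic_continuous:
  assumes f: "geodesic x y f"
  shows "continuous_on {0..1} f"
  unfolding continuous_on_iff
proof (intro ballI allI impI)
  fix t e :: real assume t: "t \<in> {0..1}" and e: "0 < e"
  obtain \<eta> where \<eta>: "0 < \<eta>" "\<And>v. cost (f t) v < \<eta> \<Longrightarrow> dist (f t) v < e" using cost_separates[OF e] by blast
  define d where "d = \<eta> / (cost x y + 1)"
  have C: "0 < cost x y + 1" using cost_nonneg[of x y] by simp
  show "\<exists>d>0. \<forall>s\<in>{0..1}. dist s t < d \<longrightarrow> dist (f s) (f t) < e"
  proof (intro exI[of _ d] conjI ballI impI)
    show "0 < d" using \<eta> C by (simp add: d_def)
    fix s :: real assume s: "s \<in> {0..1}" "dist s t < d"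
    have "cost (f t) (f s) \<le> cost x y * \<bar>s - t\<bar>" by (rule geodesicD(3)[OF f t s(1)])
    also have "\<dots> \<le> (cost x y + 1) * \<bar>s - t\<bar>" by (intro mult_right_mono) auto
    also have "\<dots> < (cost x y + 1) * d" using s C by (intro mult_strict_left_mono) (auto simp: dist_real_def)
    also have "\<dots> = \<eta>" using C by (simp add: d_def)
    finally show "dist (f s) (f t) < e" using \<eta>(2) by (simp add: dist_commute)
  qed
qed

text \<open>
  Returning to a point would allow a shortcut, contradicting that the end points are at full
  cost from each other.
\<close>

lemma geodesic_inj:
  assumes f: "geodesic x y f" and xy: "x \<noteq> y"
  shows "inj_on f {0..1}"
proof -
  have C: "0 < cost x y" using cost_nonneg[of x y] cost_eq_0 xy by (simp add: order_less_le)
  have "f s \<noteq> f t" if "s \<in> {0..1}" "t \<in> {0..1}" "s < t" for s t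
  proof
    assume eq: "f s = f t"
    have "cost x y \<le> cost (f 0) (f s) + cost (f t) (f 1)"
      using cost_triangle[of x y "f s"] eq geodesicD[OF f] by simp
    also have "\<dots> \<le> cost x y * \<bar>s - 0\<bar> + cost x y * \<bar>1 - t\<bar>"
      using that by (intro add_mono geodesicD(3)[OF f]) auto
    also have "\<dots> = cost x y * (1 - (t - s))" using that by (simp add: algebra_simps)
    also have "\<dots> < cost x y * 1" using that C by (intro mult_strict_left_mono) auto
    finally show False by simp
  qed
  then show ?thesis by (intro inj_onI) (metis linorder_neqE)
qed

text \<open>
  Where \<open>K\<close> exceeds \<open>m\<close>, cost controls \<open>m\<close> times distance.
\<close>

lemma geodesic_local_lipschitz:
  assumes f: "geodesic x y f" and t: "t \<in> {0..1}" and m: "0 \<le> m" "m < K (f t)"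
  obtains d where "0 < d" "\<And>s s'. s \<in> {0..1} \<Longrightarrow> s' \<in> {0..1} \<Longrightarrow> \<bar>s - t\<bar> < d \<Longrightarrow> \<bar>s' - t\<bar> < d \<Longrightarrow>
    m * dist (f s) (f s') \<le> cost x y * \<bar>s - s'\<bar>"
proof -
  obtain r where r: "0 < r"
    "\<And>u v. u \<in> ball (f t) r \<Longrightarrow> v \<in> ball (f t) r \<Longrightarrow> ennreal (m * dist u v) \<le> chain_dist K u v"
    using chain_dist_ge_near[OF K_nonneg K_cont m] by blast
  obtain d where d: "0 < d" "\<And>s. s \<in> {0..1} \<Longrightarrow> dist s t < d \<Longrightarrow> dist (f s) (f t) < r"
    using geodesic_continuous[OF f] t r(1) unfolding continuous_on_iff by metis
  show thesis
  proof (rule that[OF d(1)])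
    fix s s' :: real assume s: "s \<in> {0..1}" "s' \<in> {0..1}" "\<bar>s - t\<bar> < d" "\<bar>s' - t\<bar> < d"
    then have "ennreal (m * dist (f s) (f s')) \<le> ennreal (cost (f s) (f s'))"
      using d(2)[of s] d(2)[of s'] r(2)[of "f s" "f s'"] by (simp add: chain_dist_eq dist_real_def dist_commute)
    then have "m * dist (f s) (f s') \<le> cost (f s) (f s')" by (simp add: ennreal_le_iff cost_nonneg)
    also have "\<dots> \<le> cost x y * \<bar>s - s'\<bar>" using geodesicD(3)[OF f s(1,2)] by (simp add: abs_minus_commute)
    finally show "m * dist (f s) (f s') \<le> cost x y * \<bar>s - s'\<bar>" .
  qed
qed

text \<open>
  By injectivity the geodesic meets the finitely many zeros of \<open>K\<close> at finitely many times.
\<close>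

lemma geodesic_lipschitz_off:
  assumes f: "geodesic x y f" and xy: "x \<noteq> y"
  shows "lipschitz_off ({0, 1} \<union> {t\<in>{0..1}. K (f t) = 0}) {0..1} f" (is "lipschitz_off ?T _ _")
  unfolding lipschitz_off_def
proof (intro conjI ballI)
  have "finite (f -` {p. K p = 0} \<inter> {0..1})"
    using geodesic_inj[OF f xy] by (intro finite_vimage_IntI finite_zeros)
  then show "finite ?T" by (auto simp: vimage_def Int_def conj_commute)
  fix t assume t: "t \<in> {0..1} - ?T"
  define m where "m = K (f t) / 2"
  have m: "0 < m" "m < K (f t)" using t K_nonneg[of "f t"] by (auto simp: m_def)
  obtain d where d: "0 < d" "\<And>s s'. s \<in> {0..1} \<Longrightarrow> s' \<in> {0..1} \<Longrightarrow> \<bar>s - t\<bar> < d \<Longrightarrow> \<bar>s' - t\<bar> < d \<Longrightarrow>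
    m * dist (f s) (f s') \<le> cost x y * \<bar>s - s'\<bar>"
    using geodesic_local_lipschitz[OF f, of t m] t m by auto
  define u where "u = min (d / 2) (min t (1 - t))"
  have u: "0 < u" "u < d" "cball t u \<subseteq> {0..1}"
    using t d(1) by (auto simp: u_def dist_real_def)
  have "(cost x y / m)-lipschitz_on (cball t u) f"
  proof (rule lipschitz_onI)
    show "0 \<le> cost x y / m" using cost_nonneg m by simp
    fix s s' assume s: "s \<in> cball t u" "s' \<in> cball t u"
    have "m * dist (f s) (f s') \<le> cost x y * \<bar>s - s'\<bar>"
      using s u by (intro d(2)) (auto simp: dist_real_def)
    then show "dist (f s) (f s') \<le> cost x y / m * dist s s'"
      using m by (simp add: dist_real_def field_simps)
  qed
  then show "\<exists>u>0. cball t u \<subseteq> {0..1} \<and> (\<exists>L. L-lipschitz_on (cball t u) f)" using u by blast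
qed (use geodesic_continuous[OF f] in \<open>auto simp: is_interval_cc\<close>)

lemma geodesic_speed:
  assumes f: "geodesic x y f" and t: "t \<in> {0<..<1}" and lim: "(metric_quotient f t \<longlongrightarrow> l) (at t)"
  shows "K (f t) * l \<le> cost x y"
proof -
  have l: "0 \<le> l"
    by (rule tendsto_lowerbound[OF lim]) (auto simp: metric_quotient_def)
  have "m * l \<le> cost x y" if m: "0 \<le> m" "m < K (f t)" for m
  proof -
    obtain d where d: "0 < d" "\<And>s s'. s \<in> {0..1} \<Longrightarrow> s' \<in> {0..1} \<Longrightarrow> \<bar>s - t\<bar> < d \<Longrightarrow> \<bar>s' - t\<bar> < d \<Longrightarrow>
      m * dist (f s) (f s') \<le> cost x y * \<bar>s - s'\<bar>"
      using geodesic_local_lipschitz[OF f, of t m] t m by auto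
    have "\<forall>\<^sub>F s in at t. s \<in> {0<..<1} \<and> s \<noteq> t \<and> dist s t < d"
      using t d(1) by (intro eventually_conj eventually_at_in_open') (auto simp: eventually_at intro: exI[of _ d] exI[of _ 1])
    then have "\<forall>\<^sub>F s in at t. m * metric_quotient f t s \<le> cost x y"
    proof eventually_elim
      case (elim s)
      then have "m * dist (f t) (f s) \<le> cost x y * \<bar>t - s\<bar>"
        using t d(1) by (intro d(2)) (auto simp: dist_real_def)
      then show ?case using elim by (simp add: metric_quotient_def divide_le_eq)
    qed
    then show ?thesis by (intro tendsto_upperbound[OF tendsto_mult_left[OF lim]]) auto
  qed
  note le = this
  show ?thesis
  proof (cases "K (f t) * l = 0")
    case True then show ?thesis using cost_nonneg[of x y] by linarith
  next
    case False
    then have pos: "0 < K (f t)" "0 < l" using K_nonneg[of "f t"] l by auto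
    have "K (f t) \<le> cost x y / l"
    proof (rule dense_le)
      fix m assume "m < K (f t)"
      then have "max m 0 * l \<le> cost x y" using pos by (intro le) auto
      then have "max m 0 \<le> cost x y / l" using pos by (simp add: le_divide_eq)
      then show "m \<le> cost x y / l" by simp
    qed
    then show ?thesis using pos by (simp add: le_divide_eq)
  qed
qed

text \<open>
  The geodesic is itself an admissible curve, and the integrand of its weighted length is at
  most the cost almost everywhere on an interval of length one. For \<open>x = y\<close> a curve on a
  one-point interval is used.
\<close>

lemma weighted_dist_le_cost:
  assumes x: "K x = 0"
  shows "weighted_dist K x y \<le> ennreal (cost x y)"
proof (cases "x = y")
  case True
  have "ploc_lipschitz_curve {0} (\<lambda>_. x)"
    unfolding ploc_lipschitz_curve_def
    by (intro conjI exI[of _ 0] exI[of _ "\<lambda>_. 0"]) (auto simp: zero_ereal_def is_interval_1)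
  moreover have "joins {0} (\<lambda>_. x) x y"
    unfolding joins_def using True
    by (intro conjI exI[of _ "ereal 0"]) (auto simp: zero_ereal_def)
  ultimately have "weighted_dist K x y \<le> weighted_length K {0} (\<lambda>_. x)"
    unfolding weighted_dist_def by (intro Inf_lower) blast
  also have "\<dots> = 0" unfolding weighted_length_def using x by simp
  finally show ?thesis by simp
next
  case False
  obtain f where f: "geodesic x y f" using ex_geodesic[OF x] .
  note off = geodesic_lipschitz_off[OF f False]
  have "ploc_lipschitz_curve {0..1} f" by (rule lipschitz_off_Icc_imp_ploc[OF off]) simp
  moreover have "joins {0..1} f x y"
    unfolding joins_def using geodesic_continuous[OF f] geodesicD[OF f]
    by (intro conjI exI[of _ "ereal 0"] exI[of _ "ereal 1"]) auto
  ultimately have "weighted_dist K x y \<le> weighted_length K {0..1} f"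
    unfolding weighted_dist_def by (intro Inf_lower) blast
  also have "\<dots> \<le> (\<integral>\<^sup>+t. ennreal (cost x y) * indicator {0..1::real} t \<partial>lebesgue)"
    unfolding weighted_length_def
  proof (rule nn_integral_mono_AE)
    have "AE t in lebesgue. t \<notin> {0, 1::real}"
      by (rule AE_not_in_finite) simp
    then show "AE t in lebesgue. ennreal (K (f t) * metric_derivative {0..1} f t) * indicator {0..1} t
        \<le> ennreal (cost x y) * indicator {0..1} t"
      using lipschitz_off_quotient_limit[OF off]
      by eventually_elim (auto simp: indicator_def intro!: ennreal_leI geodesic_speed[OF f])
  qed
  also have "\<dots> = ennreal (cost x y)" by (simp add: nn_integral_cmult_indicator)
  finally show ?thesis .
qed

lemma weighted_dist_eq_cost:
  assumes "K x = 0"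
  shows "weighted_dist K x y = ennreal (cost x y)"
  using weighted_dist_le_cost[OF assms, of y] chain_dist_le_weighted_dist[of K x y] K_nonneg K_cont
  by (simp add: chain_dist_eq antisym)

end

section \<open>Heteroclinic connections\<close>

text \<open>
  The inequality between arithmetic and geometric mean, applied pointwise to the integrands.
\<close>

lemma weighted_length_le_energy:
  assumes "\<And>p. W p = (K p)\<^sup>2 / 2"
  shows "weighted_length K UNIV \<gamma> \<le> energy W \<gamma>"
  unfolding weighted_length_def energy_def
proof (rule nn_integral_mono)
  fix t :: real
  define m where "m = metric_derivative UNIV \<gamma> t"
  have "0 \<le> (m - K (\<gamma> t))\<^sup>2" by simp
  then have "K (\<gamma> t) * m \<le> m\<^sup>2 / 2 + W (\<gamma> t)"
    by (simp add: assms power2_diff algebra_simps)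
  then show "ennreal (K (\<gamma> t) * metric_derivative UNIV \<gamma> t) * indicator UNIV t
      \<le> ennreal ((metric_derivative UNIV \<gamma> t)\<^sup>2 / 2 + W (\<gamma> t))"
    unfolding m_def by (simp add: ennreal_leI)
qed

text \<open>
  The geodesic is reparametrised by a time \<open>\<phi>\<close> so that its speed becomes \<open>K\<close>, the equality case of
  the inequality above. Since \<open>K\<close> times the speed of \<open>f\<close> is at most \<open>C\<close>, time must run at the rate
  \<open>C / K\<^sup>2\<close>.
\<close>

locale zero_free_geodesic = weighted_space +
  fixes x y :: 'a and f :: "real \<Rightarrow> 'a"
  assumes Kx: "K x = 0" and Ky: "K y = 0" and xy: "x \<noteq> y"
    and f: "geodesic x y f" and pos: "\<And>t. t \<in> {0<..<1} \<Longrightarrow> 0 < K (f t)"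
begin

abbreviation C :: real where "C \<equiv> cost x y"

lemma C_pos: "0 < C"
  using cost_nonneg[of x y] cost_eq_0[of x y] xy by simp

definition dens :: "real \<Rightarrow> real" where "dens t = C / (K (f t))\<^sup>2"

text \<open>
  The primitive of \<open>dens\<close> that vanishes at \<open>1/2\<close>. At most one of the two integrals is over a
  nondegenerate interval; the difference spares a case distinction.
\<close>

definition \<phi> :: "real \<Rightarrow> real" where
  "\<phi> t = integral {1/2..t} dens - integral {t..1/2} dens"

lemma dens_pos: "t \<in> {0<..<1} \<Longrightarrow> 0 < dens t"
  using pos[of t] C_pos by (simp add: dens_def)

lemma dens_cont: "continuous_on {0<..<1} dens"
proof -
  have "continuous_on {0<..<1} f"
    by (rule continuous_on_subset[OF geodesic_continuous[OF f]]) auto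
  then have "continuous_on {0<..<1} (\<lambda>t. K (f t))" by (rule continuous_on_compose2[OF K_cont]) auto
  then show ?thesis unfolding dens_def using pos by (intro continuous_intros) (auto simp: less_imp_neq[symmetric])
qed

lemma \<phi>_deriv:
  assumes t: "t \<in> {0<..<1}"
  shows "(\<phi> has_real_derivative dens t) (at t)"
proof -
  define a b where "a = min t (1/2) / 2" and "b = (max t (1/2) + 1) / 2"
  have ab: "0 < a" "a < t" "a < 1/2" "t < b" "1/2 < b" "b < 1" using t by (auto simp: a_def b_def)
  have cont: "continuous_on {a..b} dens" by (rule continuous_on_subset[OF dens_cont]) (use ab in auto)
  have int: "dens integrable_on {a..u}" if "u \<le> b" for u
    using that by (intro integrable_continuous_interval continuous_on_subset[OF cont]) auto
  have \<phi>_eq: "\<phi> u = integral {a..u} dens - integral {a..1/2} dens" if u: "u \<in> {a<..<b}" for u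
  proof (cases "1/2 \<le> u")
    case True
    have "integral {a..1/2} dens + integral {1/2..u} dens = integral {a..u} dens"
      using True ab u by (intro Henstock_Kurzweil_Integration.integral_combine int) auto
    moreover have "integral {u..1/2} dens = 0"
    proof (cases "u = 1/2")
      case True then show ?thesis unfolding True by simp
    qed (use \<open>1/2 \<le> u\<close> in simp)
    ultimately show ?thesis by (simp add: \<phi>_def)
  next
    case False
    have "integral {a..u} dens + integral {u..1/2} dens = integral {a..1/2} dens"
      using False ab u by (intro Henstock_Kurzweil_Integration.integral_combine int) auto
    then show ?thesis using False by (simp add: \<phi>_def)
  qed
  have "((\<lambda>u. integral {a..u} dens) has_real_derivative dens t) (at t within {a..b})"
    by (rule integral_has_real_derivative[OF cont]) (use ab in auto)
  then have "((\<lambda>u. integral {a..u} dens) has_real_derivative dens t) (at t)"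
    using ab by (simp add: at_within_Icc_at)
  then have "((\<lambda>u. integral {a..u} dens - integral {a..1/2} dens) has_real_derivative dens t) (at t)"
    by (auto intro!: derivative_eq_intros)
  then show ?thesis
    by (rule has_field_derivative_transform_within_open[of _ _ _ "{a<..<b}"]) (use ab \<phi>_eq in auto)
qed

lemma \<phi>_less:
  assumes "0 < s" "s < t" "t < 1"
  shows "\<phi> s < \<phi> t"
proof -
  have "\<exists>z>s. z < t \<and> \<phi> t - \<phi> s = (t - s) * dens z"
    by (rule MVT2[OF assms(2)]) (use assms \<phi>_deriv in auto)
  then obtain z where "s < z" "z < t" "\<phi> t - \<phi> s = (t - s) * dens z" by blast
  moreover have "0 < (t - s) * dens z"
    using assms \<open>s < z\<close> \<open>z < t\<close> dens_pos[of z] by (intro mult_pos_pos) auto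
  ultimately show ?thesis by simp
qed

text \<open>
  The inverse of \<open>\<phi>\<close>, extended to the whole line with values \<open>0\<close> below and \<open>1\<close> above the range of \<open>\<phi>\<close>.
  The supremum makes this uniform, whether or not the range is bounded.
\<close>

definition \<psi> :: "real \<Rightarrow> real" where
  "\<psi> s = Sup ({0} \<union> {t\<in>{0<..<1}. \<phi> t \<le> s})"

lemma \<psi>_bdd: "bdd_above ({0} \<union> {t\<in>{0<..<1}. \<phi> t \<le> s})"
  by (auto simp: bdd_above_def intro!: exI[of _ 1])

lemma \<psi>_range: "\<psi> s \<in> {0..1}"
proof -
  have "0 \<le> \<psi> s" unfolding \<psi>_def by (rule cSup_upper[OF _ \<psi>_bdd]) simp
  moreover have "\<psi> s \<le> 1" unfolding \<psi>_def by (rule cSup_least) auto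
  ultimately show ?thesis by simp
qed

lemma \<psi>_lessD:
  assumes "t \<in> {0<..<1}" "\<psi> s < t"
  shows "s < \<phi> t"
proof (rule ccontr)
  assume "\<not> s < \<phi> t"
  then have "t \<le> \<psi> s" unfolding \<psi>_def using assms(1) by (intro cSup_upper[OF _ \<psi>_bdd]) auto
  then show False using assms(2) by simp
qed

lemma less_\<psi>D:
  assumes "t \<in> {0<..<1}" "t < \<psi> s"
  shows "\<phi> t < s"
proof -
  obtain t' where "t' \<in> {0} \<union> {t\<in>{0<..<1}. \<phi> t \<le> s}" "t < t'"
    using assms(2) less_cSup_iff[OF _ \<psi>_bdd, of s t] unfolding \<psi>_def by auto
  then show ?thesis using assms(1) \<phi>_less[of t t'] by auto
qed

lemma \<psi>_mono: "s \<le> s' \<Longrightarrow> \<psi> s \<le> \<psi> s'"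
proof (rule ccontr)
  assume s: "s \<le> s'" and "\<not> \<psi> s \<le> \<psi> s'"
  then obtain t where t: "\<psi> s' < t" "t < \<psi> s" using dense by (metis not_le)
  then have "t \<in> {0<..<1}" using \<psi>_range[of s] \<psi>_range[of s'] by auto
  then show False using \<psi>_lessD[of t s'] less_\<psi>D[of t s] t s by simp
qed

lemma \<psi>_\<phi>: "t \<in> {0<..<1} \<Longrightarrow> \<psi> (\<phi> t) = t"
  using \<psi>_lessD[of t "\<phi> t"] less_\<psi>D[of t "\<phi> t"] by (meson less_irrefl linorder_neqE)

lemma \<phi>_\<psi>:
  assumes s: "\<psi> s \<in> {0<..<1}"
  shows "\<phi> (\<psi> s) = s"
proof -
  define a b where "a = \<psi> s / 2" and "b = (\<psi> s + 1) / 2"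
  have ab: "a \<in> {0<..<1}" "b \<in> {0<..<1}" "a < \<psi> s" "\<psi> s < b" using s by (auto simp: a_def b_def)
  have "\<exists>t\<ge>a. t \<le> b \<and> \<phi> t = s"
  proof (rule IVT)
    show "\<phi> a \<le> s" "s \<le> \<phi> b" using less_\<psi>D[of a s] \<psi>_lessD[of b s] ab by auto
    show "\<forall>t. a \<le> t \<and> t \<le> b \<longrightarrow> isCont \<phi> t" using ab by (auto intro: DERIV_isCont[OF \<phi>_deriv])
  qed (use ab in simp)
  then obtain t where "a \<le> t" "t \<le> b" "\<phi> t = s" by blast
  then show ?thesis using \<psi>_\<phi>[of t] ab by auto
qed

lemma \<psi>_between:
  assumes "t \<in> {0<..<1}"
  shows "\<phi> t < s \<Longrightarrow> t \<le> \<psi> s" "s < \<phi> t \<Longrightarrow> \<psi> s \<le> t"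
  using \<psi>_lessD[OF assms, of s] less_\<psi>D[OF assms, of s] by force+

text \<open>
  An open window around \<open>s\<close> in which \<open>\<psi>\<close> stays inside \<open>(0, 1)\<close> and between \<open>a\<close> and \<open>b\<close>; it yields
  continuity of \<open>\<psi>\<close> and the domain for the inverse function rule.
\<close>

lemma \<psi>_window:
  assumes s: "\<psi> s \<in> {0<..<1}" and ab: "a < \<psi> s" "\<psi> s < b"
  obtains a' b' where "a' < s" "s < b'" "\<And>r. a' < r \<Longrightarrow> r < b' \<Longrightarrow> \<psi> r \<in> {0<..<1} \<and> a < \<psi> r \<and> \<psi> r < b"
proof -
  obtain t1 where t1: "max a 0 < t1" "t1 < \<psi> s" using dense[of "max a 0" "\<psi> s"] s ab by auto
  obtain t2 where t2: "\<psi> s < t2" "t2 < min b 1" using dense[of "\<psi> s" "min b 1"] s ab by auto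
  have in01: "t1 \<in> {0<..<1}" "t2 \<in> {0<..<1}" using t1 t2 s by auto
  show thesis
  proof (rule that[of "\<phi> t1" "\<phi> t2"])
    show "\<phi> t1 < s" by (rule less_\<psi>D[OF in01(1) t1(2)])
    show "s < \<phi> t2" by (rule \<psi>_lessD[OF in01(2) t2(1)])
    fix r assume "\<phi> t1 < r" "r < \<phi> t2"
    then have "t1 \<le> \<psi> r" "\<psi> r \<le> t2" using \<psi>_between[OF in01(1)] \<psi>_between[OF in01(2)] by auto
    then show "\<psi> r \<in> {0<..<1} \<and> a < \<psi> r \<and> \<psi> r < b" using t1 t2 in01 by auto
  qed
qed

lemma \<psi>_isCont:
  assumes s: "\<psi> s \<in> {0<..<1}"
  shows "isCont \<psi> s"
  unfolding isCont_def
proof (rule tendstoI)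
  fix e :: real assume "0 < e"
  then obtain a b where ab: "a < s" "s < b" "\<And>r. a < r \<Longrightarrow> r < b \<Longrightarrow>
      \<psi> r \<in> {0<..<1} \<and> \<psi> s - e < \<psi> r \<and> \<psi> r < \<psi> s + e"
    using \<psi>_window[OF s, of "\<psi> s - e" "\<psi> s + e"] by auto
  have "\<forall>\<^sub>F r in at s. r \<in> {a<..<b}" using ab by (intro eventually_at_in_open') auto
  then show "\<forall>\<^sub>F r in at s. dist (\<psi> r) (\<psi> s) < e"
    by eventually_elim (use ab(3) in \<open>force simp: dist_real_def\<close>)
qed

lemma \<psi>_deriv:
  assumes s: "\<psi> s \<in> {0<..<1}"
  shows "((\<lambda>s. C * \<psi> s) has_real_derivative (K (f (\<psi> s)))\<^sup>2) (at s)"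
proof -
  obtain a b where ab: "a < s" "s < b" "\<And>r. a < r \<Longrightarrow> r < b \<Longrightarrow> \<psi> r \<in> {0<..<1}"
    using \<psi>_window[OF s, of 0 1] s by (metis greaterThanLessThan_iff)
  have "(\<psi> has_real_derivative inverse (dens (\<psi> s))) (at s)"
    by (rule DERIV_inverse_function[OF \<phi>_deriv[OF s] _ ab(1,2) \<phi>_\<psi>[OF ab(3)] \<psi>_isCont[OF s]])
      (use dens_pos[OF s] in auto)
  then have "((\<lambda>s. C * \<psi> s) has_real_derivative C * inverse (dens (\<psi> s))) (at s)"
    by (rule DERIV_cmult)
  also have "C * inverse (dens (\<psi> s)) = (K (f (\<psi> s)))\<^sup>2"
    using C_pos by (simp add: dens_def)
  finally show ?thesis .
qed

text \<open>
  Near \<open>t\<close> the metric speed of \<open>f\<close> is at most \<open>C / m\<close> for any \<open>m\<close> below \<open>K (f t)\<close>, and \<open>\<phi>\<close> has slope close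
  to \<open>C / (K (f t))\<^sup>2\<close>. The quotient of the two is below \<open>\<kappa>\<close> if \<open>m\<close> is close enough to \<open>K (f t)\<close>.
\<close>

lemma speed_bound:
  assumes t: "t \<in> {0<..<1}" and \<kappa>: "K (f t) < \<kappa>"
  obtains d where "0 < d" "\<And>u. u \<in> {0<..<1} \<Longrightarrow> \<bar>u - t\<bar> < d \<Longrightarrow> dist (f u) (f t) \<le> \<kappa> * \<bar>\<phi> u - \<phi> t\<bar>"
proof -
  define \<alpha> where "\<alpha> = K (f t)"
  have \<alpha>: "0 < \<alpha>" "\<alpha> < \<kappa>" using pos[OF t] \<kappa> by (auto simp: \<alpha>_def)
  then have "\<alpha>\<^sup>2 / \<kappa> < \<alpha>" by (simp add: divide_less_eq power2_eq_square)
  (* the lower bound on \<open>m\<close> is equivalent to \<open>(C / m) / (C / \<alpha>\<^sup>2) < \<kappa>\<close> *)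
  then obtain m where m: "\<alpha>\<^sup>2 / \<kappa> < m" "m < \<alpha>" using dense by blast
  have m0: "0 < m" using m(1) \<alpha> by (intro le_less_trans[OF _ m(1)]) auto
  obtain d1 where d1: "0 < d1" "\<And>s s'. s \<in> {0..1} \<Longrightarrow> s' \<in> {0..1} \<Longrightarrow> \<bar>s - t\<bar> < d1 \<Longrightarrow> \<bar>s' - t\<bar> < d1 \<Longrightarrow>
    m * dist (f s) (f s') \<le> C * \<bar>s - s'\<bar>"
    using geodesic_local_lipschitz[OF f, of t m] t m m0 by (auto simp: \<alpha>_def)
  have "((\<lambda>u. \<bar>(\<phi> u - \<phi> t) / (u - t)\<bar>) \<longlongrightarrow> \<bar>dens t\<bar>) (at t)"
    using \<phi>_deriv[OF t] by (intro tendsto_rabs) (simp add: has_field_derivative_iff)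
  moreover have "C / (m * \<kappa>) < \<bar>dens t\<bar>"
  proof -
    have "\<alpha>\<^sup>2 < m * \<kappa>" using m(1) \<alpha> by (simp add: divide_less_eq)
    then show ?thesis using C_pos \<alpha> dens_pos[OF t] unfolding dens_def \<alpha>_def[symmetric]
      by (auto intro!: divide_strict_left_mono mult_pos_pos simp: m0)
  qed
  ultimately have "\<forall>\<^sub>F u in at t. C / (m * \<kappa>) < \<bar>(\<phi> u - \<phi> t) / (u - t)\<bar>" by (rule order_tendstoD(1))
  then obtain d2 where d2: "0 < d2" "\<And>u. u \<noteq> t \<Longrightarrow> dist u t < d2 \<Longrightarrow> C / (m * \<kappa>) < \<bar>(\<phi> u - \<phi> t) / (u - t)\<bar>"
    unfolding eventually_at by auto
  show thesis
  proof (rule that[of "min d1 d2"])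
    show "0 < min d1 d2" using d1 d2 by simp
    fix u assume u: "u \<in> {0<..<1}" "\<bar>u - t\<bar> < min d1 d2"
    show "dist (f u) (f t) \<le> \<kappa> * \<bar>\<phi> u - \<phi> t\<bar>"
    proof (cases "u = t")
      case False
      have "m * dist (f u) (f t) \<le> C * \<bar>u - t\<bar>" using u t d1 by (intro d1(2)) auto
      then have "dist (f u) (f t) \<le> C / m * \<bar>u - t\<bar>" using m0 by (simp add: field_simps)
      also have "\<dots> = \<kappa> * (C / (m * \<kappa>) * \<bar>u - t\<bar>)" using \<alpha> by simp
      also have "\<dots> \<le> \<kappa> * \<bar>\<phi> u - \<phi> t\<bar>"
      proof (rule mult_left_mono)
        have "C / (m * \<kappa>) < \<bar>\<phi> u - \<phi> t\<bar> / \<bar>u - t\<bar>"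
          using d2(2)[of u] False u by (simp add: dist_real_def abs_divide)
        then show "C / (m * \<kappa>) * \<bar>u - t\<bar> \<le> \<bar>\<phi> u - \<phi> t\<bar>" using False by (simp add: less_divide_eq)
      qed (use \<alpha> in simp)
      finally show ?thesis .
    qed simp
  qed
qed

text \<open>
  The local bound is additive along the curve, so bisection makes it global.
\<close>

lemma f_dist_le:
  assumes \<kappa>: "\<And>t. t \<in> {0<..<1} \<Longrightarrow> K (f t) < \<kappa>" and tt: "0 < t" "t \<le> t'" "t' < 1"
  shows "dist (f t) (f t') \<le> \<kappa> * (\<phi> t' - \<phi> t)"
proof -
  have mono: "\<phi> a \<le> \<phi> b" if "0 < a" "a \<le> b" "b < 1" for a b
    using \<phi>_less[of a b] that by (cases "a = b") auto
  have "t \<le> t \<longrightarrow> t' \<le> t' \<longrightarrow> dist (f t) (f t') \<le> \<kappa> * (\<phi> t' - \<phi> t)"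
    using tt(2)
  proof (induction rule: Bolzano[where P = "\<lambda>a b. t \<le> a \<longrightarrow> b \<le> t' \<longrightarrow> dist (f a) (f b) \<le> \<kappa> * (\<phi> b - \<phi> a)"])
    case (trans a b c)
    then show ?case using dist_triangle[of "f a" "f c" "f b"] by (auto simp: algebra_simps)
  next
    case (local z)
    then have z: "z \<in> {0<..<1}" using tt by auto
    obtain d where d: "0 < d" "\<And>u. u \<in> {0<..<1} \<Longrightarrow> \<bar>u - z\<bar> < d \<Longrightarrow> dist (f u) (f z) \<le> \<kappa> * \<bar>\<phi> u - \<phi> z\<bar>"
      using speed_bound[OF z \<kappa>[OF z]] by blast
    show ?case
    proof (intro exI conjI allI impI)
      show "0 < d" by (rule d(1))
      fix a b assume ab: "a \<le> z \<and> z \<le> b \<and> b - a < d" "t \<le> a" "b \<le> t'"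
      have "dist (f a) (f z) \<le> \<kappa> * \<bar>\<phi> a - \<phi> z\<bar>" "dist (f b) (f z) \<le> \<kappa> * \<bar>\<phi> b - \<phi> z\<bar>"
        using ab tt by (auto intro!: d(2))
      moreover have "\<phi> a \<le> \<phi> z" "\<phi> z \<le> \<phi> b" using ab tt by (auto intro!: mono)
      ultimately show "dist (f a) (f b) \<le> \<kappa> * (\<phi> b - \<phi> a)"
        using dist_triangle2[of "f a" "f b" "f z"] by (simp add: algebra_simps)
    qed
  qed
  then show ?thesis by simp
qed

definition \<sigma> :: "real \<Rightarrow> 'a" where "\<sigma> s = f (\<psi> s)"

text \<open>
  Two times \<open>s < s'\<close> are compared through parameters strictly between \<open>\<psi> s\<close> and \<open>\<psi> s'\<close>, where \<open>\<phi>\<close> is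
  defined and takes values between \<open>s\<close> and \<open>s'\<close>. This also covers times outside the range of \<open>\<phi>\<close>.
\<close>

lemma \<sigma>_lipschitz: "lipschitz_curve UNIV \<sigma>"
proof -
  have cont: "continuous_on {0..1} f" by (rule geodesic_continuous[OF f])
  obtain M where M: "0 < M" "\<And>p. p \<in> f ` {0..1} \<Longrightarrow> K p \<le> M"
    using proper_bounded_above[OF proper K_cont compact_imp_bounded[OF compact_continuous_image[OF cont]]] by auto
  define \<kappa> where "\<kappa> = M + 1"
  have \<kappa>: "K (f t) < \<kappa>" if "t \<in> {0<..<1}" for t using M(2)[of "f t"] that by (auto simp: \<kappa>_def)
  have le: "dist (\<sigma> s) (\<sigma> s') \<le> \<kappa> * (s' - s)" if ss: "s \<le> s'" for s s'
  proof (cases "\<psi> s = \<psi> s'")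
    case True then show ?thesis using ss M(1) by (simp add: \<sigma>_def \<kappa>_def)
  next
    case False
    define p q where "p = \<psi> s" and "q = \<psi> s'"
    have pq: "0 \<le> p" "p < q" "q \<le> 1"
      using \<psi>_range[of s] \<psi>_range[of s'] \<psi>_mono[OF ss] False by (auto simp: p_def q_def)
    (* with a margin of at most a third on each side, \<open>p + h n < q - h n\<close> *)
    define h where "h n = (q - p) * inverse (real (Suc n)) / 3" for n
    have h: "0 < h n" "h n \<le> (q - p) / 3" for n using pq by (auto simp: h_def mult_left_le inverse_le_1_iff)
    have "h \<longlonglongrightarrow> (q - p) * 0 / 3" unfolding h_def by (intro tendsto_intros LIMSEQ_inverse_real_of_nat) auto
    then have h0: "h \<longlonglongrightarrow> 0" by simp
    have "(\<lambda>n. p + h n) \<longlonglongrightarrow> p + 0" "(\<lambda>n. q - h n) \<longlonglongrightarrow> q - 0" by (intro tendsto_intros h0)+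
    then have lim: "(\<lambda>n. p + h n) \<longlonglongrightarrow> p" "(\<lambda>n. q - h n) \<longlonglongrightarrow> q" by simp_all
    have in01: "p + h n \<in> {0<..<1}" "q - h n \<in> {0<..<1}" "p + h n \<le> q - h n" for n
      using h[of n] pq by auto
    have "(\<lambda>n. dist (f (p + h n)) (f (q - h n))) \<longlonglongrightarrow> dist (f p) (f q)"
      using pq in01 by (intro tendsto_dist continuous_on_tendsto_compose[OF cont] lim always_eventually) (auto simp: less_imp_le)
    moreover have "dist (f (p + h n)) (f (q - h n)) \<le> \<kappa> * (s' - s)" for n
    proof -
      have "dist (f (p + h n)) (f (q - h n)) \<le> \<kappa> * (\<phi> (q - h n) - \<phi> (p + h n))"
        using in01[of n] by (intro f_dist_le \<kappa>) auto
      also have "\<dots> \<le> \<kappa> * (s' - s)"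
      proof (rule mult_left_mono)
        have "s < \<phi> (p + h n)" using h[of n] by (intro \<psi>_lessD in01) (simp add: p_def)
        moreover have "\<phi> (q - h n) < s'" using h[of n] by (intro less_\<psi>D in01) (simp add: q_def)
        ultimately show "\<phi> (q - h n) - \<phi> (p + h n) \<le> s' - s" by simp
      qed (use M in \<open>simp add: \<kappa>_def\<close>)
      finally show ?thesis .
    qed
    ultimately show ?thesis unfolding \<sigma>_def p_def[symmetric] q_def[symmetric]
      by (intro tendsto_upperbound[of "\<lambda>n. dist (f (p + h n)) (f (q - h n))" _ sequentially]) auto
  qed
  have "\<kappa>-lipschitz_on UNIV \<sigma>"
  proof (rule lipschitz_onI)
    show "0 \<le> \<kappa>" using M by (simp add: \<kappa>_def)
    fix s s' show "dist (\<sigma> s) (\<sigma> s') \<le> \<kappa> * dist s s'"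
      using le[of s s'] le[of s' s] by (cases "s \<le> s'") (auto simp: dist_real_def dist_commute)
  qed
  then show ?thesis unfolding lipschitz_curve_def by blast
qed

lemma \<sigma>_at_bot: "(\<sigma> \<longlongrightarrow> x) at_bot"
proof (rule tendstoI)
  fix e :: real assume "0 < e"
  then obtain d where d: "0 < d" "\<And>t. t \<in> {0..1} \<Longrightarrow> dist t 0 < d \<Longrightarrow> dist (f t) (f 0) < e"
    using geodesic_continuous[OF f] unfolding continuous_on_iff by (metis atLeastAtMost_iff order_refl zero_le_one)
  define t0 where "t0 = min d 1 / 2"
  have t0: "t0 \<in> {0<..<1}" "t0 < d" using d by (auto simp: t0_def)
  have "dist (\<sigma> s) x < e" if "s < \<phi> t0" for s
  proof -
    have "\<psi> s \<le> t0" by (rule \<psi>_between(2)[OF t0(1) that])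
    then show ?thesis using d(2)[OF \<psi>_range[of s]] \<psi>_range[of s] t0 geodesicD(1)[OF f] by (auto simp: \<sigma>_def dist_real_def)
  qed
  then show "\<forall>\<^sub>F s in at_bot. dist (\<sigma> s) x < e" unfolding eventually_at_bot_dense by blast
qed

lemma \<sigma>_at_top: "(\<sigma> \<longlongrightarrow> y) at_top"
proof (rule tendstoI)
  fix e :: real assume "0 < e"
  then obtain d where d: "0 < d" "\<And>t. t \<in> {0..1} \<Longrightarrow> dist t 1 < d \<Longrightarrow> dist (f t) (f 1) < e"
    using geodesic_continuous[OF f] unfolding continuous_on_iff by (metis atLeastAtMost_iff order_refl zero_le_one)
  define t0 where "t0 = 1 - min d 1 / 2"
  have t0: "t0 \<in> {0<..<1}" "1 - d < t0" using d by (auto simp: t0_def)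
  have "dist (\<sigma> s) y < e" if "\<phi> t0 < s" for s
  proof -
    have "t0 \<le> \<psi> s" by (rule \<psi>_between(1)[OF t0(1) that])
    then show ?thesis using d(2)[OF \<psi>_range[of s]] \<psi>_range[of s] t0 geodesicD(2)[OF f] by (auto simp: \<sigma>_def dist_real_def)
  qed
  then show "\<forall>\<^sub>F s in at_top. dist (\<sigma> s) y < e" unfolding eventually_at_top_dense by blast
qed

lemma K_\<sigma>_zero: "\<psi> s \<notin> {0<..<1} \<Longrightarrow> K (\<sigma> s) = 0"
  using \<psi>_range[of s] geodesicD[OF f] Kx Ky by (cases "\<psi> s = 0"; cases "\<psi> s = 1") (auto simp: \<sigma>_def)

text \<open>
  At times where \<open>\<sigma>\<close> has come to rest in a well, one of the two one-sided difference quotients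
  vanishes identically, so an existing limit is zero.
\<close>

lemma \<sigma>_speed:
  assumes lim: "(metric_quotient \<sigma> s \<longlongrightarrow> l) (at s)"
  shows "0 \<le> l" "l \<le> K (\<sigma> s)"
proof -
  show l0: "0 \<le> l" by (rule tendsto_lowerbound[OF lim]) (auto simp: metric_quotient_def)
  show "l \<le> K (\<sigma> s)"
  proof (cases "\<psi> s \<in> {0<..<1}")
    case True
    show ?thesis
    proof (rule dense_ge)
      fix \<kappa> assume \<kappa>: "K (\<sigma> s) < \<kappa>"
      obtain d where d: "0 < d" "\<And>u. u \<in> {0<..<1} \<Longrightarrow> \<bar>u - \<psi> s\<bar> < d \<Longrightarrow>
          dist (f u) (f (\<psi> s)) \<le> \<kappa> * \<bar>\<phi> u - \<phi> (\<psi> s)\<bar>"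
        using speed_bound[OF True, of \<kappa>] \<kappa> unfolding \<sigma>_def by blast
      obtain a b where ab: "a < s" "s < b"
        "\<And>r. a < r \<Longrightarrow> r < b \<Longrightarrow> \<psi> r \<in> {0<..<1} \<and> \<psi> s - d < \<psi> r \<and> \<psi> r < \<psi> s + d"
        using \<psi>_window[OF True, of "\<psi> s - d" "\<psi> s + d"] d(1) by auto
      have "\<forall>\<^sub>F r in at s. r \<in> {a<..<b}" using ab by (intro eventually_at_in_open') auto
      then have "\<forall>\<^sub>F r in at s. metric_quotient \<sigma> s r \<le> \<kappa>"
      proof eventually_elim
        case (elim r)
        then have r: "\<psi> r \<in> {0<..<1}" "\<bar>\<psi> r - \<psi> s\<bar> < d" using ab(3)[of r] by auto
        have "dist (\<sigma> r) (\<sigma> s) \<le> \<kappa> * \<bar>r - s\<bar>"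
          using d(2)[OF r] unfolding \<sigma>_def \<phi>_\<psi>[OF r(1)] \<phi>_\<psi>[OF True] .
        then show ?case
          using K_nonneg[of "\<sigma> s"] \<kappa> by (simp add: metric_quotient_def divide_le_eq dist_commute abs_minus_commute)
      qed
      then show "l \<le> \<kappa>" by (intro tendsto_upperbound[OF lim]) auto
    qed
  next
    case False
    then consider "\<psi> s = 0" | "\<psi> s = 1" using \<psi>_range[of s] by fastforce
    then obtain F where F: "F \<noteq> bot" "F \<le> at s" "\<forall>\<^sub>F r in F. \<psi> r = \<psi> s"
    proof cases
      case 1
      have "\<psi> r = \<psi> s" if "r < s" for r using \<psi>_mono[of r s] \<psi>_range[of r] that 1 by auto
      then show thesis by (intro that[of "at_left s"]) (auto simp: eventually_at_filter at_le)
    next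
      case 2
      have "\<psi> r = \<psi> s" if "s < r" for r using \<psi>_mono[of s r] \<psi>_range[of r] that 2 by auto
      then show thesis by (intro that[of "at_right s"]) (auto simp: eventually_at_filter at_le)
    qed
    from F(3) have "\<forall>\<^sub>F r in F. metric_quotient \<sigma> s r = 0"
      by eventually_elim (simp add: metric_quotient_def \<sigma>_def)
    then have "(metric_quotient \<sigma> s \<longlongrightarrow> 0) F" by (rule tendsto_eventually)
    then have "l = 0" using tendsto_unique[OF F(1) tendsto_mono[OF F(2) lim]] by blast
    then show ?thesis by (simp add: K_nonneg)
  qed
qed

lemma \<sigma>_continuous: "continuous_on UNIV \<sigma>"
  using \<sigma>_lipschitz lipschitz_on_continuous_on unfolding lipschitz_curve_def by blast

text \<open>
  By the chain rule \<open>K\<^sup>2\<close> along \<open>\<sigma>\<close> is the derivative of \<open>C * \<psi>\<close> within the range of \<open>\<phi>\<close>, and it is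
  zero elsewhere. The range is exhausted by the compact intervals \<open>A n\<close>, on each of which \<open>\<psi>\<close>
  increases by less than one.
\<close>

lemma integral_K_\<sigma>_squared: "(\<integral>\<^sup>+s. ennreal ((K (\<sigma> s))\<^sup>2) \<partial>lebesgue) \<le> ennreal C"
proof -
  define \<tau> where "\<tau> n = inverse (real (Suc n)) / 2" for n
  have \<tau>: "0 < \<tau> n" "\<tau> n \<le> 1/2" for n by (auto simp: \<tau>_def field_simps)
  have \<tau>_dec: "\<tau> n \<le> \<tau> m" if "m \<le> n" for m n using that by (simp add: \<tau>_def le_imp_inverse_le)
  define A where "A n = {\<phi> (\<tau> n)..\<phi> (1 - \<tau> n)}" for n
  have \<phi>_mono: "\<phi> a \<le> \<phi> b" if "0 < a" "a \<le> b" "b < 1" for a b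
    using \<phi>_less[of a b] that by (cases "a = b") auto
  have "continuous_on UNIV (\<lambda>s. (K (\<sigma> s))\<^sup>2)"
    by (intro continuous_intros continuous_on_compose2[OF K_cont \<sigma>_continuous]) auto
  then have "(\<lambda>s. (K (\<sigma> s))\<^sup>2) \<in> borel_measurable borel" by (rule borel_measurable_continuous_onI)
  then have "(\<lambda>s. (K (\<sigma> s))\<^sup>2) \<in> borel_measurable lebesgue" by (simp add: measurable_completion)
  then have meas: "(\<lambda>s. ennreal ((K (\<sigma> s))\<^sup>2) * indicator (A n) s) \<in> borel_measurable lebesgue" for n
    by (intro borel_measurable_times_ennreal measurable_compose[OF _ measurable_ennreal] borel_measurable_indicator)
      (auto simp: A_def)
  have le: "(\<integral>\<^sup>+s\<in>A n. ennreal ((K (\<sigma> s))\<^sup>2) \<partial>lebesgue) \<le> ennreal C" for n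
  proof -
    define a b where "a = \<phi> (\<tau> n)" and "b = \<phi> (1 - \<tau> n)"
    have ab: "a \<le> b" unfolding a_def b_def using \<tau>[of n] by (intro \<phi>_mono) auto
    have \<psi>ab: "\<psi> a = \<tau> n" "\<psi> b = 1 - \<tau> n" unfolding a_def b_def using \<tau>[of n] by (auto intro!: \<psi>_\<phi>)
    have "((\<lambda>s. (K (\<sigma> s))\<^sup>2) has_integral (C * \<psi> b - C * \<psi> a)) {a..b}"
    proof (rule fundamental_theorem_of_calculus[OF ab])
      fix s assume "s \<in> {a..b}"
      then have "\<psi> s \<in> {0<..<1}" using \<psi>_mono[of a s] \<psi>_mono[of s b] \<psi>ab \<tau>[of n] by auto
      then show "((\<lambda>s. C * \<psi> s) has_vector_derivative (K (\<sigma> s))\<^sup>2) (at s within {a..b})"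
        using \<psi>_deriv unfolding \<sigma>_def has_real_derivative_iff_has_vector_derivative
        by (blast intro: has_vector_derivative_at_within)
    qed
    then have "(\<integral>\<^sup>+s\<in>A n. ennreal ((K (\<sigma> s))\<^sup>2) \<partial>lebesgue) = ennreal (C * \<psi> b - C * \<psi> a)"
      unfolding A_def a_def[symmetric] b_def[symmetric] by (rule nn_integral_has_integral_on) simp
    also have "\<dots> \<le> ennreal C"
    proof (rule ennreal_leI)
      have "C * (\<psi> b - \<psi> a) \<le> C * 1" using \<tau>[of n] C_pos by (intro mult_left_mono) (auto simp: \<psi>ab)
      then show "C * \<psi> b - C * \<psi> a \<le> C" by (simp add: right_diff_distrib)
    qed
    finally show ?thesis .
  qed
  have inc: "incseq A"
  proof (rule incseq_SucI)
    fix n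
    have "\<phi> (\<tau> (Suc n)) \<le> \<phi> (\<tau> n)" "\<phi> (1 - \<tau> n) \<le> \<phi> (1 - \<tau> (Suc n))"
      using \<tau>_dec[of n "Suc n"] \<tau>[of n] \<tau>[of "Suc n"] by (auto intro!: \<phi>_mono)
    then show "A n \<subseteq> A (Suc n)" by (auto simp: A_def)
  qed
  have cover: "s \<in> (\<Union>n. A n)" if s: "\<psi> s \<in> {0<..<1}" for s
  proof -
    define \<mu> where "\<mu> = min (\<psi> s) (1 - \<psi> s)"
    have \<mu>: "0 < \<mu>" using s by (simp add: \<mu>_def)
    then obtain n where "inverse (real (Suc n)) < \<mu>" using reals_Archimedean by blast
    moreover have "\<tau> n < inverse (real (Suc n))" by (simp add: \<tau>_def)
    ultimately have n: "\<tau> n < \<psi> s" "\<psi> s < 1 - \<tau> n" by (auto simp: \<mu>_def)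
    have "s \<in> A n"
      using less_\<psi>D[OF _ n(1)] \<psi>_lessD[OF _ n(2)] \<tau>[of n] unfolding A_def by (auto intro: less_imp_le)
    then show ?thesis by blast
  qed
  have "(\<integral>\<^sup>+s. ennreal ((K (\<sigma> s))\<^sup>2) \<partial>lebesgue) = (\<integral>\<^sup>+s\<in>(\<Union>n. A n). ennreal ((K (\<sigma> s))\<^sup>2) \<partial>lebesgue)"
    using cover K_\<sigma>_zero by (intro nn_integral_cong) (fastforce simp: indicator_def)
  also have "\<dots> \<le> ennreal C" by (rule nn_integral_exhaustion_le[OF meas inc le])
  finally show ?thesis .
qed

lemma \<sigma>_energy:
  assumes W: "\<And>p. W p = (K p)\<^sup>2 / 2"
  shows "energy W \<sigma> \<le> ennreal C"
proof -
  obtain T where off: "lipschitz_off T UNIV \<sigma>"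
    using ploc_lipschitz_curve_imp_lipschitz_off[OF lipschitz_curve_UNIV_imp_ploc[OF \<sigma>_lipschitz]] .
  have "energy W \<sigma> \<le> (\<integral>\<^sup>+s. ennreal ((K (\<sigma> s))\<^sup>2) \<partial>lebesgue)"
    unfolding energy_def
  proof (rule nn_integral_mono_AE)
    show "AE s in lebesgue. ennreal ((metric_derivative UNIV \<sigma> s)\<^sup>2 / 2 + W (\<sigma> s)) \<le> ennreal ((K (\<sigma> s))\<^sup>2)"
      using lipschitz_off_quotient_limit[OF off]
    proof eventually_elim
      fix s assume "s \<in> UNIV \<longrightarrow> (metric_quotient \<sigma> s \<longlongrightarrow> metric_derivative UNIV \<sigma> s) (at s)"
      then have "(metric_derivative UNIV \<sigma> s)\<^sup>2 \<le> (K (\<sigma> s))\<^sup>2"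
        using \<sigma>_speed by (intro power_mono) auto
      then show "ennreal ((metric_derivative UNIV \<sigma> s)\<^sup>2 / 2 + W (\<sigma> s)) \<le> ennreal ((K (\<sigma> s))\<^sup>2)"
        by (intro ennreal_leI) (simp add: W)
    qed
  qed
  also have "\<dots> \<le> ennreal C" by (rule integral_K_\<sigma>_squared)
  finally show ?thesis .
qed

end

context weighted_space
begin

text \<open>
  A point of the geodesic splits the cost of its end points additively, which the strict
  triangle inequality forbids for a zero of \<open>K\<close> other than the end points; those are excluded by
  injectivity.
\<close>

lemma geodesic_avoids_zeros:
  assumes x: "K x = 0" and f: "geodesic x y f" and xy: "x \<noteq> y" and t: "t \<in> {0<..<1}"
    and strict: "\<And>z. z \<notin> {x, y} \<Longrightarrow> K z = 0 \<Longrightarrow> weighted_dist K x y < weighted_dist K x z + weighted_dist K z y"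
  shows "0 < K (f t)"
proof (rule ccontr)
  assume "\<not> 0 < K (f t)"
  then have z: "K (f t) = 0" using K_nonneg[of "f t"] by simp
  have "f t \<noteq> f 0" "f t \<noteq> f 1"
    using inj_onD[OF geodesic_inj[OF f xy], of t 0] inj_onD[OF geodesic_inj[OF f xy], of t 1] t by auto
  then have "f t \<notin> {x, y}" using geodesicD[OF f] by simp
  from strict[OF this z]
  have "ennreal (cost x y) < ennreal (cost x (f t) + cost (f t) y)"
    by (simp add: weighted_dist_eq_cost x z cost_nonneg)
  then have "cost x y < cost x (f t) + cost (f t) y"
    by (subst (asm) ennreal_less_iff) (auto simp: cost_nonneg)
  also have "\<dots> \<le> cost x y * \<bar>t - 0\<bar> + cost x y * \<bar>1 - t\<bar>"
    using geodesicD(3)[OF f, of 0 t] geodesicD(3)[OF f, of t 1] t geodesicD(1,2)[OF f] by (intro add_mono) auto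
  also have "\<dots> = cost x y" using t by (simp add: algebra_simps)
  finally show False by simp
qed

lemma heteroclinic_exists:
  assumes x: "K x = 0" and y: "K y = 0" and W: "\<And>p. W p = (K p)\<^sup>2 / 2"
    and strict: "\<And>z. z \<notin> {x, y} \<Longrightarrow> K z = 0 \<Longrightarrow> weighted_dist K x y < weighted_dist K x z + weighted_dist K z y"
  shows "\<exists>\<gamma>. lipschitz_curve UNIV \<gamma> \<and> joins UNIV \<gamma> x y \<and> energy W \<gamma> \<le> weighted_dist K x y"
proof (cases "x = y")
  case True
  have "metric_derivative UNIV (\<lambda>_. x) t = 0" for t
    unfolding metric_derivative_def by (intro tendsto_Lim) auto
  then have "energy W (\<lambda>_. x) = 0" by (simp add: energy_def W x)
  moreover have "lipschitz_curve UNIV (\<lambda>_. x)"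
    unfolding lipschitz_curve_def by (intro exI[of _ 0]) (auto simp: lipschitz_on_def)
  moreover have "joins UNIV (\<lambda>_. x) x y" using True by (simp add: joins_UNIV_iff)
  ultimately show ?thesis by (intro exI[of _ "\<lambda>_. x"]) auto
next
  case False
  obtain f where f: "geodesic x y f" using ex_geodesic[OF x] .
  interpret zero_free_geodesic K k x y f
    by unfold_locales (use x y False f geodesic_avoids_zeros[OF x f False _ strict] in auto)
  show ?thesis
    using \<sigma>_lipschitz \<sigma>_energy[OF W] \<sigma>_at_bot \<sigma>_at_top \<sigma>_continuous
    by (intro exI[of _ \<sigma>]) (auto simp: joins_UNIV_iff weighted_dist_eq_cost x)
qed

end

theorem theorem3:
  fixes W K :: "'a::metric_space \<Rightarrow> real"
    and k :: "real \<Rightarrow> real"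
    and \<Sigma> :: "'a set"
    and xm xp :: 'a
  assumes W_nonneg: "\<And>x. 0 \<le> W x"
    and W_cont: "continuous_on UNIV W"
    and K_eq: "K = (\<lambda>x. sqrt (2 * W x))"
    and proper: "proper_metric TYPE('a)"
    and length_space: "length_metric TYPE('a)"
    and K_cont: "continuous_on UNIV K"
    and \<Sigma>_eq: "\<Sigma> = {x. K x = 0}"
    and \<Sigma>_finite: "finite \<Sigma>"
    and k_cont: "continuous_on {0..} k"
    and k_nonneg: "\<And>t. 0 \<le> t \<Longrightarrow> 0 \<le> k t"
    and k_integral: "(\<integral>\<^sup>+t\<in>{0..}. ennreal (k t) \<partial>lebesgue) = \<infinity>"
    and K_lower: "\<And>x. k (infdist x \<Sigma>) \<le> K x"
    and W_xm: "W xm = 0"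
    and W_xp: "W xp = 0"
    and strict_triangle: "\<And>x. x \<notin> {xm, xp} \<Longrightarrow> W x = 0 \<Longrightarrow>
           weighted_dist K xm xp < weighted_dist K xm x + weighted_dist K x xp"
  shows "\<exists>\<gamma>. lipschitz_curve UNIV \<gamma> \<and> joins UNIV \<gamma> xm xp \<and>
           energy W \<gamma> =
             Inf {energy W \<sigma> | \<sigma>. ploc_lipschitz_curve UNIV \<sigma> \<and> joins UNIV \<sigma> xm xp} \<and>
           energy W \<gamma> = weighted_dist K xm xp"
proof -
  interpret weighted_space K k
    by unfold_locales
      (use proper length_space K_cont \<Sigma>_finite k_cont k_nonneg k_integral K_lower W_nonneg
        in \<open>auto simp: \<Sigma>_eq K_eq\<close>)
  have W: "W p = (K p)\<^sup>2 / 2" for p using W_nonneg[of p] by (simp add: K_eq)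
  have zero: "K p = 0 \<longleftrightarrow> W p = 0" for p by (simp add: K_eq)
  obtain \<gamma> where \<gamma>: "lipschitz_curve UNIV \<gamma>" "joins UNIV \<gamma> xm xp" "energy W \<gamma> \<le> weighted_dist K xm xp"
    using heteroclinic_exists[of xm xp W] W_xm W_xp W strict_triangle zero by blast
  let ?E = "{energy W \<sigma> | \<sigma>. ploc_lipschitz_curve UNIV \<sigma> \<and> joins UNIV \<sigma> xm xp}"
  have lower: "weighted_dist K xm xp \<le> energy W \<sigma>"
    if "ploc_lipschitz_curve UNIV \<sigma>" "joins UNIV \<sigma> xm xp" for \<sigma>
  proof -
    have "weighted_dist K xm xp \<le> weighted_length K UNIV \<sigma>"
      unfolding weighted_dist_def using that by (intro Inf_lower) blast
    also have "\<dots> \<le> energy W \<sigma>" by (rule weighted_length_le_energy[OF W])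
    finally show ?thesis .
  qed
  have ploc: "ploc_lipschitz_curve UNIV \<gamma>" by (rule lipschitz_curve_UNIV_imp_ploc[OF \<gamma>(1)])
  have eq: "energy W \<gamma> = weighted_dist K xm xp" by (rule antisym[OF \<gamma>(3) lower[OF ploc \<gamma>(2)]])
  have "Inf ?E = energy W \<gamma>"
  proof (rule antisym)
    show "Inf ?E \<le> energy W \<gamma>" using ploc \<gamma>(2) by (intro Inf_lower) blast
    show "energy W \<gamma> \<le> Inf ?E" unfolding eq using lower by (intro Inf_greatest) blast
  qed
  then show ?thesis using \<gamma> eq by auto
qed

end
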